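(* Let $\phi:(G,g)\to(H,h)$ be a homomorphism between two Riemannian Lie groups, let $\xi:\mathfrak g\to\mathfrak h$ be its differential at $e$, let $(e_i)_{i=1}^n$ be an orthonormal basis of $\mathfrak g$, let $B$ be the Levi-Civita product of $\mathfrak h$, and let $K^H(u,v)=[B_u,B_v]-B_{[u,v]}$ be its curvature. Put $U^\xi=\sum_{i=1}^n B_{\xi(e_i)}\xi(e_i)\in\mathfrak h$ and let $U^{\mathfrak g}\in\mathfrak g$ be the vector defined by $\langle U^{\mathfrak g},v\rangle_{\mathfrak g}=\mathrm{tr}(\mathrm{ad}_v)$ for all $v\in\mathfrak g$. Then $\phi$ is harmonic if and only if $$\tau(\xi):=\tau(\phi)(e)=U^\xi-\xi(U^{\mathfrak g})=0,$$ and $\phi$ is biharmonic if and only if $$\tau_2(\xi):=\tau_2(\phi)(e)=-\sum_{i=1}^n\Big(B_{\xi(e_i)}B_{\xi(e_i)}\tau(\xi)+K^H(\tau(\xi),\xi(e_i))\xi(e_i)\Big)+B_{\xi(U^{\mathfrak g})}\tau(\xi)=0.$$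
   Context: All Lie groups are real and connected. A Riemannian Lie group is a Lie group $G$ with a left invariant Riemannian metric $g$; its Lie algebra $\mathfrak g=T_eG$ carries the inner product $\langle\,,\rangle_{\mathfrak g}=g(e)$. The Levi-Civita product $A$ of $(\mathfrak g,\langle\,,\rangle_{\mathfrak g})$ is the bilinear map given by $2\langle A_uv,w\rangle=\langle[u,v],w\rangle+\langle[w,u],v\rangle+\langle[w,v],u\rangle$; equivalently $\nabla_{u^\ell}v^\ell=(A_uv)^\ell$, where $u^\ell$ is the left invariant vector field defined by $u$. For a smooth map $\phi:(M,g)\to(N,h)$ of Riemannian manifolds and a local orthonormal frame $(E_i)$ of $TM$, the tension field is $\tau(\phi)=\sum_i(\nabla_{E_i}d\phi)(E_i)$, a section of $\phi^*TN$, and the bitension field is $\tau_2(\phi)=-\sum_i\big((\nabla^\phi)^2_{E_i,E_i}\tau(\phi)+R^N(\tau(\phi),d\phi(E_i))d\phi(E_i)\big)$, where $\nabla^\phi$ is the pull-back of the Levi-Civita connection of $N$, $(\nabla^\phi)^2_{X,Y}=\nabla^\phi_X\nabla^\phi_Y-\nabla^\phi_{\nabla^M_XY}$ and $R^N(X,Y)=\nabla_X\nabla_Y-\nabla_Y\nabla_X-\nabla_{[X,Y]}$. The map $\phi$ is harmonic if $\tau(\phi)=0$ and biharmonic if $\tau_2(\phi)=0$. *)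

theory Defs
  imports "HOL-Analysis.Analysis" "HOL-Algebra.Group" "HOL-Library.Function_Algebras"
begin

section \<open>Real-valued functions as a real vector space\<close>

text \<open>Together with \<^theory>\<open>HOL-Library.Function_Algebras\<close> this makes tangent vectors (functionals on
  real functions, with pointwise operations) elements of a real vector space.\<close>

instantiation "fun" :: (type, real_vector) real_vector
begin

definition scaleR_fun :: "real \<Rightarrow> ('a \<Rightarrow> 'b) \<Rightarrow> 'a \<Rightarrow> 'b"
  where "scaleR_fun c f = (\<lambda>x. c *\<^sub>R f x)"

instance
  by standard (simp_all add: scaleR_fun_def fun_eq_iff scaleR_add_right scaleR_add_left)

end

section \<open>Smooth functions between Euclidean spaces\<close>

primrec Ck_on :: "nat \<Rightarrow> 'a::euclidean_space set \<Rightarrow> ('a \<Rightarrow> 'b::real_normed_vector) \<Rightarrow> bool" where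
  "Ck_on 0 W f \<longleftrightarrow> continuous_on W f"
| "Ck_on (Suc k) W f \<longleftrightarrow>
     (\<forall>x\<in>W. f differentiable (at x)) \<and> (\<forall>v. Ck_on k W (\<lambda>x. frechet_derivative f (at x) v))"

text \<open>\<^const>\<open>Ck_on\<close> is only meaningful on open sets. On an arbitrary set, smoothness is the existence of
  local smooth extensions; on a relatively open subset of a linear subspace this is ordinary
  smoothness on an open subset of that subspace.\<close>

definition smooth_on :: "'a::euclidean_space set \<Rightarrow> ('a \<Rightarrow> 'b::real_normed_vector) \<Rightarrow> bool" where
  "smooth_on S f \<longleftrightarrow>
     (\<forall>x\<in>S. \<exists>W F. open W \<and> x \<in> W \<and> (\<forall>k. Ck_on k W F) \<and> (\<forall>y\<in>S \<inter> W. F y = f y))"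

section \<open>Smooth manifolds\<close>

text \<open>The model space is a linear subspace of a Euclidean space rather than the whole type, because
  a type of class \<^class>\<open>euclidean_space\<close> has positive dimension; with a subspace, zero-dimensional
  manifolds are included. A chart is a pair of its domain and its coordinate map (of which only the
  values on the domain matter).\<close>

record ('p, 'a) manifold =
  mtop :: "'p topology"
  model :: "'a set"
  charts :: "('p set \<times> ('p \<Rightarrow> 'a)) set"

abbreviation points :: "('p, 'a, 'z) manifold_scheme \<Rightarrow> 'p set"
  where "points M \<equiv> topspace (mtop M)"

definition smooth_manifold :: "('p, 'a::euclidean_space) manifold \<Rightarrow> bool" where
  "smooth_manifold M \<longleftrightarrow>
     Hausdorff_space (mtop M) \<and> second_countable (mtop M) \<and> subspace (model M) \<and>
     (\<forall>(U, \<kappa>)\<in>charts M.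
        openin (mtop M) U \<and> openin (top_of_set (model M)) (\<kappa> ` U) \<and>
        homeomorphic_map (subtopology (mtop M) U) (top_of_set (\<kappa> ` U)) \<kappa>) \<and>
     points M = (\<Union>(U, \<kappa>)\<in>charts M. U) \<and>
     (\<forall>(U, \<kappa>)\<in>charts M. \<forall>(V, \<eta>)\<in>charts M. smooth_on (\<kappa> ` (U \<inter> V)) (\<eta> \<circ> inv_into U \<kappa>))"

definition prod_manifold ::
    "('p, 'a::euclidean_space) manifold \<Rightarrow> ('q, 'b::euclidean_space) manifold \<Rightarrow> ('p \<times> 'q, 'a \<times> 'b) manifold" where
  "prod_manifold M N =
     \<lparr> mtop = prod_topology (mtop M) (mtop N),
       model = model M \<times> model N,
       charts = {(U \<times> V, map_prod \<kappa> \<eta>) | U \<kappa> V \<eta>. (U, \<kappa>) \<in> charts M \<and> (V, \<eta>) \<in> charts N} \<rparr>"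

definition smooth_map ::
    "('p, 'a::euclidean_space) manifold \<Rightarrow> ('q, 'b::euclidean_space) manifold \<Rightarrow> ('p \<Rightarrow> 'q) \<Rightarrow> bool" where
  "smooth_map M N \<phi> \<longleftrightarrow>
     continuous_map (mtop M) (mtop N) \<phi> \<and>
     (\<forall>(U, \<kappa>)\<in>charts M. \<forall>(V, \<eta>)\<in>charts N.
        smooth_on (\<kappa> ` (U \<inter> \<phi> -` V)) (\<eta> \<circ> \<phi> \<circ> inv_into U \<kappa>))"

text \<open>Values outside of the manifold are unconstrained.\<close>

definition smooth_functions :: "('p, 'a::euclidean_space) manifold \<Rightarrow> ('p \<Rightarrow> real) set" where
  "smooth_functions M = {f. \<forall>(U, \<kappa>)\<in>charts M. smooth_on (\<kappa> ` U) (f \<circ> inv_into U \<kappa>)}"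

section \<open>Tangent vectors and vector fields\<close>

text \<open>Tangent vectors are derivations of the algebra of smooth functions, extended by zero to all other
  functions so that equality of tangent vectors is equality of functionals. By the Leibniz rule,
  applied to the indicator function of the complement of the manifold, a derivation at a point of the
  manifold ignores the values of its argument outside of the manifold.\<close>

type_synonym 'p tangent_vector = "('p \<Rightarrow> real) \<Rightarrow> real"
type_synonym ('p, 'q) field_along = "'p \<Rightarrow> 'q tangent_vector"
type_synonym 'p vfield = "('p, 'p) field_along"

definition tangent_space :: "('p, 'a::euclidean_space) manifold \<Rightarrow> 'p \<Rightarrow> 'p tangent_vector set" where
  "tangent_space M p =
     {v. (\<forall>f\<in>smooth_functions M. \<forall>f'\<in>smooth_functions M.
            v (f + f') = v f + v f' \<and> v (f * f') = v f * f' p + f p * v f') \<and>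
         (\<forall>c. \<forall>f\<in>smooth_functions M. v (c *\<^sub>R f) = c * v f) \<and>
         (\<forall>f. f \<notin> smooth_functions M \<longrightarrow> v f = 0)}"

definition differential ::
    "('p, 'a::euclidean_space) manifold \<Rightarrow> ('q, 'b::euclidean_space) manifold \<Rightarrow> ('p \<Rightarrow> 'q) \<Rightarrow>
     'p \<Rightarrow> 'p tangent_vector \<Rightarrow> 'q tangent_vector" where
  "differential M N \<phi> p v = (\<lambda>f. if f \<in> smooth_functions N then v (f \<circ> \<phi>) else 0)"

text \<open>Smooth sections of the pull-back of the tangent bundle of \<open>N\<close> under \<open>\<phi>\<close>.\<close>

definition sections_along ::
    "('p, 'a::euclidean_space) manifold \<Rightarrow> ('q, 'b::euclidean_space) manifold \<Rightarrow> ('p \<Rightarrow> 'q) \<Rightarrow>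
     ('p, 'q) field_along set" where
  "sections_along M N \<phi> =
     {V. (\<forall>p\<in>points M. V p \<in> tangent_space N (\<phi> p)) \<and>
         (\<forall>f\<in>smooth_functions N. (\<lambda>p. V p f) \<in> smooth_functions M)}"

definition vector_fields :: "('p, 'a::euclidean_space) manifold \<Rightarrow> 'p vfield set" where
  "vector_fields M = sections_along M M (\<lambda>p. p)"

definition vf_bracket :: "'p vfield \<Rightarrow> 'p vfield \<Rightarrow> 'p vfield" where
  "vf_bracket X Y p = (\<lambda>f. X p (\<lambda>q. Y q f) - Y p (\<lambda>q. X q f))"

section \<open>Riemannian metrics and connections\<close>

type_synonym 'p metric = "'p \<Rightarrow> 'p tangent_vector \<Rightarrow> 'p tangent_vector \<Rightarrow> real"

definition riemannian_metric :: "('p, 'a::euclidean_space) manifold \<Rightarrow> 'p metric \<Rightarrow> bool" where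
  "riemannian_metric M g \<longleftrightarrow>
     (\<forall>p\<in>points M. \<forall>u\<in>tangent_space M p.
        (\<forall>v\<in>tangent_space M p. g p u v = g p v u) \<and>
        (\<forall>v\<in>tangent_space M p. \<forall>w\<in>tangent_space M p. g p u (v + w) = g p u v + g p u w) \<and>
        (\<forall>c. \<forall>v\<in>tangent_space M p. g p u (c *\<^sub>R v) = c * g p u v) \<and>
        (u \<noteq> 0 \<longrightarrow> g p u u > 0)) \<and>
     (\<forall>X\<in>vector_fields M. \<forall>Y\<in>vector_fields M. (\<lambda>p. g p (X p) (Y p)) \<in> smooth_functions M)"

definition orthonormal_basis ::
    "'v::real_vector set \<Rightarrow> ('v \<Rightarrow> 'v \<Rightarrow> real) \<Rightarrow> nat \<Rightarrow> (nat \<Rightarrow> 'v) \<Rightarrow> bool" where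
  "orthonormal_basis V ip n e \<longleftrightarrow>
     (\<forall>i<n. e i \<in> V) \<and>
     (\<forall>i<n. \<forall>j<n. ip (e i) (e j) = (if i = j then 1 else 0)) \<and>
     V = span (e ` {..<n})"

text \<open>A connection on the pull-back bundle is a map taking a point \<open>p\<close>, a tangent vector \<open>v\<close> at \<open>p\<close> and a
  section \<open>V\<close> to the covariant derivative of \<open>V\<close> in direction \<open>v\<close>. For \<open>N = M\<close> and the identity map
  this is an affine connection.\<close>

type_synonym ('p, 'q) connection = "'p \<Rightarrow> 'p tangent_vector \<Rightarrow> ('p, 'q) field_along \<Rightarrow> 'q tangent_vector"

definition is_connection ::
    "('p, 'a::euclidean_space) manifold \<Rightarrow> ('q, 'b::euclidean_space) manifold \<Rightarrow> ('p \<Rightarrow> 'q) \<Rightarrow>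
     ('p, 'q) connection \<Rightarrow> bool" where
  "is_connection M N \<phi> D \<longleftrightarrow>
     (\<forall>p\<in>points M. \<forall>u\<in>tangent_space M p. \<forall>V\<in>sections_along M N \<phi>.
        D p u V \<in> tangent_space N (\<phi> p) \<and>
        (\<forall>v\<in>tangent_space M p. D p (u + v) V = D p u V + D p v V) \<and>
        (\<forall>c. D p (c *\<^sub>R u) V = c *\<^sub>R D p u V) \<and>
        (\<forall>V'\<in>sections_along M N \<phi>. D p u (V + V') = D p u V + D p u V') \<and>
        (\<forall>f\<in>smooth_functions M. D p u (\<lambda>q. f q *\<^sub>R V q) = u f *\<^sub>R V p + f p *\<^sub>R D p u V)) \<and>
     (\<forall>X\<in>vector_fields M. \<forall>V\<in>sections_along M N \<phi>. (\<lambda>p. D p (X p) V) \<in> sections_along M N \<phi>)"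

definition is_levi_civita ::
    "('p, 'a::euclidean_space) manifold \<Rightarrow> 'p metric \<Rightarrow> ('p, 'p) connection \<Rightarrow> bool" where
  "is_levi_civita M g D \<longleftrightarrow>
     is_connection M M (\<lambda>p. p) D \<and>
     (\<forall>X\<in>vector_fields M. \<forall>Y\<in>vector_fields M. \<forall>p\<in>points M.
        D p (X p) Y - D p (Y p) X = vf_bracket X Y p) \<and>
     (\<forall>X\<in>vector_fields M. \<forall>Y\<in>vector_fields M. \<forall>p\<in>points M. \<forall>v\<in>tangent_space M p.
        v (\<lambda>q. g q (X q) (Y q)) = g p (D p v X) (Y p) + g p (X p) (D p v Y))"

text \<open>Existence and uniqueness hold by the fundamental theorem of Riemannian geometry; uniqueness is up
  to the irrelevant values at arguments that are not points, tangent vectors or smooth sections,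
  whence the choice operator. The same applies to the pull-back connection.\<close>

definition levi_civita ::
    "('p, 'a::euclidean_space) manifold \<Rightarrow> 'p metric \<Rightarrow> ('p, 'p) connection" where
  "levi_civita M g = (SOME D. is_levi_civita M g D)"

definition pullback_connection ::
    "('p, 'a::euclidean_space) manifold \<Rightarrow> ('q, 'b::euclidean_space) manifold \<Rightarrow> ('p \<Rightarrow> 'q) \<Rightarrow>
     ('q, 'q) connection \<Rightarrow> ('p, 'q) connection" where
  "pullback_connection M N \<phi> DN =
     (SOME D. is_connection M N \<phi> D \<and>
        (\<forall>p\<in>points M. \<forall>v\<in>tangent_space M p. \<forall>Y\<in>vector_fields N.
           D p v (Y \<circ> \<phi>) = DN (\<phi> p) (differential M N \<phi> p v) Y))"

text \<open>\<open>R(u, v)w\<close> at \<open>p\<close>, computed by extending the three tangent vectors to vector fields; the result does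
  not depend on the extensions.\<close>

definition vf_extension ::
    "('p, 'a::euclidean_space) manifold \<Rightarrow> 'p \<Rightarrow> 'p tangent_vector \<Rightarrow> 'p vfield" where
  "vf_extension M p u = (SOME X. X \<in> vector_fields M \<and> X p = u)"

definition curvature ::
    "('p, 'a::euclidean_space) manifold \<Rightarrow> 'p metric \<Rightarrow>
     'p \<Rightarrow> 'p tangent_vector \<Rightarrow> 'p tangent_vector \<Rightarrow> 'p tangent_vector \<Rightarrow> 'p tangent_vector" where
  "curvature M g p u v w =
     (let D = levi_civita M g;
          X = vf_extension M p u; Y = vf_extension M p v; Z = vf_extension M p w
      in D p (X p) (\<lambda>q. D q (Y q) Z) - D p (Y p) (\<lambda>q. D q (X q) Z) - D p (vf_bracket X Y p) Z)"

section \<open>Tension and bitension fields\<close>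

text \<open>A local orthonormal frame around \<open>p\<close> is given by global smooth vector fields that are orthonormal on
  a neighbourhood of \<open>p\<close>: every local frame agrees with such a family near \<open>p\<close>. The tension and
  bitension fields at \<open>p\<close> do not depend on the choice of the frame.\<close>

definition local_orthonormal_frame ::
    "('p, 'a::euclidean_space) manifold \<Rightarrow> 'p metric \<Rightarrow> 'p \<Rightarrow> (nat \<Rightarrow> 'p vfield) \<Rightarrow> bool" where
  "local_orthonormal_frame M g p E \<longleftrightarrow>
     (\<forall>i<dim (tangent_space M p). E i \<in> vector_fields M) \<and>
     (\<exists>U. openin (mtop M) U \<and> p \<in> U \<and>
        (\<forall>q\<in>U. orthonormal_basis (tangent_space M q) (g q) (dim (tangent_space M p)) (\<lambda>i. E i q)))"

definition some_frame ::
    "('p, 'a::euclidean_space) manifold \<Rightarrow> 'p metric \<Rightarrow> 'p \<Rightarrow> nat \<Rightarrow> 'p vfield" where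
  "some_frame M g p = (SOME E. local_orthonormal_frame M g p E)"

text \<open>\<open>(\<nabla>\<^sub>v d\<phi>)(Y) = \<nabla>\<^sup>\<phi>\<^sub>v (d\<phi>(Y)) - d\<phi>(\<nabla>\<^sub>v Y)\<close>\<close>

definition second_fundamental_form ::
    "('p, 'a::euclidean_space) manifold \<Rightarrow> 'p metric \<Rightarrow> ('q, 'b::euclidean_space) manifold \<Rightarrow> 'q metric \<Rightarrow>
     ('p \<Rightarrow> 'q) \<Rightarrow> 'p \<Rightarrow> 'p tangent_vector \<Rightarrow> 'p vfield \<Rightarrow> 'q tangent_vector" where
  "second_fundamental_form M g N h \<phi> p v Y =
     pullback_connection M N \<phi> (levi_civita N h) p v (\<lambda>q. differential M N \<phi> q (Y q))
     - differential M N \<phi> p (levi_civita M g p v Y)"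

definition tension ::
    "('p, 'a::euclidean_space) manifold \<Rightarrow> 'p metric \<Rightarrow> ('q, 'b::euclidean_space) manifold \<Rightarrow> 'q metric \<Rightarrow>
     ('p \<Rightarrow> 'q) \<Rightarrow> ('p, 'q) field_along" where
  "tension M g N h \<phi> p =
     (let E = some_frame M g p
      in \<Sum>i<dim (tangent_space M p). second_fundamental_form M g N h \<phi> p (E i p) (E i))"

definition bitension ::
    "('p, 'a::euclidean_space) manifold \<Rightarrow> 'p metric \<Rightarrow> ('q, 'b::euclidean_space) manifold \<Rightarrow> 'q metric \<Rightarrow>
     ('p \<Rightarrow> 'q) \<Rightarrow> ('p, 'q) field_along" where
  "bitension M g N h \<phi> p =
     (let E = some_frame M g p;
          DM = levi_civita M g;
          D = pullback_connection M N \<phi> (levi_civita N h);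
          \<tau> = tension M g N h \<phi>
      in - (\<Sum>i<dim (tangent_space M p).
              (D p (E i p) (\<lambda>q. D q (E i q) \<tau>) - D p (DM p (E i p) (E i)) \<tau>)
              + curvature N h (\<phi> p) (\<tau> p)
                  (differential M N \<phi> p (E i p)) (differential M N \<phi> p (E i p))))"

definition harmonic ::
    "('p, 'a::euclidean_space) manifold \<Rightarrow> 'p metric \<Rightarrow> ('q, 'b::euclidean_space) manifold \<Rightarrow> 'q metric \<Rightarrow>
     ('p \<Rightarrow> 'q) \<Rightarrow> bool" where
  "harmonic M g N h \<phi> \<longleftrightarrow> (\<forall>p\<in>points M. tension M g N h \<phi> p = 0)"

definition biharmonic ::
    "('p, 'a::euclidean_space) manifold \<Rightarrow> 'p metric \<Rightarrow> ('q, 'b::euclidean_space) manifold \<Rightarrow> 'q metric \<Rightarrow>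
     ('p \<Rightarrow> 'q) \<Rightarrow> bool" where
  "biharmonic M g N h \<phi> \<longleftrightarrow> (\<forall>p\<in>points M. bitension M g N h \<phi> p = 0)"

section \<open>Riemannian Lie groups\<close>

definition lie_group :: "'p monoid \<Rightarrow> ('p, 'a::euclidean_space) manifold \<Rightarrow> bool" where
  "lie_group G M \<longleftrightarrow>
     group G \<and> smooth_manifold M \<and> carrier G = points M \<and> connected_space (mtop M) \<and>
     smooth_map (prod_manifold M M) M (\<lambda>(x, y). x \<otimes>\<^bsub>G\<^esub> y) \<and>
     smooth_map M M (\<lambda>x. inv\<^bsub>G\<^esub> x)"

definition left_invariant_metric ::
    "'p monoid \<Rightarrow> ('p, 'a::euclidean_space) manifold \<Rightarrow> 'p metric \<Rightarrow> bool" where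
  "left_invariant_metric G M g \<longleftrightarrow>
     (\<forall>a\<in>carrier G. \<forall>p\<in>carrier G. \<forall>u\<in>tangent_space M p. \<forall>v\<in>tangent_space M p.
        g (a \<otimes>\<^bsub>G\<^esub> p) (differential M M (\<lambda>x. a \<otimes>\<^bsub>G\<^esub> x) p u) (differential M M (\<lambda>x. a \<otimes>\<^bsub>G\<^esub> x) p v)
        = g p u v)"

definition riemannian_lie_group ::
    "'p monoid \<Rightarrow> ('p, 'a::euclidean_space) manifold \<Rightarrow> 'p metric \<Rightarrow> bool" where
  "riemannian_lie_group G M g \<longleftrightarrow>
     lie_group G M \<and> riemannian_metric M g \<and> left_invariant_metric G M g"

definition lie_algebra :: "'p monoid \<Rightarrow> ('p, 'a::euclidean_space) manifold \<Rightarrow> 'p tangent_vector set" where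
  "lie_algebra G M = tangent_space M \<one>\<^bsub>G\<^esub>"

definition left_invariant_field ::
    "'p monoid \<Rightarrow> ('p, 'a::euclidean_space) manifold \<Rightarrow> 'p tangent_vector \<Rightarrow> 'p vfield" where
  "left_invariant_field G M u a = differential M M (\<lambda>x. a \<otimes>\<^bsub>G\<^esub> x) \<one>\<^bsub>G\<^esub> u"

definition lie_bracket ::
    "'p monoid \<Rightarrow> ('p, 'a::euclidean_space) manifold \<Rightarrow>
     'p tangent_vector \<Rightarrow> 'p tangent_vector \<Rightarrow> 'p tangent_vector" where
  "lie_bracket G M u v = vf_bracket (left_invariant_field G M u) (left_invariant_field G M v) \<one>\<^bsub>G\<^esub>"

definition levi_civita_product ::
    "'p monoid \<Rightarrow> ('p, 'a::euclidean_space) manifold \<Rightarrow> 'p metric \<Rightarrow>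
     'p tangent_vector \<Rightarrow> 'p tangent_vector \<Rightarrow> 'p tangent_vector" where
  "levi_civita_product G M g u v =
     (THE a. a \<in> lie_algebra G M \<and>
        (\<forall>w\<in>lie_algebra G M.
           2 * g \<one>\<^bsub>G\<^esub> a w =
             g \<one>\<^bsub>G\<^esub> (lie_bracket G M u v) w + g \<one>\<^bsub>G\<^esub> (lie_bracket G M w u) v
             + g \<one>\<^bsub>G\<^esub> (lie_bracket G M w v) u))"

definition lie_curvature ::
    "'p monoid \<Rightarrow> ('p, 'a::euclidean_space) manifold \<Rightarrow> 'p metric \<Rightarrow>
     'p tangent_vector \<Rightarrow> 'p tangent_vector \<Rightarrow> 'p tangent_vector \<Rightarrow> 'p tangent_vector" where
  "lie_curvature G M g u v w =
     (let B = levi_civita_product G M g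
      in B u (B v w) - B v (B u w) - B (lie_bracket G M u v) w)"

text \<open>Trace of an endomorphism of a finite-dimensional subspace: the sum of the diagonal coefficients
  with respect to any basis.\<close>

definition trace_on :: "'v::real_vector set \<Rightarrow> ('v \<Rightarrow> 'v) \<Rightarrow> real" where
  "trace_on V L =
     (let S = (SOME S. independent S \<and> span S = V) in \<Sum>b\<in>S. representation S (L b) b)"

end

theory Submission
  imports Defs
begin

text \<open>Left translation turns sections along a map into a Lie group into functions with values in the
  Lie algebra. In this trivialization every connection is the componentwise derivative plus a bilinear
  term; for the Levi-Civita connection the Koszul formula identifies that term with the Levi-Civita
  product, and for its pull-back with \<open>B \<circ> \<xi>\<close>. Since \<open>d\<phi>\<close> intertwines left translations, the derivatives
  cancel in all tensorial expressions: the second fundamental form at any point is the left translate of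
  \<open>B (\<xi> u) (\<xi> w) - \<xi> (A u w)\<close>, its trace the left translate of a constant, and likewise for the
  bitension field; both traces are independent of the frame. Finally \<open>\<Sum>\<^sub>i A e\<^sub>i e\<^sub>i = U\<close>, as \<open>A\<close> is skew.

  Tangent vectors are abstract derivations, so Hadamard's lemma and cut-off functions are needed to
  write them in coordinates. This yields the finite dimension of the Lie algebra and the smoothness of
  left translates of sections.\<close>

text \<open>The objects of the statement are picked by \<open>SOME\<close>: the Levi-Civita
  connection, its pull-back, the extensions in the curvature and the frame at each point. Only their
  defining properties are known, so each choice needs a witness (the explicit trivialized
  connection, the left invariant fields) and each result has to hold for every admissible choice. In
  particular the chosen frame may change arbitrarily with the base point and may fail to be left
  invariant, so derivatives of its trivialization do occur and must be seen to cancel. They do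
  because \<xi> is one fixed linear map: it sends u to the functional k -> u (k o \<phi>) whatever
  the base point, hence commutes with differentiation of Lie algebra valued functions. A second
  obstacle is that functions and fields live on a whole type while identities between them hold only
  on the manifold. Derivations and connections do not respect such identities by definition; their
  Leibniz rules, applied to the indicator function of the complement, show that they do.\<close>

section \<open>Calculus of smooth functions\<close>

text \<open>Recognizing \<open>frechet_derivative f\<close> as \<open>f'\<close> is possible only on
  W, so a congruence rule of order k is required. It is a premise because \<open>Ck_on_cong\<close>
  is itself proved by induction through this lemma, with the induction hypothesis in its place;
  \<open>Ck_on_SucI'\<close> discharges it.\<close>

lemma Ck_on_SucI:
  assumes "\<And>x. x \<in> W \<Longrightarrow> (f has_derivative f' x) (at x)"
    and "\<And>v. Ck_on k W (\<lambda>x. f' x v)" and "open W"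
    and cong: "\<And>(f :: 'a \<Rightarrow> 'b) g. (\<And>x. x \<in> W \<Longrightarrow> f x = g x) \<Longrightarrow> Ck_on k W f \<Longrightarrow> Ck_on k W g"
  shows "Ck_on (Suc k) W (f :: 'a::euclidean_space \<Rightarrow> 'b::real_normed_vector)"
proof -
  have "Ck_on k W (\<lambda>x. frechet_derivative f (at x) v)" for v
    by (rule cong[OF _ assms(2)[of v]]) (use assms(1) frechet_derivative_at in metis)
  then show ?thesis
    using assms(1) by (auto simp: differentiable_def)
qed

lemma Ck_on_cong:
  assumes "open W" "\<And>x. x \<in> W \<Longrightarrow> f x = g x" "Ck_on k W f"
  shows "Ck_on k W (g :: 'a::euclidean_space \<Rightarrow> 'b::real_normed_vector)"
  using assms(2,3)
proof (induction k arbitrary: f g)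
  case 0
  then show ?case by (metis Ck_on.simps(1) continuous_on_cong)
next
  case (Suc k)
  have d: "(g has_derivative frechet_derivative f (at x)) (at x)" if "x \<in> W" for x
    by (rule has_derivative_transform_within_open[of f])
      (use Suc.prems that assms(1) in \<open>auto simp: frechet_derivative_works[symmetric]\<close>)
  show ?case
    by (rule Ck_on_SucI[OF d]) (use Suc assms(1) in auto)
qed

lemmas Ck_on_SucI' = Ck_on_SucI[OF _ _ _ Ck_on_cong]

lemma Ck_on_SucD:
  assumes "Ck_on (Suc k) W (f :: 'a::euclidean_space \<Rightarrow> 'b::real_normed_vector)"
  shows "Ck_on k W f"
  using assms
proof (induction k arbitrary: f)
  case 0
  then show ?case
    by (auto intro!: continuous_at_imp_continuous_on differentiable_imp_continuous_within)
qed simp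

lemma Ck_on_subset:
  assumes "Ck_on k W (f :: 'a::euclidean_space \<Rightarrow> 'b::real_normed_vector)" "W' \<subseteq> W"
  shows "Ck_on k W' f"
  using assms
  by (induction k arbitrary: f) (auto intro: continuous_on_subset)

lemma Ck_on_local:
  assumes "\<And>x. x \<in> W \<Longrightarrow> \<exists>W'. open W' \<and> x \<in> W' \<and> Ck_on k W' f"
  shows "Ck_on k W (f :: 'a::euclidean_space \<Rightarrow> 'b::real_normed_vector)"
  using assms
proof (induction k arbitrary: f)
  case 0
  have "isCont f x" if "x \<in> W" for x
  proof -
    obtain W' where "open W'" "x \<in> W'" "continuous_on W' f" using 0 \<open>x \<in> W\<close> by auto
    then show ?thesis by (simp add: continuous_on_eq_continuous_at)
  qed
  then show ?case by (simp add: continuous_at_imp_continuous_on)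
next
  case (Suc k)
  then show ?case by simp meson
qed

text \<open>Openness is included so that one predicate describes the local extensions in
  \<open>smooth_on\<close> and \<open>Ck_on\<close> is meaningful.\<close>

definition Cinf_on :: "'a::euclidean_space set \<Rightarrow> ('a \<Rightarrow> 'b::real_normed_vector) \<Rightarrow> bool" where
  "Cinf_on W f \<longleftrightarrow> open W \<and> (\<forall>k. Ck_on k W f)"

lemma Cinf_on_open: "Cinf_on W f \<Longrightarrow> open W"
  by (simp add: Cinf_on_def)

lemma Cinf_on_subset: "Cinf_on W f \<Longrightarrow> open W' \<Longrightarrow> W' \<subseteq> W \<Longrightarrow> Cinf_on W' f"
  by (auto simp: Cinf_on_def intro: Ck_on_subset)

lemma Cinf_on_cong: "Cinf_on W f \<Longrightarrow> (\<And>x. x \<in> W \<Longrightarrow> f x = g x) \<Longrightarrow> Cinf_on W g"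
  by (auto simp: Cinf_on_def intro: Ck_on_cong)

lemma Cinf_on_has_derivative:
  "Cinf_on W f \<Longrightarrow> x \<in> W \<Longrightarrow> (f has_derivative frechet_derivative f (at x)) (at x)"
  unfolding Cinf_on_def by (metis Ck_on.simps(2) frechet_derivative_works)

lemma Cinf_on_derivative: "Cinf_on W f \<Longrightarrow> Cinf_on W (\<lambda>x. frechet_derivative f (at x) v)"
  unfolding Cinf_on_def by (metis Ck_on.simps(2))

lemma Cinf_on_continuous: "Cinf_on W f \<Longrightarrow> continuous_on W f"
  unfolding Cinf_on_def by (metis Ck_on.simps(1))

lemma Ck_on_const: "Ck_on k W (\<lambda>_::'a::euclidean_space. c :: 'b::real_normed_vector)"
  by (induction k arbitrary: c) (auto simp: frechet_derivative_const)

lemma Ck_on_bounded_linear: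
  assumes "bounded_linear f" "open W"
  shows "Ck_on k W (f :: 'a::euclidean_space \<Rightarrow> 'b::real_normed_vector)"
proof (cases k)
  case 0
  then show ?thesis using assms(1) by (simp add: linear_continuous_on)
next
  case (Suc l)
  show ?thesis unfolding Suc
    by (rule Ck_on_SucI'[of _ _ "\<lambda>_. f"])
      (use assms in \<open>auto intro: bounded_linear_imp_has_derivative Ck_on_const\<close>)
qed

lemma Ck_on_bounded_linear_comp:
  assumes L: "bounded_linear L" and "open W" and "Ck_on k W f"
  shows "Ck_on k W (\<lambda>x::'a::euclidean_space. L (f x :: 'b::real_normed_vector) :: 'c::real_normed_vector)"
  using assms(3)
proof (induction k arbitrary: f)
  case 0
  then show ?case using bounded_linear.continuous_on[OF L] by auto
next
  case (Suc k)
  show ?case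
  proof (rule Ck_on_SucI'[of _ _ "\<lambda>x v. L (frechet_derivative f (at x) v)"])
    fix x assume "x \<in> W"
    then have "(f has_derivative frechet_derivative f (at x)) (at x)"
      using Suc.prems by (simp add: frechet_derivative_works[symmetric])
    then show "((\<lambda>x. L (f x)) has_derivative (\<lambda>v. L (frechet_derivative f (at x) v))) (at x)"
      by (rule bounded_linear.has_derivative[OF L])
  qed (use Suc assms(2) in auto)
qed

lemma Ck_on_add:
  assumes "open W" "Ck_on k W f" "Ck_on k W g"
  shows "Ck_on k W (\<lambda>x::'a::euclidean_space. f x + g x :: 'b::real_normed_vector)"
  using assms(2,3)
proof (induction k arbitrary: f g)
  case (Suc k)
  show ?case
    by (rule Ck_on_SucI'[of _ _ "\<lambda>x v. frechet_derivative f (at x) v + frechet_derivative g (at x) v"])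
      (use Suc assms(1) in \<open>auto simp: frechet_derivative_works[symmetric] intro!: has_derivative_add\<close>)
qed (auto intro: continuous_intros)

lemma Ck_on_sum:
  assumes "open W" "\<And>i. i \<in> I \<Longrightarrow> Ck_on k W (f i)"
  shows "Ck_on k W (\<lambda>x::'a::euclidean_space. \<Sum>i\<in>I. f i x :: 'b::real_normed_vector)"
  using assms(2)
  by (induction I rule: infinite_finite_induct) (auto intro: Ck_on_const Ck_on_add assms(1))

lemma Ck_on_scaleR:
  assumes "open W" "Ck_on k W f" "Ck_on k W g"
  shows "Ck_on k W (\<lambda>x::'a::euclidean_space. f x *\<^sub>R (g x :: 'b::real_normed_vector))"
  using assms(2,3)
proof (induction k arbitrary: f g)
  case (Suc k)
  show ?case
  proof (rule Ck_on_SucI'[of _ _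
        "\<lambda>x v. f x *\<^sub>R frechet_derivative g (at x) v + frechet_derivative f (at x) v *\<^sub>R g x"])
    fix x assume "x \<in> W"
    then have "(f has_derivative frechet_derivative f (at x)) (at x)"
      "(g has_derivative frechet_derivative g (at x)) (at x)"
      using Suc.prems by (simp_all add: frechet_derivative_works[symmetric])
    then show "((\<lambda>x. f x *\<^sub>R g x) has_derivative
        (\<lambda>v. f x *\<^sub>R frechet_derivative g (at x) v + frechet_derivative f (at x) v *\<^sub>R g x)) (at x)"
      by (rule has_derivative_scaleR)
  next
    fix v
    show "Ck_on k W (\<lambda>x. f x *\<^sub>R frechet_derivative g (at x) v + frechet_derivative f (at x) v *\<^sub>R g x)"
      using Suc.prems Ck_on_SucD[OF Suc.prems(1)] Ck_on_SucD[OF Suc.prems(2)]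
      by (intro Ck_on_add assms(1) Suc.IH) auto
  qed (use assms(1) in auto)
qed (auto intro: continuous_intros)

lemma Ck_on_Pair:
  assumes "open W" "Ck_on k W f" "Ck_on k W g"
  shows "Ck_on k W (\<lambda>x::'a::euclidean_space. (f x :: 'b::real_normed_vector, g x :: 'c::real_normed_vector))"
  using assms(2,3)
proof (induction k arbitrary: f g)
  case (Suc k)
  show ?case
    by (rule Ck_on_SucI'[of _ _ "\<lambda>x v. (frechet_derivative f (at x) v, frechet_derivative g (at x) v)"])
      (use Suc assms(1) in \<open>auto simp: frechet_derivative_works[symmetric] intro!: has_derivative_Pair\<close>)
qed (auto intro: continuous_intros)

text \<open>The direction \<open>frechet_derivative f (at x) v\<close> moves with x, while
  \<open>Ck_on\<close> controls only fixed directions. The chain rule is therefore expanded in the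
  standard basis into products of a component of the derivative of \<open>f\<close> and a partial
  derivative of \<open>g\<close> composed with \<open>f\<close>; the latter is covered by the
  induction hypothesis, where \<open>g\<close> is arbitrary.\<close>

lemma Ck_on_compose:
  fixes f :: "'a::euclidean_space \<Rightarrow> 'b::euclidean_space" and g :: "'b \<Rightarrow> 'c::real_normed_vector"
  assumes "open W" "open W'" "f ` W \<subseteq> W'" "Ck_on k W f" "Ck_on k W' g"
  shows "Ck_on k W (\<lambda>x. g (f x))"
  using assms(4,5)
proof (induction k arbitrary: g)
  case 0
  then show ?case using assms(3) by (auto intro: continuous_on_compose2)
next
  case (Suc k)
  let ?d = "\<lambda>x v. \<Sum>b\<in>Basis. (frechet_derivative f (at x) v \<bullet> b) *\<^sub>R frechet_derivative g (at (f x)) b"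
  show ?case
  proof (rule Ck_on_SucI'[of _ _ ?d])
    fix x assume x: "x \<in> W"
    have f: "(f has_derivative frechet_derivative f (at x)) (at x)"
      using Suc.prems x by (simp add: frechet_derivative_works[symmetric])
    have g: "(g has_derivative frechet_derivative g (at (f x))) (at (f x))"
      using Suc.prems x assms(3) by (auto simp: frechet_derivative_works[symmetric])
    interpret L: bounded_linear "frechet_derivative g (at (f x))"
      using g by (rule has_derivative_bounded_linear)
    have "frechet_derivative g (at (f x)) (frechet_derivative f (at x) v) = ?d x v" for v
      by (subst euclidean_representation[symmetric, of "frechet_derivative f (at x) v"])
        (simp only: L.sum L.scaleR)
    then show "((\<lambda>x. g (f x)) has_derivative ?d x) (at x)"
      using diff_chain_at[OF f g] by (simp add: comp_def)
  next
    fix v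
    show "Ck_on k W (\<lambda>x. ?d x v)"
    proof (intro Ck_on_sum Ck_on_scaleR assms(1))
      fix b :: 'b
      show "Ck_on k W (\<lambda>x. frechet_derivative f (at x) v \<bullet> b)"
        using Suc.prems by (intro Ck_on_bounded_linear_comp[OF bounded_linear_inner_left assms(1)]) auto
      show "Ck_on k W (\<lambda>x. frechet_derivative g (at (f x)) b)"
        using Suc.prems(2) by (intro Suc.IH Ck_on_SucD[OF Suc.prems(1)]) auto
    qed
  qed (use assms(1) in auto)
qed

lemma Cinf_on_const: "open W \<Longrightarrow> Cinf_on W (\<lambda>_. c)"
  by (simp add: Cinf_on_def Ck_on_const)

lemma Cinf_on_bounded_linear: "open W \<Longrightarrow> bounded_linear f \<Longrightarrow> Cinf_on W f"
  by (simp add: Cinf_on_def Ck_on_bounded_linear)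

lemma Cinf_on_add: "Cinf_on W f \<Longrightarrow> Cinf_on W g \<Longrightarrow> Cinf_on W (\<lambda>x. f x + g x)"
  by (simp add: Cinf_on_def Ck_on_add)

lemma Cinf_on_sum: "open W \<Longrightarrow> (\<And>i. i \<in> I \<Longrightarrow> Cinf_on W (f i)) \<Longrightarrow> Cinf_on W (\<lambda>x. \<Sum>i\<in>I. f i x)"
  by (simp add: Cinf_on_def Ck_on_sum)

lemma Cinf_on_scaleR: "Cinf_on W f \<Longrightarrow> Cinf_on W g \<Longrightarrow> Cinf_on W (\<lambda>x. f x *\<^sub>R g x)"
  by (simp add: Cinf_on_def Ck_on_scaleR)

lemma Cinf_on_mult:
  "Cinf_on W f \<Longrightarrow> Cinf_on W g \<Longrightarrow> Cinf_on W (\<lambda>x. f x * g x :: real)"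
  using Cinf_on_scaleR[of W f g] by simp

lemma Cinf_on_Pair: "Cinf_on W f \<Longrightarrow> Cinf_on W g \<Longrightarrow> Cinf_on W (\<lambda>x. (f x, g x))"
  by (simp add: Cinf_on_def Ck_on_Pair)

lemma Cinf_on_compose:
  "Cinf_on W f \<Longrightarrow> Cinf_on W' g \<Longrightarrow> f ` W \<subseteq> W' \<Longrightarrow> Cinf_on W (\<lambda>x. g (f x))"
  by (auto simp: Cinf_on_def intro: Ck_on_compose)

section \<open>Smoothness on arbitrary sets through local extensions\<close>

lemma smooth_on_iff:
  "smooth_on S f \<longleftrightarrow> (\<forall>x\<in>S. \<exists>W F. x \<in> W \<and> Cinf_on W F \<and> (\<forall>y\<in>S \<inter> W. F y = f y))"
  unfolding smooth_on_def Cinf_on_def by (intro ball_cong) auto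

lemma smooth_onD:
  "smooth_on S f \<Longrightarrow> x \<in> S \<Longrightarrow> \<exists>W F. x \<in> W \<and> Cinf_on W F \<and> (\<forall>y\<in>S \<inter> W. F y = f y)"
  unfolding smooth_on_iff by blast

lemma Cinf_on_imp_smooth_on: "Cinf_on W f \<Longrightarrow> S \<subseteq> W \<Longrightarrow> smooth_on S f"
  unfolding smooth_on_iff by blast

lemma smooth_on_cong: "smooth_on S f \<Longrightarrow> (\<And>x. x \<in> S \<Longrightarrow> f x = g x) \<Longrightarrow> smooth_on S g"
  unfolding smooth_on_iff by simp

lemma smooth_on_subset: "smooth_on S f \<Longrightarrow> T \<subseteq> S \<Longrightarrow> smooth_on T f"
  unfolding smooth_on_iff by (meson Int_iff subsetD)

lemma smooth_on_local:
  assumes "\<And>x. x \<in> S \<Longrightarrow> \<exists>T. open T \<and> x \<in> T \<and> smooth_on (S \<inter> T) f"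
  shows "smooth_on S f"
  unfolding smooth_on_iff
proof
  fix x assume "x \<in> S"
  then obtain T where T: "open T" "x \<in> T" "smooth_on (S \<inter> T) f" using assms by blast
  then have "x \<in> S \<inter> T" using \<open>x \<in> S\<close> by simp
  obtain W F where W: "x \<in> W" "Cinf_on W F" "\<forall>y\<in>(S \<inter> T) \<inter> W. F y = f y"
    using smooth_onD[OF T(3) \<open>x \<in> S \<inter> T\<close>] by blast
  have "Cinf_on (W \<inter> T) F"
    by (intro Cinf_on_subset[OF W(2)] open_Int T(1) Cinf_on_open[OF W(2)]) auto
  then show "\<exists>W F. x \<in> W \<and> Cinf_on W F \<and> (\<forall>y\<in>S \<inter> W. F y = f y)"
    using T W by (intro exI[of _ "W \<inter> T"] exI[of _ F]) auto
qed

lemma smooth_on_compose: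
  fixes f :: "'a::euclidean_space \<Rightarrow> 'b::euclidean_space" and g :: "'b \<Rightarrow> 'c::real_normed_vector"
  assumes "smooth_on S f" "smooth_on T g" "f ` S \<subseteq> T"
  shows "smooth_on S (\<lambda>x. g (f x))"
  unfolding smooth_on_iff
proof
  fix x assume x: "x \<in> S"
  obtain W F where W: "x \<in> W" "Cinf_on W F" "\<forall>y\<in>S \<inter> W. F y = f y"
    using smooth_onD[OF assms(1) x] by blast
  have fx: "f x \<in> T" using assms(3) x by auto
  obtain W' F' where W': "f x \<in> W'" "Cinf_on W' F'" "\<forall>y\<in>T \<inter> W'. F' y = g y"
    using smooth_onD[OF assms(2) fx] by blast
  let ?W = "W \<inter> F -` W'"
  have "open ?W"
    by (intro continuous_open_preimage Cinf_on_continuous[OF W(2)] Cinf_on_open[OF W(2)]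
        Cinf_on_open[OF W'(2)])
  then have "Cinf_on ?W (\<lambda>x. F' (F x))"
    by (intro Cinf_on_compose[OF _ W'(2)] Cinf_on_subset[OF W(2)]) auto
  moreover have "F' (F y) = g (f y)" if "y \<in> S \<inter> ?W" for y
  proof -
    have "F y = f y" using W(3) that by auto
    moreover have "f y \<in> T" using assms(3) that by auto
    ultimately show ?thesis using W'(3) that by auto
  qed
  moreover have "x \<in> ?W" using W W' x by auto
  ultimately show "\<exists>W F. x \<in> W \<and> Cinf_on W F \<and> (\<forall>y\<in>S \<inter> W. F y = g (f y))"
    by (intro exI[of _ ?W] exI[of _ "\<lambda>x. F' (F x)"] conjI ballI)
qed

lemma smooth_on_Pair:
  assumes "smooth_on S f" "smooth_on S g"
  shows "smooth_on S (\<lambda>x. (f x, g x))"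
  unfolding smooth_on_iff
proof
  fix x assume x: "x \<in> S"
  obtain W F where W: "x \<in> W" "Cinf_on W F" "\<forall>y\<in>S \<inter> W. F y = f y"
    using smooth_onD[OF assms(1) x] by blast
  obtain W' F' where W': "x \<in> W'" "Cinf_on W' F'" "\<forall>y\<in>S \<inter> W'. F' y = g y"
    using smooth_onD[OF assms(2) x] by blast
  have "open (W \<inter> W')" using Cinf_on_open[OF W(2)] Cinf_on_open[OF W'(2)] by auto
  then have "Cinf_on (W \<inter> W') (\<lambda>x. (F x, F' x))"
    by (intro Cinf_on_Pair Cinf_on_subset[OF W(2)] Cinf_on_subset[OF W'(2)]) auto
  then show "\<exists>W F. x \<in> W \<and> Cinf_on W F \<and> (\<forall>y\<in>S \<inter> W. F y = (f y, g y))"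
    using W W' by (intro exI[of _ "W \<inter> W'"] exI[of _ "\<lambda>x. (F x, F' x)"]) auto
qed

lemma smooth_on_const: "smooth_on S (\<lambda>_. c)"
  by (rule Cinf_on_imp_smooth_on[OF Cinf_on_const[of UNIV]]) auto

lemma smooth_on_bounded_linear: "bounded_linear f \<Longrightarrow> smooth_on S f"
  by (rule Cinf_on_imp_smooth_on[OF Cinf_on_bounded_linear[of UNIV]]) auto

lemma smooth_on_id: "smooth_on S (\<lambda>x. x)"
  by (rule smooth_on_bounded_linear) (rule bounded_linear_ident)

text \<open>Composing with addition on pairs leaves the intersection of the two extension domains to
  \<open>smooth_on_Pair\<close>; multiplication is treated in the same way.\<close>

lemma smooth_on_add:
  fixes f :: "'a::euclidean_space \<Rightarrow> 'b::euclidean_space"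
  assumes "smooth_on S f" "smooth_on S g"
  shows "smooth_on S (\<lambda>x. f x + g x)"
proof -
  have "smooth_on UNIV (\<lambda>p::'b \<times> 'b. fst p + snd p)"
    by (intro smooth_on_bounded_linear bounded_linear_add bounded_linear_fst bounded_linear_snd)
  from smooth_on_compose[OF smooth_on_Pair[OF assms] this] show ?thesis by simp
qed

lemma smooth_on_mult:
  fixes f :: "'a::euclidean_space \<Rightarrow> real"
  assumes "smooth_on S f" "smooth_on S g"
  shows "smooth_on S (\<lambda>x. f x * g x)"
proof -
  have "Cinf_on UNIV (\<lambda>p::real \<times> real. fst p * snd p)"
    by (intro Cinf_on_mult Cinf_on_bounded_linear bounded_linear_fst bounded_linear_snd) auto
  then have "smooth_on UNIV (\<lambda>p::real \<times> real. fst p * snd p)"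
    by (rule Cinf_on_imp_smooth_on) auto
  from smooth_on_compose[OF smooth_on_Pair[OF assms] this] show ?thesis by simp
qed

lemma smooth_on_sum:
  fixes f :: "'i \<Rightarrow> 'a::euclidean_space \<Rightarrow> 'b::euclidean_space"
  assumes "\<And>i. i \<in> I \<Longrightarrow> smooth_on S (f i)"
  shows "smooth_on S (\<lambda>x. \<Sum>i\<in>I. f i x)"
  using assms
  by (induction I rule: infinite_finite_induct) (auto intro: smooth_on_const smooth_on_add)

subsection \<open>A smooth cut-off function\<close>

text \<open>For m = 0 this is the classical flat function exp (-1/t). The powers in the denominator
  are added because the derivative of a member of the family is a linear combination of later
  members, so one induction makes all of them smooth.\<close>

definition flat_exp :: "nat \<Rightarrow> real \<Rightarrow> real" where
  "flat_exp m t = (if t \<le> 0 then 0 else exp (- (1 / t)) / t ^ m)"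

lemma flat_exp_tendsto_0: "(flat_exp m \<longlongrightarrow> 0) (at_right 0)"
proof -
  have "((\<lambda>x::real. x ^ m / exp x) \<longlongrightarrow> 0) at_top" by (rule tendsto_power_div_exp_0)
  then have L: "((\<lambda>t. inverse t ^ m / exp (inverse t)) \<longlongrightarrow> (0::real)) (at_right 0)"
    by (rule filterlim_compose[OF _ filterlim_inverse_at_top_right])
  have "inverse t ^ m / exp (inverse t) = flat_exp m t" if "t > 0" for t
    using that by (simp add: flat_exp_def exp_minus inverse_eq_divide power_one_over)
  then have "\<forall>\<^sub>F t in at_right 0. inverse t ^ m / exp (inverse t) = flat_exp m t"
    by (intro eventually_mono[OF eventually_at_right_less]) auto
  then show ?thesis
    by (rule Lim_transform_eventually[OF L])
qed

lemma flat_exp_has_derivative: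
  "(flat_exp m has_real_derivative (- real m * flat_exp (Suc m) t + flat_exp (Suc (Suc m)) t)) (at t)"
proof -
  consider "t < 0" | "t > 0" | "t = 0" by linarith
  then show ?thesis
  proof cases
    case 1
    have "((\<lambda>_. 0) has_real_derivative 0) (at t)" by simp
    then have "(flat_exp m has_real_derivative 0) (at t)"
      by (rule has_field_derivative_transform_within_open[of _ _ _ "{..<0}"])
        (use 1 in \<open>auto simp: flat_exp_def\<close>)
    then show ?thesis using 1 by (simp add: flat_exp_def)
  next
    case 2
    have e: "((\<lambda>t. exp (- (1 / t))) has_real_derivative exp (- (1 / t)) / t\<^sup>2) (at t)"
      using 2 by (auto intro!: derivative_eq_intros simp: field_simps power2_eq_square)
    have p: "((\<lambda>t. t ^ m) has_real_derivative real m * t ^ (m - 1)) (at t)"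
      by (auto intro!: derivative_eq_intros)
    have eq: "(exp (- (1 / t)) / t\<^sup>2 * t ^ m - exp (- (1 / t)) * (real m * t ^ (m - 1))) / (t ^ m * t ^ m)
        = - real m * (exp (- (1 / t)) / t ^ Suc m) + exp (- (1 / t)) / t ^ Suc (Suc m)"
    \<comment> \<open>For m = 0 the exponent \<open>m - 1\<close> is truncated to 0, and only the
      factor \<open>real m\<close> removes that term.\<close>
    proof (cases m)
      case (Suc l)
      show ?thesis unfolding Suc using 2 by (simp add: divide_simps power2_eq_square algebra_simps)
    qed (use 2 in \<open>simp add: power2_eq_square\<close>)
    have "((\<lambda>t. exp (- (1 / t)) / t ^ m) has_real_derivative
        - real m * (exp (- (1 / t)) / t ^ Suc m) + exp (- (1 / t)) / t ^ Suc (Suc m)) (at t)"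
      using DERIV_divide[OF e p] 2 unfolding eq by simp
    then have "(flat_exp m has_real_derivative
        - real m * (exp (- (1 / t)) / t ^ Suc m) + exp (- (1 / t)) / t ^ Suc (Suc m)) (at t)"
      by (rule has_field_derivative_transform_within_open[of _ _ _ "{0<..}"])
        (use 2 in \<open>auto simp: flat_exp_def\<close>)
    then show ?thesis using 2 by (simp add: flat_exp_def)
  next
    case 3
    have l: "0 = (flat_exp m y - flat_exp m 0) / (y - 0)" if "y < 0" for y
      using that by (simp add: flat_exp_def)
    \<comment> \<open>At the origin the right difference quotient is the next member of the family,
      which tends to 0.\<close>
    have r: "flat_exp (Suc m) y = (flat_exp m y - flat_exp m 0) / (y - 0)" if "y > 0" for y
      using that by (simp add: flat_exp_def)
    have "((\<lambda>y. (flat_exp m y - flat_exp m 0) / (y - 0)) \<longlongrightarrow> 0) (at_right 0)"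
      by (rule Lim_transform_eventually[OF flat_exp_tendsto_0[of "Suc m"]])
        (use r in \<open>intro eventually_mono[OF eventually_at_right_less], auto\<close>)
    moreover have "((\<lambda>y. (flat_exp m y - flat_exp m 0) / (y - 0)) \<longlongrightarrow> 0) (at_left 0)"
      by (rule Lim_transform_eventually[OF tendsto_const])
        (use l in \<open>intro eventually_at_leftI[of "-1"], auto\<close>)
    ultimately have "((\<lambda>y. (flat_exp m y - flat_exp m 0) / (y - 0)) \<longlongrightarrow> 0) (at 0)"
      by (intro filterlim_split_at_real)
    then show ?thesis using 3 by (simp add: has_field_derivative_iff flat_exp_def)
  qed
qed

lemma Ck_on_flat_exp: "Ck_on k UNIV (flat_exp m)"
proof (induction k arbitrary: m)
  case 0
  then show ?case
    using DERIV_isCont[OF flat_exp_has_derivative] by (simp add: continuous_at_imp_continuous_on)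
next
  case (Suc k)
  show ?case
  proof (rule Ck_on_SucI'[of _ _ "\<lambda>t v. v *\<^sub>R (- real m * flat_exp (Suc m) t + flat_exp (Suc (Suc m)) t)"])
    fix x
    show "(flat_exp m has_derivative
        (\<lambda>v. v *\<^sub>R (- real m * flat_exp (Suc m) x + flat_exp (Suc (Suc m)) x))) (at x)"
      by (rule has_derivative_eq_rhs[OF flat_exp_has_derivative[unfolded has_field_derivative_def]])
        (simp add: fun_eq_iff)
  next
    fix v :: real
    have "Ck_on k UNIV (\<lambda>x. v *\<^sub>R ((- real m) *\<^sub>R flat_exp (Suc m) x + flat_exp (Suc (Suc m)) x))"
      by (intro Ck_on_scaleR Ck_on_add Ck_on_const Suc.IH open_UNIV)
    then show "Ck_on k UNIV (\<lambda>x. v *\<^sub>R (- real m * flat_exp (Suc m) x + flat_exp (Suc (Suc m)) x))"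
      by simp
  qed auto
qed

lemma flat_exp_0_mono: "s \<le> t \<Longrightarrow> flat_exp 0 s \<le> flat_exp 0 t"
  by (auto simp: flat_exp_def frac_le)

text \<open>With \<open>h = flat_exp 0\<close> increasing and vanishing on the negative half line, \<open>h (h 1 - h t)\<close> equals
  the positive constant \<open>h (h 1)\<close> for \<open>t \<le> 0\<close> and vanishes for \<open>t \<ge> 1\<close>.\<close>

lemma cutoff_exists:
  fixes x0 :: "'a::euclidean_space"
  assumes "0 < r"
  obtains \<rho> :: "'a \<Rightarrow> real" where "Cinf_on UNIV \<rho>" "\<And>x. x \<in> ball x0 r \<Longrightarrow> \<rho> x = 1"
    "\<And>x. x \<notin> ball x0 (2 * r) \<Longrightarrow> \<rho> x = 0"
proof
  define c where "c = flat_exp 0 1"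
  have c: "c > 0" by (simp add: c_def flat_exp_def)
  then have hc: "flat_exp 0 c > 0" by (simp add: flat_exp_def)
  \<comment> \<open>The squared distance is rescaled so that \<open>a\<close> is at most 0 on the
    ball of radius r and at least 3, hence at least 1, from radius 2 r on.\<close>
  define a where "a = (\<lambda>x::'a. ((x - x0) \<bullet> (x - x0) - r\<^sup>2) / r\<^sup>2)"
  define \<rho> where "\<rho> = (\<lambda>x. (1 / flat_exp 0 c) *\<^sub>R flat_exp 0 (c + (-1) *\<^sub>R flat_exp 0 (a x)))"
  have a_norm: "a x = ((dist x0 x)\<^sup>2 - r\<^sup>2) / r\<^sup>2" for x
    unfolding a_def power2_norm_eq_inner[symmetric] by (simp add: dist_norm norm_minus_commute)
  have F: "Cinf_on UNIV (flat_exp 0)" by (simp add: Cinf_on_def Ck_on_flat_exp)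
  \<comment> \<open>The squared distance is written as a sum of products of coordinates, to which
    the closure rules apply.\<close>
  have "Cinf_on UNIV (\<lambda>x. \<Sum>b\<in>Basis. (x \<bullet> b + - (x0 \<bullet> b)) *\<^sub>R (x \<bullet> b + - (x0 \<bullet> b)))"
    by (intro Cinf_on_sum Cinf_on_scaleR Cinf_on_add Cinf_on_const open_UNIV
        Cinf_on_bounded_linear[OF open_UNIV bounded_linear_inner_left])
  then have "Cinf_on UNIV (\<lambda>x. (x - x0) \<bullet> (x - x0))"
    by (rule Cinf_on_cong) (subst euclidean_inner, simp add: inner_diff_left)
  then have "Cinf_on UNIV (\<lambda>x. (1 / r\<^sup>2) *\<^sub>R ((x - x0) \<bullet> (x - x0) + (- r\<^sup>2)))"
    by (intro Cinf_on_scaleR Cinf_on_add Cinf_on_const) auto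
  then have A: "Cinf_on UNIV a"
    by (rule Cinf_on_cong) (simp add: a_def)
  show "Cinf_on UNIV \<rho>"
    unfolding \<rho>_def
    by (intro Cinf_on_scaleR Cinf_on_compose[OF _ F] Cinf_on_compose[OF A F] Cinf_on_add Cinf_on_const)
      auto
  show "\<rho> x = 1" if "x \<in> ball x0 r" for x
  proof -
    have "(dist x0 x)\<^sup>2 \<le> r\<^sup>2" using that by (intro power_mono) auto
    then have "a x \<le> 0" unfolding a_norm by (simp add: divide_nonpos_nonneg)
    then have "flat_exp 0 (a x) = 0" by (simp add: flat_exp_def)
    then show ?thesis using hc by (simp add: \<rho>_def)
  qed
  show "\<rho> x = 0" if "x \<notin> ball x0 (2 * r)" for x
  proof -
    have "(2 * r)\<^sup>2 \<le> (dist x0 x)\<^sup>2" using that assms by (intro power_mono) auto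
    then have "2 * r\<^sup>2 + 2 * r\<^sup>2 \<le> (dist x0 x)\<^sup>2" by (simp add: power_mult_distrib)
    then have "2 * r\<^sup>2 \<le> (dist x0 x)\<^sup>2" using zero_le_power2[of r] by linarith
    then have "1 \<le> a x" using assms unfolding a_norm by (simp add: le_divide_eq)
    then have "c \<le> flat_exp 0 (a x)" unfolding c_def by (rule flat_exp_0_mono)
    then show ?thesis by (simp add: \<rho>_def flat_exp_def)
  qed
qed

subsection \<open>Hadamard's lemma\<close>

text \<open>The weight \<open>t ^ m\<close> makes the induction on the order of differentiability go through.\<close>

lemma Ck_on_integral_segment:
  fixes F :: "'a::euclidean_space \<Rightarrow> real"
  assumes "Ck_on k (ball x0 r) F"
  shows "Ck_on k (ball x0 r) (\<lambda>x. integral (cbox 0 1) (\<lambda>t::real. t ^ m * F (x0 + t *\<^sub>R (x - x0))))"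
proof -
  have seg: "x0 + t *\<^sub>R (x - x0) \<in> ball x0 r" if "x \<in> ball x0 r" "t \<in> cbox 0 1" for x t
  proof -
    have "norm (t *\<^sub>R (x - x0)) \<le> 1 * norm (x - x0)"
      using that(2) unfolding norm_scaleR by (intro mult_right_mono) auto
    then show ?thesis using that(1) by (simp add: dist_norm norm_minus_commute)
  qed
  have cont: "continuous_on (ball x0 r \<times> cbox 0 1) (\<lambda>(x, t). t ^ m * G (x0 + t *\<^sub>R (x - x0)))"
    if "continuous_on (ball x0 r) G" for m and G :: "'a \<Rightarrow> real"
    unfolding split_beta
    by (intro continuous_intros continuous_on_compose2[OF that]) (use seg in \<open>auto simp del: mem_ball\<close>)
  show ?thesis
    using assms
  proof (induction k arbitrary: F m)
    case 0
    then show ?case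
      unfolding Ck_on.simps(1) by (intro integral_continuous_on_param cont)
  next
    case (Suc k)
    let ?D = "\<lambda>x. frechet_derivative F (at x)"
    \<comment> \<open>The chain rule contributes one more factor t, whence \<open>Suc m\<close>. The
      derivative is packed as a bounded linear function because differentiation under the integral
      is stated for such values.\<close>
    define fx where "fx = (\<lambda>x t. Blinfun (\<lambda>v. t ^ Suc m * ?D (x0 + t *\<^sub>R (x - x0)) v))"
    have F: "(F has_derivative ?D y) (at y)" if "y \<in> ball x0 r" for y
      using Suc.prems that by (simp add: frechet_derivative_works[symmetric])
    have fx: "blinfun_apply (fx x t) = (\<lambda>v. t ^ Suc m * ?D (x0 + t *\<^sub>R (x - x0)) v)"
      if "x \<in> ball x0 r" "t \<in> cbox 0 1" for x t
      unfolding fx_def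
      by (rule bounded_linear_Blinfun_apply, rule bounded_linear_const_mult,
          rule has_derivative_bounded_linear[OF F[OF seg[OF that]]])
    have der: "((\<lambda>x. t ^ m * F (x0 + t *\<^sub>R (x - x0))) has_derivative blinfun_apply (fx x t))
        (at x within ball x0 r)" if "x \<in> ball x0 r" "t \<in> cbox 0 1" for x t
    proof -
      interpret L: bounded_linear "?D (x0 + t *\<^sub>R (x - x0))"
        by (rule has_derivative_bounded_linear[OF F[OF seg[OF that]]])
      have "((\<lambda>x. x0 + t *\<^sub>R (x - x0)) has_derivative (\<lambda>v. t *\<^sub>R v)) (at x)"
        by (auto intro!: derivative_eq_intros)
      then have "((\<lambda>x. F (x0 + t *\<^sub>R (x - x0))) has_derivative
          (\<lambda>v. ?D (x0 + t *\<^sub>R (x - x0)) (t *\<^sub>R v))) (at x)"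
        by (rule has_derivative_compose) (rule F[OF seg[OF that]])
      then have "((\<lambda>x. t ^ m * F (x0 + t *\<^sub>R (x - x0))) has_derivative
          (\<lambda>v. t ^ m * ?D (x0 + t *\<^sub>R (x - x0)) (t *\<^sub>R v))) (at x)"
        by (rule has_derivative_mult_right)
      moreover have "t ^ m * ?D (x0 + t *\<^sub>R (x - x0)) (t *\<^sub>R v) = t ^ Suc m * ?D (x0 + t *\<^sub>R (x - x0)) v"
        for v by (simp only: L.scaleR real_scaleR_def power_Suc mult.assoc mult.left_commute)
      ultimately show ?thesis
        unfolding fx[OF that] by (simp only: has_derivative_at_withinI)
    qed
    have contF: "continuous_on (ball x0 r) F" 
      using Ck_on_SucD[OF Suc.prems] by (induction k) (auto simp del: Ck_on.simps(2) dest: Ck_on_SucD)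
    have contD: "continuous_on (ball x0 r) (\<lambda>y. ?D y v)" for v
    proof -
      have "Ck_on k (ball x0 r) (\<lambda>y. ?D y v)" using Suc.prems by simp
      then show ?thesis by (induction k) (auto simp del: Ck_on.simps(2) dest: Ck_on_SucD)
    qed
    have int: "(\<lambda>t. t ^ m * F (x0 + t *\<^sub>R (x - x0))) integrable_on cbox 0 1" if "x \<in> ball x0 r" for x
      by (intro integrable_continuous continuous_intros continuous_on_compose2[OF contF])
        (use seg that in \<open>auto simp del: mem_ball\<close>)
    have cfx: "continuous_on (ball x0 r \<times> cbox 0 1) (\<lambda>(x, t). fx x t)"
    proof (rule continuous_on_blinfun_componentwise)
      fix i :: 'a
      show "continuous_on (ball x0 r \<times> cbox 0 1) (\<lambda>p. blinfun_apply (case p of (x, t) \<Rightarrow> fx x t) i)"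
        by (rule continuous_on_eq[OF cont[OF contD[of i], of "Suc m"]])
          (use fx in \<open>auto simp del: mem_ball\<close>)
    qed
    let ?I = "\<lambda>x. integral (cbox 0 1) (fx x)"
    show ?case
    proof (rule Ck_on_SucI'[of _ _ "\<lambda>x. blinfun_apply (?I x)"])
      fix x assume x: "x \<in> ball x0 r"
      then have "((\<lambda>x. integral (cbox 0 1) (\<lambda>t. t ^ m * F (x0 + t *\<^sub>R (x - x0)))) has_derivative ?I x)
          (at x within ball x0 r)"
        by (intro leibniz_rule[OF der int cfx]) auto
      then show "((\<lambda>x. integral (cbox 0 1) (\<lambda>t. t ^ m * F (x0 + t *\<^sub>R (x - x0)))) has_derivative ?I x) (at x)"
        using x by (simp add: at_within_open[of x "ball x0 r"])
    next
      fix v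
      have Iv: "?I x v = integral (cbox 0 1) (\<lambda>t. t ^ Suc m * ?D (x0 + t *\<^sub>R (x - x0)) v)"
        if x: "x \<in> ball x0 r" for x
      proof -
        have "continuous_on (cbox 0 1) (fx x)"
          using continuous_on_compose2[OF cfx, of "cbox 0 1" "\<lambda>t. (x, t)"] x
          by (simp add: continuous_on_Pair image_subset_iff)
        then have "?I x v = integral (cbox 0 1) (\<lambda>t. fx x t v)"
          by (intro blinfun_apply_integral integrable_continuous)
        also have "\<dots> = integral (cbox 0 1) (\<lambda>t. t ^ Suc m * ?D (x0 + t *\<^sub>R (x - x0)) v)"
          by (rule integral_cong) (simp add: fx[OF x] del: power_Suc)
        finally show ?thesis .
      qed
      have "Ck_on k (ball x0 r)
          (\<lambda>x. integral (cbox 0 1) (\<lambda>t. t ^ Suc m * ?D (x0 + t *\<^sub>R (x - x0)) v))"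
        using Suc.prems by (intro Suc.IH) simp
      then show "Ck_on k (ball x0 r) (\<lambda>x. ?I x v)"
        by (rule Ck_on_cong[OF open_ball Iv[symmetric], rotated])
    qed auto
  qed
qed

text \<open>The fundamental theorem of calculus along the segment from \<open>x0\<close> to x, with
  the derivative in direction x - x0 split into partial derivatives. Thus \<open>g b\<close> is the
  mean of the partial derivative over the segment, and at \<open>x0\<close> the segment degenerates
  to a point.\<close>

lemma Hadamard:
  fixes F :: "'a::euclidean_space \<Rightarrow> real"
  assumes F: "Cinf_on (ball x0 r) F" and "0 < r"
  obtains g where "\<And>b. Cinf_on (ball x0 r) (g b)"
    "\<And>x. x \<in> ball x0 r \<Longrightarrow> F x = F x0 + (\<Sum>b\<in>Basis. ((x - x0) \<bullet> b) * g b x)"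
    "\<And>b. g b x0 = frechet_derivative F (at x0) b"
proof
  let ?D = "\<lambda>x. frechet_derivative F (at x)"
  \<comment> \<open>The factor \<open>t ^ 0\<close> makes this an instance of
    \<open>Ck_on_integral_segment\<close>.\<close>
  define g where "g = (\<lambda>b x. integral (cbox 0 1) (\<lambda>t::real. t ^ 0 * ?D (x0 + t *\<^sub>R (x - x0)) b))"
  show "Cinf_on (ball x0 r) (g b)" for b
    using Cinf_on_derivative[OF F, of b] unfolding Cinf_on_def g_def
    by (intro conjI allI Ck_on_integral_segment) auto
  show "g b x0 = ?D x0 b" for b
    by (simp add: g_def)
  fix x assume x: "x \<in> ball x0 r"
  have seg: "x0 + t *\<^sub>R (x - x0) \<in> ball x0 r" if "t \<in> {0..1}" for t
  proof -
    have "norm (t *\<^sub>R (x - x0)) \<le> 1 * norm (x - x0)"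
      using that unfolding norm_scaleR by (intro mult_right_mono) auto
    then show ?thesis using x by (simp add: dist_norm norm_minus_commute)
  qed
  have "((\<lambda>t. F (x0 + t *\<^sub>R (x - x0))) has_vector_derivative ?D (x0 + t *\<^sub>R (x - x0)) (x - x0))
      (at t within {0..1})" if t: "t \<in> {0..1}" for t
  proof -
    interpret L: bounded_linear "?D (x0 + t *\<^sub>R (x - x0))"
      by (rule has_derivative_bounded_linear[OF Cinf_on_has_derivative[OF F seg[OF t]]])
    have "((\<lambda>t. x0 + t *\<^sub>R (x - x0)) has_derivative (\<lambda>h. h *\<^sub>R (x - x0))) (at t)"
      by (auto intro!: derivative_eq_intros)
    then have "((\<lambda>t. F (x0 + t *\<^sub>R (x - x0))) has_derivative
        (\<lambda>h. ?D (x0 + t *\<^sub>R (x - x0)) (h *\<^sub>R (x - x0)))) (at t)"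
      by (rule has_derivative_compose) (rule Cinf_on_has_derivative[OF F seg[OF t]])
    then show ?thesis
      unfolding has_vector_derivative_def L.scaleR by (rule has_derivative_at_withinI)
  qed
  then have "((\<lambda>t. ?D (x0 + t *\<^sub>R (x - x0)) (x - x0)) has_integral
      (F (x0 + 1 *\<^sub>R (x - x0)) - F (x0 + 0 *\<^sub>R (x - x0)))) {0..1}"
    by (intro fundamental_theorem_of_calculus) auto
  then have "F x - F x0 = integral {0..1} (\<lambda>t. ?D (x0 + t *\<^sub>R (x - x0)) (x - x0))"
    by (simp add: integral_unique)
  also have "\<dots> = integral {0..1} (\<lambda>t. \<Sum>b\<in>Basis. ((x - x0) \<bullet> b) * ?D (x0 + t *\<^sub>R (x - x0)) b)"
  proof (rule integral_cong)
    fix t :: real assume t: "t \<in> {0..1}"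
    interpret L: bounded_linear "?D (x0 + t *\<^sub>R (x - x0))"
      by (rule has_derivative_bounded_linear[OF Cinf_on_has_derivative[OF F seg[OF t]]])
    have "?D (x0 + t *\<^sub>R (x - x0)) (x - x0)
        = ?D (x0 + t *\<^sub>R (x - x0)) (\<Sum>b\<in>Basis. ((x - x0) \<bullet> b) *\<^sub>R b)"
      by (simp only: euclidean_representation)
    then show "?D (x0 + t *\<^sub>R (x - x0)) (x - x0)
        = (\<Sum>b\<in>Basis. ((x - x0) \<bullet> b) * ?D (x0 + t *\<^sub>R (x - x0)) b)"
      by (simp only: L.sum L.scaleR real_scaleR_def)
  qed
  also have "\<dots> = (\<Sum>b\<in>Basis. integral {0..1} (\<lambda>t. ((x - x0) \<bullet> b) * ?D (x0 + t *\<^sub>R (x - x0)) b))"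
  proof (rule integral_sum)
    fix b :: 'a
    show "(\<lambda>t. ((x - x0) \<bullet> b) * ?D (x0 + t *\<^sub>R (x - x0)) b) integrable_on {0..1}"
      by (intro integrable_continuous_real continuous_on_mult_left
          continuous_on_compose2[OF Cinf_on_continuous[OF Cinf_on_derivative[OF F, of b]]]
          continuous_intros) (use seg in auto)
  qed auto
  also have "\<dots> = (\<Sum>b\<in>Basis. ((x - x0) \<bullet> b) * g b x)"
    by (simp add: g_def)
  finally show "F x = F x0 + (\<Sum>b\<in>Basis. ((x - x0) \<bullet> b) * g b x)" by simp
qed

section \<open>Smooth functions and tangent vectors on manifolds\<close>

text \<open>The part of the definition of a manifold that is evident for products.\<close>

definition open_charts :: "('p, 'a::euclidean_space) manifold \<Rightarrow> bool" where
  "open_charts P \<longleftrightarrow> (\<forall>(U, \<kappa>)\<in>charts P. U \<subseteq> points P \<and> inj_on \<kappa> U \<and>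
     (\<forall>T. openin (mtop P) T \<longrightarrow> openin (top_of_set (model P)) (\<kappa> ` (U \<inter> T))))"

lemma open_chartsD:
  assumes "open_charts P" "(U, \<kappa>) \<in> charts P"
  shows "U \<subseteq> points P" "inj_on \<kappa> U"
    "openin (mtop P) T \<Longrightarrow> openin (top_of_set (model P)) (\<kappa> ` (U \<inter> T))"
  using assms unfolding open_charts_def by auto

lemma manifold_charts:
  assumes "smooth_manifold M" "(U, \<kappa>) \<in> charts M"
  shows "openin (mtop M) U" "U \<subseteq> points M" "openin (top_of_set (model M)) (\<kappa> ` U)"
    "homeomorphic_map (subtopology (mtop M) U) (top_of_set (\<kappa> ` U)) \<kappa>" "inj_on \<kappa> U"
proof -
  show U: "openin (mtop M) U" "openin (top_of_set (model M)) (\<kappa> ` U)"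
    and h: "homeomorphic_map (subtopology (mtop M) U) (top_of_set (\<kappa> ` U)) \<kappa>"
    using assms unfolding smooth_manifold_def by auto
  show "U \<subseteq> points M" using U(1) openin_subset by blast
  then have "topspace (subtopology (mtop M) U) = U" by auto
  then show "inj_on \<kappa> U" using h by (metis homeomorphic_imp_injective_map)
qed

lemma manifold_cover:
  assumes "smooth_manifold M" "p \<in> points M"
  obtains U \<kappa> where "(U, \<kappa>) \<in> charts M" "p \<in> U"
  using assms unfolding smooth_manifold_def by auto

lemma manifold_open_charts:
  assumes "smooth_manifold M"
  shows "open_charts M"
proof -
  have "openin (top_of_set (model M)) (\<kappa> ` (U \<inter> T))"
    if c: "(U, \<kappa>) \<in> charts M" and T: "openin (mtop M) T" for U \<kappa> T
  proof -
    note [simp] = manifold_charts[OF assms c]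
    have "openin (subtopology (mtop M) U) (U \<inter> T)"
      using T by (auto simp: openin_subtopology)
    then have "openin (top_of_set (\<kappa> ` U)) (\<kappa> ` (U \<inter> T))"
      using homeomorphic_imp_open_map[of "subtopology (mtop M) U" "top_of_set (\<kappa> ` U)" \<kappa>]
      by (simp add: open_map_def)
    then show ?thesis
      using openin_trans manifold_charts(3)[OF assms c] by blast
  qed
  then show ?thesis
    using manifold_charts(2,5)[OF assms] by (simp add: open_charts_def Ball_def split_paired_All)
qed

lemma openin_chart_vimage:
  assumes "smooth_manifold M" "(U, \<kappa>) \<in> charts M" "open W"
  shows "openin (mtop M) {q\<in>U. \<kappa> q \<in> W}"
proof -
  note c = manifold_charts[OF assms(1,2)]
  have "continuous_map (subtopology (mtop M) U) (top_of_set (\<kappa> ` U)) \<kappa>"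
    using c(4) homeomorphic_imp_continuous_map by blast
  moreover have "openin (top_of_set (\<kappa> ` U)) (\<kappa> ` U \<inter> W)"
    using assms(3) by auto
  ultimately have "openin (subtopology (mtop M) U)
      {q \<in> topspace (subtopology (mtop M) U). \<kappa> q \<in> \<kappa> ` U \<inter> W}"
    by (rule openin_continuous_map_preimage)
  moreover have "{q \<in> topspace (subtopology (mtop M) U). \<kappa> q \<in> \<kappa> ` U \<inter> W} = {q\<in>U. \<kappa> q \<in> W}"
    using c(2) by auto
  ultimately show ?thesis
    using c(1) openin_trans_full by fastforce
qed

text \<open>Transfers locality from the manifold to coordinates. A chart maps an open set to a set
  that is open only relative to the model; an ambient open set cutting it out is what
  \<open>smooth_on_local\<close> needs, and injectivity of the chart brings points of this set back
  to T.\<close>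

lemma smooth_on_chart_local:
  assumes P: "open_charts P" "(U, \<kappa>) \<in> charts P" and "S \<subseteq> U"
    and loc: "\<And>q. q \<in> S \<Longrightarrow> \<exists>T. openin (mtop P) T \<and> q \<in> T \<and> smooth_on (\<kappa> ` (S \<inter> T)) h"
  shows "smooth_on (\<kappa> ` S) h"
proof (rule smooth_on_local)
  fix x assume "x \<in> \<kappa> ` S"
  then obtain q where q: "q \<in> S" "x = \<kappa> q" by auto
  then obtain T where T: "openin (mtop P) T" "q \<in> T" "smooth_on (\<kappa> ` (S \<inter> T)) h"
    using loc by blast
  note c = open_chartsD[OF P]
  obtain W where W: "open W" "\<kappa> ` (U \<inter> T) = model P \<inter> W"
    using c(3)[OF T(1)] by (auto simp: openin_open)
  have "\<kappa> ` U \<subseteq> model P"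
    using c(3)[OF openin_topspace] openin_subset c(1) by (fastforce simp: Int_absorb2)
  then have "\<kappa> ` S \<inter> W \<subseteq> \<kappa> ` (U \<inter> T)"
    using W(2) \<open>S \<subseteq> U\<close> by blast
  then have "\<kappa> ` S \<inter> W \<subseteq> \<kappa> ` (S \<inter> T)"
    using c(2) \<open>S \<subseteq> U\<close> by (fastforce dest: inj_onD)
  then have "smooth_on (\<kappa> ` S \<inter> W) h" by (rule smooth_on_subset[OF T(3)])
  moreover have "x \<in> W" using q T \<open>S \<subseteq> U\<close> W(2) by blast
  ultimately show "\<exists>W. open W \<and> x \<in> W \<and> smooth_on (\<kappa> ` S \<inter> W) h" using W(1) by blast
qed

lemma smooth_functionsI:
  assumes P: "open_charts P"
    and "\<And>U \<kappa> q. (U, \<kappa>) \<in> charts P \<Longrightarrow> q \<in> U \<Longrightarrow>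
      \<exists>T. openin (mtop P) T \<and> q \<in> T \<and> smooth_on (\<kappa> ` (U \<inter> T)) (\<lambda>x. f (inv_into U \<kappa> x))"
  shows "f \<in> smooth_functions P"
  using smooth_on_chart_local[OF P _ subset_refl] assms(2)
  unfolding smooth_functions_def comp_def by blast

lemma smooth_functionsD:
  "f \<in> smooth_functions P \<Longrightarrow> (U, \<kappa>) \<in> charts P \<Longrightarrow> smooth_on (\<kappa> ` U) (\<lambda>x. f (inv_into U \<kappa> x))"
  unfolding smooth_functions_def comp_def by blast

lemma smooth_mapD:
  assumes "smooth_map P N \<phi>" "(U, \<kappa>) \<in> charts P" "(V, \<eta>) \<in> charts N"
  shows "smooth_on (\<kappa> ` (U \<inter> \<phi> -` V)) (\<lambda>x. \<eta> (\<phi> (inv_into U \<kappa> x)))"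
  using assms unfolding smooth_map_def comp_def by blast

lemma smooth_map_points: "smooth_map P N \<phi> \<Longrightarrow> p \<in> points P \<Longrightarrow> \<phi> p \<in> points N"
  unfolding smooth_map_def continuous_map_def by blast

lemma openin_smooth_map_vimage:
  "smooth_map P N \<phi> \<Longrightarrow> openin (mtop N) T \<Longrightarrow> openin (mtop P) {x\<in>points P. \<phi> x \<in> T}"
  unfolding smooth_map_def continuous_map_def by blast

lemma smooth_functions_pullback:
  assumes P: "open_charts P" and N: "smooth_manifold N" and \<phi>: "smooth_map P N \<phi>"
    and f: "f \<in> smooth_functions N"
  shows "(\<lambda>x. f (\<phi> x)) \<in> smooth_functions P"
proof (rule smooth_functionsI[OF P])
  fix U \<kappa> q assume c: "(U, \<kappa>) \<in> charts P" and q: "q \<in> U"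
  note U = open_chartsD[OF P c]
  obtain V \<eta> where V: "(V, \<eta>) \<in> charts N" "\<phi> q \<in> V"
    using manifold_cover[OF N] smooth_map_points[OF \<phi>] q U(1) by (metis subsetD)
  let ?T = "{x\<in>points P. \<phi> x \<in> V}"
  have "smooth_on (\<kappa> ` (U \<inter> \<phi> -` V)) (\<lambda>x. f (inv_into V \<eta> (\<eta> (\<phi> (inv_into U \<kappa> x)))))"
    by (rule smooth_on_compose[OF smooth_mapD[OF \<phi> c V(1)] smooth_functionsD[OF f V(1)]])
      (auto simp: inv_into_f_f[OF U(2)])
  then have "smooth_on (\<kappa> ` (U \<inter> \<phi> -` V)) (\<lambda>x. f (\<phi> (inv_into U \<kappa> x)))"
    by (rule smooth_on_cong) (auto simp: inv_into_f_f[OF U(2)] inv_into_f_f[OF manifold_charts(5)[OF N V(1)]])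
  moreover have "U \<inter> ?T = U \<inter> \<phi> -` V" using U(1) by auto
  moreover have "openin (mtop P) ?T"
    using openin_smooth_map_vimage[OF \<phi>] manifold_charts(1)[OF N V(1)] by blast
  ultimately show "\<exists>T. openin (mtop P) T \<and> q \<in> T \<and> smooth_on (\<kappa> ` (U \<inter> T)) (\<lambda>x. f (\<phi> (inv_into U \<kappa> x)))"
    using q U(1) V(2) by (intro exI[of _ ?T]) auto
qed

lemma smooth_map_compose:
  assumes P: "open_charts P" and N: "smooth_manifold N" and \<phi>: "smooth_map P N \<phi>" and \<psi>: "smooth_map N N' \<psi>"
  shows "smooth_map P N' (\<lambda>x. \<psi> (\<phi> x))"
  unfolding smooth_map_def comp_def
proof (intro conjI ballI, goal_cases)
  case 1
  then show ?case
    using \<phi> \<psi> continuous_map_compose[of "mtop P" "mtop N" \<phi> "mtop N'" \<psi>]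
    unfolding smooth_map_def comp_def by blast
next
  case (2 c)
  show ?case
  proof (cases c, safe)
    fix U \<kappa> W \<zeta> assume c0: "c = (U, \<kappa>)" and cW: "(W, \<zeta>) \<in> charts N'"
    then have c: "(U, \<kappa>) \<in> charts P" using 2 by simp
    note U = open_chartsD[OF P c]
    show "smooth_on (\<kappa> ` (U \<inter> (\<lambda>x. \<psi> (\<phi> x)) -` W)) (\<lambda>x. \<zeta> (\<psi> (\<phi> (inv_into U \<kappa> x))))"
    proof (rule smooth_on_chart_local[OF P c])
      fix q assume q: "q \<in> U \<inter> (\<lambda>x. \<psi> (\<phi> x)) -` W"
      obtain V \<eta> where V: "(V, \<eta>) \<in> charts N" "\<phi> q \<in> V"
        using manifold_cover[OF N] smooth_map_points[OF \<phi>] q U(1) by (metis IntD1 subsetD)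
      note inj = inv_into_f_f[OF U(2)] inv_into_f_f[OF manifold_charts(5)[OF N V(1)]]
      let ?T = "{x\<in>points P. \<phi> x \<in> V}"
      let ?S = "U \<inter> (\<lambda>x. \<psi> (\<phi> x)) -` W \<inter> ?T"
      have "smooth_on (\<kappa> ` ?S) (\<lambda>x. \<eta> (\<phi> (inv_into U \<kappa> x)))"
        by (rule smooth_on_subset[OF smooth_mapD[OF \<phi> c V(1)]]) auto
      then have "smooth_on (\<kappa> ` ?S) (\<lambda>x. \<zeta> (\<psi> (inv_into V \<eta> (\<eta> (\<phi> (inv_into U \<kappa> x))))))"
        by (rule smooth_on_compose[OF _ smooth_mapD[OF \<psi> V(1) cW]]) (auto simp: inj)
      then have "smooth_on (\<kappa> ` ?S) (\<lambda>x. \<zeta> (\<psi> (\<phi> (inv_into U \<kappa> x))))"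
        by (rule smooth_on_cong) (auto simp: inj)
      moreover have "openin (mtop P) ?T"
        using openin_smooth_map_vimage[OF \<phi>] manifold_charts(1)[OF N V(1)] by blast
      ultimately show "\<exists>T. openin (mtop P) T \<and> q \<in> T \<and>
          smooth_on (\<kappa> ` (U \<inter> (\<lambda>x. \<psi> (\<phi> x)) -` W \<inter> T)) (\<lambda>x. \<zeta> (\<psi> (\<phi> (inv_into U \<kappa> x))))"
        using q U(1) V(2) by (intro exI[of _ ?T]) auto
    qed auto
  qed
qed

lemma smooth_map_const:
  assumes "c \<in> points N"
  shows "smooth_map P N (\<lambda>_. c)"
  using assms unfolding smooth_map_def comp_def by (auto intro: smooth_on_const)

text \<open>For the identity, smoothness in charts is exactly the compatibility of the
  charts.\<close>

lemma smooth_map_id: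
  assumes M: "smooth_manifold M"
  shows "smooth_map M M (\<lambda>p. p)"
proof -
  have "\<forall>(U, \<kappa>)\<in>charts M. \<forall>(V, \<eta>)\<in>charts M. smooth_on (\<kappa> ` (U \<inter> V)) (\<eta> \<circ> inv_into U \<kappa>)"
    using M unfolding smooth_manifold_def by (elim conjE)
  then show ?thesis
    unfolding smooth_map_def id_def[symmetric] by simp
qed

lemma smooth_functions_cong:
  assumes P: "open_charts P" and f: "f \<in> smooth_functions P" and "\<And>p. p \<in> points P \<Longrightarrow> f p = f' p"
  shows "f' \<in> smooth_functions P"
proof -
  have "smooth_on (\<kappa> ` U) (f' \<circ> inv_into U \<kappa>)" if c: "(U, \<kappa>) \<in> charts P" for U \<kappa>
    using smooth_functionsD[OF f c]
    by (rule smooth_on_cong)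
      (use assms(3) open_chartsD[OF P c] in \<open>auto simp: inv_into_f_f subset_iff\<close>)
  then show ?thesis unfolding smooth_functions_def by blast
qed

lemma smooth_functions_const: "(\<lambda>_. c) \<in> smooth_functions P"
  unfolding smooth_functions_def comp_def by (auto intro: smooth_on_const)

lemma smooth_functions_add:
  "f \<in> smooth_functions P \<Longrightarrow> f' \<in> smooth_functions P \<Longrightarrow> (\<lambda>p. f p + f' p) \<in> smooth_functions P"
  unfolding smooth_functions_def comp_def by (auto intro: smooth_on_add)

lemma smooth_functions_mult:
  "f \<in> smooth_functions P \<Longrightarrow> f' \<in> smooth_functions P \<Longrightarrow> (\<lambda>p. f p * f' p) \<in> smooth_functions P"
  unfolding smooth_functions_def comp_def by (auto intro: smooth_on_mult)

lemma smooth_functions_sum: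
  "(\<And>i. i \<in> I \<Longrightarrow> f i \<in> smooth_functions P) \<Longrightarrow> (\<lambda>p. \<Sum>i\<in>I. f i p) \<in> smooth_functions P"
  by (induction I rule: infinite_finite_induct)
    (auto intro: smooth_functions_const smooth_functions_add)

lemma smooth_functions_diff:
  assumes "f \<in> smooth_functions P" "f' \<in> smooth_functions P"
  shows "(\<lambda>p. f p - f' p) \<in> smooth_functions P"
  using smooth_functions_add[OF assms(1) smooth_functions_mult[OF smooth_functions_const[of "-1"] assms(2)]]
  by simp

text \<open>A cut-off function times F in coordinates, extended by zero. The set S is fixed before
  F, so that all coordinate functions, or all the Hadamard quotients, are extended from one common
  neighbourhood; the vanishing outside T provides bump functions.\<close>

lemma smooth_extension:
  assumes M: "smooth_manifold M" and c: "(U, \<kappa>) \<in> charts M" and p: "p \<in> U"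
    and T: "openin (mtop M) T" "p \<in> T" and W: "open W" "\<kappa> p \<in> W"
  obtains S where "openin (mtop M) S" "p \<in> S" "S \<subseteq> U" "S \<subseteq> T" "\<kappa> ` S \<subseteq> W"
    "\<And>F. Cinf_on W F \<Longrightarrow> \<exists>f\<in>smooth_functions M. (\<forall>q\<in>S. f q = F (\<kappa> q)) \<and> (\<forall>q. q \<notin> T \<longrightarrow> f q = 0)"
proof -
  note oc = manifold_open_charts[OF M]
  note U = manifold_charts[OF M c] open_chartsD(3)[OF oc c]
  obtain W' where W': "open W'" "\<kappa> ` (U \<inter> T) = model M \<inter> W'"
    using U(6)[OF T(1)] by (auto simp: openin_open)
  have mod: "\<kappa> ` U \<subseteq> model M" using U(3) openin_subset by fastforce
  have "\<kappa> p \<in> W \<inter> W'" using W(2) W'(2) p T(2) by auto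
  then obtain r' where r': "r' > 0" "cball (\<kappa> p) r' \<subseteq> W \<inter> W'"
    using open_contains_cball[of "W \<inter> W'"] W(1) W'(1) by blast
  \<comment> \<open>Halved because the cut-off is supported in radius 2 r, and this closed ball has
    to fit into both W and W'.\<close>
  define r where "r = r' / 2"
  have r: "r > 0" "cball (\<kappa> p) (2 * r) \<subseteq> W \<inter> W'" using r' by (auto simp: r_def)
  obtain \<rho> :: "'b \<Rightarrow> real" where \<rho>: "Cinf_on UNIV \<rho>" "\<And>x. x \<in> ball (\<kappa> p) r \<Longrightarrow> \<rho> x = 1"
    "\<And>x. x \<notin> ball (\<kappa> p) (2 * r) \<Longrightarrow> \<rho> x = 0"
    using cutoff_exists[OF r(1)] by metis
  define C where "C = {q\<in>U. \<kappa> q \<in> cball (\<kappa> p) (2 * r)}"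
  have UT: "q \<in> T" if "q \<in> U" "\<kappa> q \<in> cball (\<kappa> p) (2 * r)" for q
  proof -
    have "\<kappa> q \<in> \<kappa> ` (U \<inter> T)" using W'(2) r(2) mod that by auto
    then show ?thesis using U(5) that(1) by (auto dest: inj_onD)
  qed
  \<comment> \<open>Here the Hausdorff property enters: C is the image of a compact piece of the
    model under the inverse chart, hence compact and closed. So f vanishes on an open set around
    every point outside U, which makes the extension by zero smooth there.\<close>
  have "closedin (mtop M) C"
  proof -
    obtain g where g: "homeomorphic_maps (subtopology (mtop M) U) (top_of_set (\<kappa> ` U)) \<kappa> g"
      using U(4) homeomorphic_map_maps by blast
    have "model M \<inter> cball (\<kappa> p) (2 * r) \<subseteq> \<kappa> ` U" using W'(2) r(2) by auto
    moreover have "compact (model M \<inter> cball (\<kappa> p) (2 * r))"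
      using M by (auto simp: smooth_manifold_def intro!: closed_Int_compact closed_subspace)
    ultimately have "compactin (top_of_set (\<kappa> ` U)) (model M \<inter> cball (\<kappa> p) (2 * r))"
      by (simp add: compactin_subtopology)
    then have "compactin (subtopology (mtop M) U) (g ` (model M \<inter> cball (\<kappa> p) (2 * r)))"
      using g image_compactin unfolding homeomorphic_maps_def by blast
    moreover have "g ` (model M \<inter> cball (\<kappa> p) (2 * r)) = C"
    proof -
      have gk: "g (\<kappa> q) = q" if "q \<in> U" for q
        using g that U(2) unfolding homeomorphic_maps_def by auto
      have "model M \<inter> cball (\<kappa> p) (2 * r) = \<kappa> ` C"
        using \<open>model M \<inter> cball (\<kappa> p) (2 * r) \<subseteq> \<kappa> ` U\<close> mod unfolding C_def by auto
      then show ?thesis using gk by (force simp: C_def image_iff)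
    qed
    ultimately have "compactin (mtop M) C" by (simp add: compactin_subtopology)
    moreover have "Hausdorff_space (mtop M)" using M by (simp add: smooth_manifold_def)
    ultimately show ?thesis by (metis compactin_imp_closedin)
  qed
  define S where "S = {q\<in>U. \<kappa> q \<in> ball (\<kappa> p) r}"
  have S: "openin (mtop M) S" "p \<in> S" "S \<subseteq> U" "S \<subseteq> T" "\<kappa> ` S \<subseteq> W"
    using openin_chart_vimage[OF M c, of "ball (\<kappa> p) r"] p r UT unfolding S_def by auto
  have ext: "\<exists>f\<in>smooth_functions M. (\<forall>q\<in>S. f q = F (\<kappa> q)) \<and> (\<forall>q. q \<notin> T \<longrightarrow> f q = 0)"
    if F: "Cinf_on W F" for F
  proof -
    define G where "G = (\<lambda>x. if x \<in> W then \<rho> x * F x else 0)"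
    have "Ck_on k UNIV G" for k
    proof (rule Ck_on_local)
      fix x :: 'b
      have 1: "Ck_on k W G"
        using Cinf_on_mult[OF Cinf_on_subset[OF \<rho>(1) W(1)] F] Cinf_on_cong[of W "\<lambda>x. \<rho> x * F x" G]
        by (auto simp: Cinf_on_def G_def)
      have 2: "Ck_on k (- cball (\<kappa> p) (2 * r)) G"
        by (rule Ck_on_cong[OF _ _ Ck_on_const[of _ _ 0]]) (auto simp: G_def \<rho>(3))
      show "\<exists>W'. open W' \<and> x \<in> W' \<and> Ck_on k W' G"
      proof (cases "x \<in> W")
        case True
        then show ?thesis using 1 W(1) by blast
      next
        case False
        then have "x \<in> - cball (\<kappa> p) (2 * r)" using r(2) by blast
        then show ?thesis using 2 by (metis closed_cball open_Compl)
      qed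
    qed
    then have G: "smooth_on UNIV G" by (intro Cinf_on_imp_smooth_on[of UNIV]) (auto simp: Cinf_on_def)
    define f where "f = (\<lambda>q. if q \<in> U then G (\<kappa> q) else 0)"
    have f0: "f q = 0" if "q \<notin> C" for q
      using that by (auto simp: f_def G_def C_def \<rho>(3))
    have "f \<in> smooth_functions M"
    proof (rule smooth_functionsI[OF oc])
      fix V \<eta> q assume cV: "(V, \<eta>) \<in> charts M" and q: "q \<in> V"
      note inj = inv_into_f_f[OF manifold_charts(5)[OF M cV]]
      show "\<exists>T. openin (mtop M) T \<and> q \<in> T \<and> smooth_on (\<eta> ` (V \<inter> T)) (\<lambda>x. f (inv_into V \<eta> x))"
      proof (cases "q \<in> U")
        case True
        have "smooth_on (\<eta> ` (V \<inter> U)) (\<lambda>x. G (\<kappa> (inv_into V \<eta> x)))"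
          by (rule smooth_on_compose[OF smooth_mapD[OF smooth_map_id[OF M] cV c, unfolded vimage_ident] G]) auto
        then have "smooth_on (\<eta> ` (V \<inter> U)) (\<lambda>x. f (inv_into V \<eta> x))"
          by (rule smooth_on_cong) (auto simp: inj f_def)
        then show ?thesis using True U(1) by blast
      next
        case False
        have "smooth_on (\<eta> ` (V \<inter> (points M - C))) (\<lambda>x. f (inv_into V \<eta> x))"
          by (rule smooth_on_cong[OF smooth_on_const[of _ 0]]) (auto simp: inj f0)
        moreover have "q \<in> points M - C"
          using False q manifold_charts(2)[OF M cV] by (auto simp: C_def)
        ultimately show ?thesis using \<open>closedin (mtop M) C\<close> by blast
      qed
    qed
    moreover have "f q = F (\<kappa> q)" if "q \<in> S" for q
    proof -
      have "\<kappa> q \<in> W" using S(5) that by blast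
      then show ?thesis using that by (simp add: f_def G_def S_def \<rho>(2))
    qed
    moreover have "f q = 0" if "q \<notin> T" for q
      using f0 UT that by (auto simp: C_def)
    ultimately show ?thesis by blast
  qed
  show thesis by (rule that[OF S ext])
qed

section \<open>Derivations at a point: Leibniz rule, locality, coordinates\<close>

lemma tangent_space_add:
  assumes "v \<in> tangent_space M p" "f \<in> smooth_functions M" "f' \<in> smooth_functions M"
  shows "v (\<lambda>q. f q + f' q) = v f + v f'"
  using assms unfolding tangent_space_def plus_fun_def by blast

lemma tangent_space_mult:
  assumes "v \<in> tangent_space M p" "f \<in> smooth_functions M" "f' \<in> smooth_functions M"
  shows "v (\<lambda>q. f q * f' q) = v f * f' p + f p * v f'"
  using assms unfolding tangent_space_def times_fun_def by blast

lemma tangent_space_cmult: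
  assumes "v \<in> tangent_space M p" "f \<in> smooth_functions M"
  shows "v (\<lambda>q. c * f q) = c * v f"
  using assms unfolding tangent_space_def scaleR_fun_def real_scaleR_def by blast

lemma tangent_space_nonsmooth:
  "v \<in> tangent_space M p \<Longrightarrow> f \<notin> smooth_functions M \<Longrightarrow> v f = 0"
  unfolding tangent_space_def by blast

lemma tangent_spaceI:
  assumes "\<And>f f'. f \<in> smooth_functions M \<Longrightarrow> f' \<in> smooth_functions M \<Longrightarrow> v (\<lambda>q. f q + f' q) = v f + v f'"
    and "\<And>f f'. f \<in> smooth_functions M \<Longrightarrow> f' \<in> smooth_functions M \<Longrightarrow>
      v (\<lambda>q. f q * f' q) = v f * f' p + f p * v f'"
    and "\<And>c f. f \<in> smooth_functions M \<Longrightarrow> v (\<lambda>q. c * f q) = c * v f"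
    and "\<And>f. f \<notin> smooth_functions M \<Longrightarrow> v f = 0"
  shows "v \<in> tangent_space M p"
  using assms unfolding tangent_space_def plus_fun_def times_fun_def scaleR_fun_def real_scaleR_def by blast

lemma tangent_space_const:
  assumes "v \<in> tangent_space M p"
  shows "v (\<lambda>_. c) = 0"
proof -
  have "v (\<lambda>_. 1 * 1) = v (\<lambda>_. 1) * 1 + 1 * v (\<lambda>_. 1)"
    by (rule tangent_space_mult[OF assms smooth_functions_const smooth_functions_const])
  then have "v (\<lambda>_. 1) = 0" by simp
  then show ?thesis
    using tangent_space_cmult[OF assms smooth_functions_const, of c 1] by simp
qed

lemma tangent_space_sum:
  assumes "v \<in> tangent_space M p" "\<And>i. i \<in> I \<Longrightarrow> f i \<in> smooth_functions M"
  shows "v (\<lambda>q. \<Sum>i\<in>I. f i q) = (\<Sum>i\<in>I. v (f i))"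
  using assms(2)
proof (induction I rule: infinite_finite_induct)
  case (insert i I)
  then show ?case
    using tangent_space_add[OF assms(1), of "f i" "\<lambda>q. \<Sum>i\<in>I. f i q"]
    by (simp add: smooth_functions_sum)
qed (simp_all add: tangent_space_const[OF assms(1)])

lemma tangent_space_diff:
  assumes v: "v \<in> tangent_space M p" and f: "f \<in> smooth_functions M" "f' \<in> smooth_functions M"
  shows "v (\<lambda>q. f q - f' q) = v f - v f'"
  using tangent_space_add[OF v f(1) smooth_functions_mult[OF smooth_functions_const[of "-1"] f(2)]]
    tangent_space_cmult[OF v f(2), of "-1"] by simp

lemma subspace_tangent_space: "subspace (tangent_space M p)"
  by (rule subspaceI; rule tangent_spaceI)
    (auto simp: scaleR_fun_def tangent_space_add tangent_space_mult tangent_space_cmult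
      tangent_space_nonsmooth algebra_simps)

lemma tangent_space_cong:
  assumes M: "open_charts M" and p: "p \<in> points M" and v: "v \<in> tangent_space M p"
    and eq: "\<And>q. q \<in> points M \<Longrightarrow> f q = f' q"
  shows "v f = v f'"
proof (cases "f \<in> smooth_functions M")
  case True
  have f': "f' \<in> smooth_functions M" by (rule smooth_functions_cong[OF M True eq])
  let ?d = "\<lambda>q. f q - f' q" and ?i = "\<lambda>q. if q \<in> points M then 0 else 1 :: real"
  have i: "?i \<in> smooth_functions M"
    by (rule smooth_functions_cong[OF M smooth_functions_const[of 0]]) simp
  have "(\<lambda>q. ?i q * ?d q) = ?d" using eq by auto
  then have "v ?d = v (\<lambda>q. ?i q * ?d q)" by simp
  also have "\<dots> = v ?i * ?d p + ?i p * v ?d"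
    by (rule tangent_space_mult[OF v i smooth_functions_diff[OF True f']])
  also have "\<dots> = 0" using p eq by simp
  finally show ?thesis using tangent_space_diff[OF v True f'] by simp
next
  case False
  then have "f' \<notin> smooth_functions M" using smooth_functions_cong[OF M, of f' f] eq by auto
  then show ?thesis using False tangent_space_nonsmooth[OF v] by simp
qed

text \<open>For a bump function \<rho> with value 1 at p and 0 outside T the product \<rho> (f - f')
  is zero. Since f - f' vanishes at p, the Leibniz rule evaluates v on this product to v (f -
  f').\<close>

lemma tangent_space_local:
  assumes M: "smooth_manifold M" and v: "v \<in> tangent_space M p"
    and T: "openin (mtop M) T" "p \<in> T" and eq: "\<And>q. q \<in> T \<Longrightarrow> f q = f' q"
    and f: "f \<in> smooth_functions M" "f' \<in> smooth_functions M"
  shows "v f = v f'"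
proof -
  have p: "p \<in> points M" using T openin_subset by blast
  obtain U \<kappa> where c: "(U, \<kappa>) \<in> charts M" "p \<in> U" using manifold_cover[OF M p] .
  obtain S where S: "p \<in> S" "\<exists>f\<in>smooth_functions M. (\<forall>q\<in>S. f q = 1) \<and> (\<forall>q. q \<notin> T \<longrightarrow> f q = 0)"
    using smooth_extension[OF M c T open_UNIV UNIV_I] Cinf_on_const[of UNIV 1] by (metis open_UNIV)
  then obtain \<rho> where \<rho>: "\<rho> \<in> smooth_functions M" "\<rho> p = 1" "\<And>q. q \<notin> T \<Longrightarrow> \<rho> q = 0" by metis
  let ?d = "\<lambda>q. f q - f' q"
  have "(\<lambda>q. \<rho> q * ?d q) = (\<lambda>_. 0)" using \<rho>(3) eq by fastforce
  then have "0 = v (\<lambda>q. \<rho> q * ?d q)" using tangent_space_const[OF v] by simp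
  also have "\<dots> = v \<rho> * ?d p + \<rho> p * v ?d"
    by (rule tangent_space_mult[OF v \<rho>(1) smooth_functions_diff[OF f]])
  also have "\<dots> = v ?d" using \<rho>(2) eq[OF T(2)] by simp
  finally show ?thesis using tangent_space_diff[OF v f] by simp
qed

text \<open>Hadamard's lemma writes f near p as a constant plus products of a function vanishing at
  p and another smooth function; the Leibniz rule keeps one term of each product. The sum runs over
  the basis of the ambient space even when the model is a proper subspace, and F may be any local
  extension of the coordinate expression.\<close>

lemma tangent_space_coordinates:
  assumes M: "smooth_manifold M" and c: "(U, \<kappa>) \<in> charts M" "p \<in> U"
    and v: "v \<in> tangent_space M p"
    and S: "openin (mtop M) S" "p \<in> S" "S \<subseteq> U"
    and y: "\<And>b. b \<in> Basis \<Longrightarrow> y b \<in> smooth_functions M" "\<And>b q. b \<in> Basis \<Longrightarrow> q \<in> S \<Longrightarrow> y b q = \<kappa> q \<bullet> b"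
    and W: "Cinf_on W F" "\<kappa> p \<in> W" and f: "f \<in> smooth_functions M"
    and fF: "\<And>q. q \<in> U \<Longrightarrow> \<kappa> q \<in> W \<Longrightarrow> f q = F (\<kappa> q)"
  shows "v f = (\<Sum>b\<in>Basis. v (y b) * frechet_derivative F (at (\<kappa> p)) b)"
proof -
  obtain r where r: "r > 0" "ball (\<kappa> p) r \<subseteq> W"
    using Cinf_on_open[OF W(1)] W(2) open_contains_ball by blast
  obtain g where g: "\<And>b. Cinf_on (ball (\<kappa> p) r) (g b)"
    "\<And>x. x \<in> ball (\<kappa> p) r \<Longrightarrow> F x = F (\<kappa> p) + (\<Sum>b\<in>Basis. ((x - \<kappa> p) \<bullet> b) * g b x)"
    "\<And>b. g b (\<kappa> p) = frechet_derivative F (at (\<kappa> p)) b"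
    using Hadamard[OF Cinf_on_subset[OF W(1) open_ball r(2)] r(1)] by metis
  have "\<kappa> p \<in> ball (\<kappa> p) r" using r(1) by simp
  then obtain T where T: "openin (mtop M) T" "p \<in> T" "T \<subseteq> S" "\<kappa> ` T \<subseteq> ball (\<kappa> p) r"
    "\<And>F. Cinf_on (ball (\<kappa> p) r) F \<Longrightarrow> \<exists>f\<in>smooth_functions M. (\<forall>q\<in>T. f q = F (\<kappa> q))"
    using smooth_extension[OF M c S(1,2) open_ball, of "\<kappa> p" r] by metis
  obtain h where h: "\<And>b. h b \<in> smooth_functions M" "\<And>b q. q \<in> T \<Longrightarrow> h b q = g b (\<kappa> q)"
    using T(5)[OF g(1)] by metis
  let ?f = "\<lambda>q. F (\<kappa> p) + (\<Sum>b\<in>Basis. (y b q - \<kappa> p \<bullet> b) * h b q)"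
  have yk: "(\<lambda>q. y b q - \<kappa> p \<bullet> b) \<in> smooth_functions M" if "b \<in> Basis" for b
    by (rule smooth_functions_diff[OF y(1)[OF that] smooth_functions_const])
  have s: "(\<lambda>q. (y b q - \<kappa> p \<bullet> b) * h b q) \<in> smooth_functions M" if "b \<in> Basis" for b
    by (rule smooth_functions_mult[OF yk[OF that] h(1)])
  have s': "(\<lambda>q. \<Sum>b\<in>Basis. (y b q - \<kappa> p \<bullet> b) * h b q) \<in> smooth_functions M"
    by (rule smooth_functions_sum[OF s])
  have "v f = v ?f"
  proof (rule tangent_space_local[OF M v T(1,2) _ f smooth_functions_add[OF smooth_functions_const s']])
    fix q assume q: "q \<in> T"
    then have k: "\<kappa> q \<in> ball (\<kappa> p) r" "q \<in> S" "q \<in> U" using T S by auto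
    then have "f q = F (\<kappa> q)" using fF r(2) by blast
    also have "\<dots> = ?f q"
      unfolding g(2)[OF k(1)] using y(2) k(2) h(2)[OF q] by (simp add: inner_diff_left)
    finally show "f q = ?f q" .
  qed
  also have "\<dots> = (\<Sum>b\<in>Basis. v (\<lambda>q. (y b q - \<kappa> p \<bullet> b) * h b q))"
    using tangent_space_add[OF v smooth_functions_const s'] tangent_space_sum[OF v s]
    by (simp add: tangent_space_const[OF v])
  also have "\<dots> = (\<Sum>b\<in>Basis. v (y b) * frechet_derivative F (at (\<kappa> p)) b)"
  proof (rule sum.cong[OF refl])
    fix b :: 'b assume b: "b \<in> Basis"
    have "v (\<lambda>q. (y b q - \<kappa> p \<bullet> b) * h b q)
        = v (\<lambda>q. y b q - \<kappa> p \<bullet> b) * h b p + (y b p - \<kappa> p \<bullet> b) * v (h b)"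
      by (rule tangent_space_mult[OF v yk[OF b] h(1)])
    also have "v (\<lambda>q. y b q - \<kappa> p \<bullet> b) = v (y b)"
      using tangent_space_diff[OF v y(1)[OF b] smooth_functions_const] tangent_space_const[OF v] by simp
    finally show "v (\<lambda>q. (y b q - \<kappa> p \<bullet> b) * h b q) = v (y b) * frechet_derivative F (at (\<kappa> p)) b"
      using y(2)[OF b S(2)] h(2)[OF T(2)] g(3) by simp
  qed
  finally show ?thesis .
qed

lemma coordinates_exist:
  assumes M: "smooth_manifold M" and c: "(U, \<kappa>) \<in> charts M" "p \<in> U"
  obtains S y where "openin (mtop M) S" "p \<in> S" "S \<subseteq> U"
    "\<And>b. b \<in> Basis \<Longrightarrow> y b \<in> smooth_functions M" "\<And>b q. b \<in> Basis \<Longrightarrow> q \<in> S \<Longrightarrow> y b q = \<kappa> q \<bullet> b"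
proof -
  have p: "p \<in> points M" using manifold_charts(2)[OF M c(1)] c(2) by blast
  obtain S where S: "openin (mtop M) S" "p \<in> S" "S \<subseteq> U"
    "\<And>F. Cinf_on UNIV F \<Longrightarrow> \<exists>f\<in>smooth_functions M. (\<forall>q\<in>S. f q = F (\<kappa> q))"
    using smooth_extension[OF M c openin_topspace p open_UNIV UNIV_I] by metis
  have "\<exists>f\<in>smooth_functions M. (\<forall>q\<in>S. f q = \<kappa> q \<bullet> b)" for b
    by (rule S(4)[of "\<lambda>x. x \<bullet> b"]) (intro Cinf_on_bounded_linear open_UNIV bounded_linear_inner_left)
  then obtain y where y: "\<And>b. y b \<in> smooth_functions M" "\<And>b q. q \<in> S \<Longrightarrow> y b q = \<kappa> q \<bullet> b"
    by metis
  show thesis using that[OF S(1-3), of y] y by blast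
qed

text \<open>Finitely many numbers determine a derivation; the finite dimension of the Lie algebra is
  derived from this.\<close>

lemma tangent_space_eqI_coordinates:
  fixes M :: "('p, 'a::euclidean_space) manifold"
  assumes M: "smooth_manifold M" and p: "p \<in> points M"
  obtains y :: "'a \<Rightarrow> 'p \<Rightarrow> real" where "\<And>b. b \<in> Basis \<Longrightarrow> y b \<in> smooth_functions M"
    "\<And>v w. v \<in> tangent_space M p \<Longrightarrow> w \<in> tangent_space M p \<Longrightarrow> (\<And>b. b \<in> Basis \<Longrightarrow> v (y b) = w (y b)) \<Longrightarrow> v = w"
proof -
  obtain U \<kappa> where c: "(U, \<kappa>) \<in> charts M" "p \<in> U" using manifold_cover[OF M p] .
  obtain S y where S: "openin (mtop M) S" "p \<in> S" "S \<subseteq> U"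
    and y: "\<And>b. b \<in> Basis \<Longrightarrow> y b \<in> smooth_functions M" "\<And>b q. b \<in> Basis \<Longrightarrow> q \<in> S \<Longrightarrow> y b q = \<kappa> q \<bullet> b"
    using coordinates_exist[OF M c] by metis
  have apply_eq: "v f = w f" if v: "v \<in> tangent_space M p" and w: "w \<in> tangent_space M p"
    and eq: "\<And>b. b \<in> Basis \<Longrightarrow> v (y b) = w (y b)" for v w f
  proof (cases "f \<in> smooth_functions M")
    case True
    have "\<kappa> p \<in> \<kappa> ` U" using c(2) by simp
    then obtain W F where W: "\<kappa> p \<in> W" "Cinf_on W F" "\<forall>x\<in>\<kappa> ` U \<inter> W. F x = f (inv_into U \<kappa> x)"
      using smooth_onD[OF smooth_functionsD[OF True c(1)]] by metis
    have fF: "f q = F (\<kappa> q)" if "q \<in> U" "\<kappa> q \<in> W" for q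
      using W(3) that by (simp add: inv_into_f_f[OF manifold_charts(5)[OF M c(1)]])
    have "v f = (\<Sum>b\<in>Basis. v (y b) * frechet_derivative F (at (\<kappa> p)) b)"
      by (rule tangent_space_coordinates[OF M c v S y W(2,1) True fF])
    also have "\<dots> = (\<Sum>b\<in>Basis. w (y b) * frechet_derivative F (at (\<kappa> p)) b)"
      using eq by simp
    also have "\<dots> = w f"
      by (rule tangent_space_coordinates[OF M c w S y W(2,1) True fF, symmetric])
    finally show ?thesis .
  next
    case False
    then show ?thesis using tangent_space_nonsmooth[OF v] tangent_space_nonsmooth[OF w] by simp
  qed
  have "v = w" if "v \<in> tangent_space M p" "w \<in> tangent_space M p"
    "\<And>b. b \<in> Basis \<Longrightarrow> v (y b) = w (y b)" for v w
    by (rule ext, rule apply_eq[OF that])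
  from that[OF y(1) this] show thesis .
qed

subsection \<open>Products\<close>

text \<open>An open set of the product contains an open box around each of its points, and a product
  chart maps a box to a product of relatively open sets.\<close>

lemma prod_open_charts:
  assumes M: "open_charts M" and N: "open_charts N"
  shows "open_charts (prod_manifold M N)"
  unfolding open_charts_def
proof (intro ballI, clarify)
  fix c k assume "(c, k) \<in> charts (prod_manifold M N)"
  then obtain U \<kappa> V \<eta> where ck: "c = U \<times> V" "k = map_prod \<kappa> \<eta>" and
    U: "(U, \<kappa>) \<in> charts M" and V: "(V, \<eta>) \<in> charts N"
    by (auto simp: prod_manifold_def)
  note cU = open_chartsD[OF M U] and cV = open_chartsD[OF N V]
  have "openin (top_of_set (model M \<times> model N)) (k ` (c \<inter> T))"
    if T: "openin (prod_topology (mtop M) (mtop N)) T" for T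
  proof (subst openin_subopen, intro ballI)
    fix z assume "z \<in> k ` (c \<inter> T)"
    then obtain a b where ab: "(a, b) \<in> T" "a \<in> U" "b \<in> V" and z: "z = k (a, b)" by (auto simp: ck)
    obtain A B where AB: "openin (mtop M) A" "openin (mtop N) B" "a \<in> A" "b \<in> B" "A \<times> B \<subseteq> T"
      using T[unfolded openin_prod_topology_alt, rule_format, OF ab(1)] by (elim exE conjE)
    have "openin (top_of_set (model M \<times> model N)) (\<kappa> ` (U \<inter> A) \<times> \<eta> ` (V \<inter> B))"
      using openin_Times[OF cU(3)[OF AB(1)] cV(3)[OF AB(2)]] .
    moreover have "k (a, b) \<in> \<kappa> ` (U \<inter> A) \<times> \<eta> ` (V \<inter> B)" using ab AB by (auto simp: ck)
    moreover have "\<kappa> ` (U \<inter> A) \<times> \<eta> ` (V \<inter> B) \<subseteq> k ` (c \<inter> T)"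
    proof
      fix z assume "z \<in> \<kappa> ` (U \<inter> A) \<times> \<eta> ` (V \<inter> B)"
      then obtain x y where "x \<in> U \<inter> A" "y \<in> V \<inter> B" "z = (\<kappa> x, \<eta> y)" by auto
      then show "z \<in> k ` (c \<inter> T)" using AB(5) by (intro image_eqI[of _ _ "(x, y)"]) (auto simp: ck)
    qed
    ultimately show "\<exists>S. openin (top_of_set (model M \<times> model N)) S \<and> z \<in> S \<and> S \<subseteq> k ` (c \<inter> T)"
      unfolding z by (intro exI[of _ "\<kappa> ` (U \<inter> A) \<times> \<eta> ` (V \<inter> B)"] conjI)
  qed
  moreover have "c \<subseteq> points (prod_manifold M N)"
    using cU(1) cV(1) by (auto simp: ck prod_manifold_def)
  moreover have "inj_on k c"
    using cU(2) cV(2) by (auto simp: ck inj_on_def)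
  ultimately show "c \<subseteq> points (prod_manifold M N) \<and> inj_on k c \<and>
     (\<forall>T. openin (mtop (prod_manifold M N)) T \<longrightarrow> openin (top_of_set (model (prod_manifold M N))) (k ` (c \<inter> T)))"
    by (simp add: prod_manifold_def)
qed

lemma smooth_functions_prodD:
  assumes M: "smooth_manifold M" and N: "smooth_manifold N"
    and K: "K \<in> smooth_functions (prod_manifold M N)"
    and U: "(U, \<kappa>) \<in> charts M" and V: "(V, \<eta>) \<in> charts N" and "p \<in> U" "q \<in> V"
  obtains W F where "Cinf_on W F" "(\<kappa> p, \<eta> q) \<in> W"
    "\<And>x y. x \<in> U \<Longrightarrow> y \<in> V \<Longrightarrow> (\<kappa> x, \<eta> y) \<in> W \<Longrightarrow> K (x, y) = F (\<kappa> x, \<eta> y)"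
proof -
  have "(U \<times> V, map_prod \<kappa> \<eta>) \<in> charts (prod_manifold M N)"
    using U V by (auto simp: prod_manifold_def)
  from smooth_functionsD[OF K this]
  have s: "smooth_on (map_prod \<kappa> \<eta> ` (U \<times> V)) (\<lambda>x. K (inv_into (U \<times> V) (map_prod \<kappa> \<eta>) x))" .
  have inj: "inj_on (map_prod \<kappa> \<eta>) (U \<times> V)"
    using manifold_charts(5)[OF M U] manifold_charts(5)[OF N V] by (auto simp: inj_on_def)
  have inv: "inv_into (U \<times> V) (map_prod \<kappa> \<eta>) (\<kappa> x, \<eta> y) = (x, y)" if "x \<in> U" "y \<in> V" for x y
    using inv_into_f_f[OF inj, of "(x, y)"] that by simp
  have "(\<kappa> p, \<eta> q) \<in> map_prod \<kappa> \<eta> ` (U \<times> V)" using \<open>p \<in> U\<close> \<open>q \<in> V\<close> by force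
  from smooth_onD[OF s this] obtain W F where W: "(\<kappa> p, \<eta> q) \<in> W" "Cinf_on W F"
    "\<forall>z\<in>map_prod \<kappa> \<eta> ` (U \<times> V) \<inter> W. F z = K (inv_into (U \<times> V) (map_prod \<kappa> \<eta>) z)" by blast
  have "K (x, y) = F (\<kappa> x, \<eta> y)" if "x \<in> U" "y \<in> V" "(\<kappa> x, \<eta> y) \<in> W" for x y
    using W(3) inv that by (force simp: image_iff)
  then show thesis using that W(1,2) by blast
qed

lemma smooth_functions_slice:
  assumes M: "smooth_manifold M" and N: "smooth_manifold N"
    and K: "K \<in> smooth_functions (prod_manifold M N)" and a: "a \<in> points M"
  shows "(\<lambda>y. K (a, y)) \<in> smooth_functions N"
proof (rule smooth_functionsI[OF manifold_open_charts[OF N]])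
  fix V \<eta> q assume V: "(V, \<eta>) \<in> charts N" and q: "q \<in> V"
  obtain U \<kappa> where U: "(U, \<kappa>) \<in> charts M" "a \<in> U" using manifold_cover[OF M a] .
  obtain W F where W: "Cinf_on W F" "(\<kappa> a, \<eta> q) \<in> W"
    "\<And>x y. x \<in> U \<Longrightarrow> y \<in> V \<Longrightarrow> (\<kappa> x, \<eta> y) \<in> W \<Longrightarrow> K (x, y) = F (\<kappa> x, \<eta> y)"
    using smooth_functions_prodD[OF M N K U(1) V U(2) q] by metis
  obtain A B where AB0: "open A" "open B" "(\<kappa> a, \<eta> q) \<in> A \<times> B" "A \<times> B \<subseteq> W"
    using open_prod_elim[OF Cinf_on_open[OF W(1)] W(2)] .
  then have AB: "open A" "open B" "\<kappa> a \<in> A" "\<eta> q \<in> B" "A \<times> B \<subseteq> W" by auto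
  let ?T = "{y\<in>V. \<eta> y \<in> B}"
  note inj = inv_into_f_f[OF manifold_charts(5)[OF N V]]
  have "smooth_on (\<eta> ` (V \<inter> ?T)) (\<lambda>y. F (\<kappa> a, y))"
    by (rule smooth_on_compose[OF smooth_on_Pair[OF smooth_on_const smooth_on_id]
          Cinf_on_imp_smooth_on[OF W(1) subset_refl]]) (use AB in auto)
  then have "smooth_on (\<eta> ` (V \<inter> ?T)) (\<lambda>x. K (a, inv_into V \<eta> x))"
    by (rule smooth_on_cong) (use W(3) U(2) AB in \<open>auto simp: inj subset_iff\<close>)
  then show "\<exists>T. openin (mtop N) T \<and> q \<in> T \<and> smooth_on (\<eta> ` (V \<inter> T)) (\<lambda>x. K (a, inv_into V \<eta> x))"
    using openin_chart_vimage[OF N V AB(2)] q AB(4) by (intro exI[of _ ?T]) auto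
qed

text \<open>Differentiating a smooth family of functions along a section is smooth in the parameter: in
  coordinates, the components of the section are smooth, and so are the partial derivatives of the family.\<close>

lemma smooth_section_apply:
  assumes P: "smooth_manifold P" and M: "smooth_manifold M" and N: "smooth_manifold N"
    and \<psi>: "smooth_map P M \<psi>" and \<phi>: "smooth_map P N \<phi>"
    and K: "K \<in> smooth_functions (prod_manifold M N)" and X: "X \<in> sections_along P N \<phi>"
  shows "(\<lambda>p. X p (\<lambda>y. K (\<psi> p, y))) \<in> smooth_functions P"
proof (rule smooth_functionsI[OF manifold_open_charts[OF P]])
  fix O' \<kappa> p assume c: "(O', \<kappa>) \<in> charts P" and p: "p \<in> O'"
  note cO = manifold_charts[OF P c] and inj = inv_into_f_f[OF manifold_charts(5)[OF P c]]
  have pP: "p \<in> points P" using cO(2) p by blast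
  obtain U \<mu> where U: "(U, \<mu>) \<in> charts M" "\<psi> p \<in> U" using manifold_cover[OF M smooth_map_points[OF \<psi> pP]] .
  obtain V \<eta> where V: "(V, \<eta>) \<in> charts N" "\<phi> p \<in> V" using manifold_cover[OF N smooth_map_points[OF \<phi> pP]] .
  obtain W F where W: "Cinf_on W F" "(\<mu> (\<psi> p), \<eta> (\<phi> p)) \<in> W"
    "\<And>x y. x \<in> U \<Longrightarrow> y \<in> V \<Longrightarrow> (\<mu> x, \<eta> y) \<in> W \<Longrightarrow> K (x, y) = F (\<mu> x, \<eta> y)"
    using smooth_functions_prodD[OF M N K U(1) V(1) U(2) V(2)] by metis
  obtain A B where AB0: "open A" "open B" "(\<mu> (\<psi> p), \<eta> (\<phi> p)) \<in> A \<times> B" "A \<times> B \<subseteq> W"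
    using open_prod_elim[OF Cinf_on_open[OF W(1)] W(2)] .
  then have AB: "open A" "open B" "\<mu> (\<psi> p) \<in> A" "\<eta> (\<phi> p) \<in> B" "A \<times> B \<subseteq> W" by auto
  obtain S y where S: "openin (mtop N) S" "\<phi> p \<in> S" "S \<subseteq> V"
    and y: "\<And>b. b \<in> Basis \<Longrightarrow> y b \<in> smooth_functions N" "\<And>b q. b \<in> Basis \<Longrightarrow> q \<in> S \<Longrightarrow> y b q = \<eta> q \<bullet> b"
    using coordinates_exist[OF N V] by metis
  let ?A = "{x\<in>U. \<mu> x \<in> A}" and ?B = "{x\<in>V. \<eta> x \<in> B} \<inter> S"
  let ?T = "{x\<in>points P. \<psi> x \<in> ?A} \<inter> {x\<in>points P. \<phi> x \<in> ?B}"
  have T: "openin (mtop P) ?T"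
    by (intro openin_Int openin_smooth_map_vimage[OF \<psi>] openin_smooth_map_vimage[OF \<phi>]
        openin_chart_vimage[OF M U(1) AB(1)] openin_chart_vimage[OF N V(1) AB(2)] S(1))
  \<comment> \<open>Only the second variable is differentiated: X x acts on K with its first
    argument frozen at \<psi> x.\<close>
  let ?D = "\<lambda>b z. frechet_derivative F (at z) (0, b)"
  have X_eq: "X x (\<lambda>y. K (\<psi> x, y)) = (\<Sum>b\<in>Basis. X x (y b) * ?D b (\<mu> (\<psi> x), \<eta> (\<phi> x)))"
    if x: "x \<in> ?T" for x
  proof -
    let ?a = "\<mu> (\<psi> x)" and ?z = "\<eta> (\<phi> x)"
    have v: "X x \<in> tangent_space N (\<phi> x)" using X x by (auto simp: sections_along_def)
    have Ka: "(\<lambda>y. K (\<psi> x, y)) \<in> smooth_functions N"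
      using smooth_functions_slice[OF M N K] smooth_map_points[OF \<psi>] x by auto
    have Fa: "Cinf_on B (\<lambda>z. F (?a, z))"
      by (rule Cinf_on_compose[OF Cinf_on_Pair[OF Cinf_on_const Cinf_on_bounded_linear] W(1)])
        (use AB x in auto)
    have d: "frechet_derivative (\<lambda>z. F (?a, z)) (at ?z) b = ?D b (?a, ?z)" for b
    proof -
      have "(?a, ?z) \<in> W" using AB x by auto
      from Cinf_on_has_derivative[OF W(1) this]
      have "(F has_derivative frechet_derivative F (at (?a, ?z))) (at (?a, ?z))" .
      moreover have "((\<lambda>z. (?a, z)) has_derivative (\<lambda>h. (0, h))) (at ?z)"
        by (auto intro!: derivative_eq_intros)
      ultimately have "((\<lambda>z. F (?a, z)) has_derivative (\<lambda>h. frechet_derivative F (at (?a, ?z)) (0, h))) (at ?z)"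
        by (rule has_derivative_compose[rotated])
      then show ?thesis using frechet_derivative_at by metis
    qed
    have "X x (\<lambda>y. K (\<psi> x, y)) = (\<Sum>b\<in>Basis. X x (y b) * frechet_derivative (\<lambda>z. F (?a, z)) (at ?z) b)"
      by (rule tangent_space_coordinates[OF N V(1) _ v S(1) _ S(3) y Fa _ Ka])
        (use x AB W(3) in auto)
    then show ?thesis unfolding d .
  qed
  have "smooth_on (\<kappa> ` (O' \<inter> ?T)) (\<lambda>x. X (inv_into O' \<kappa> x) (y b))" if "b \<in> Basis" for b
  proof (rule smooth_on_subset)
    have "(\<lambda>p. X p (y b)) \<in> smooth_functions P"
      using X y(1)[OF that] by (auto simp: sections_along_def)
    from smooth_functionsD[OF this c]
    show "smooth_on (\<kappa> ` O') (\<lambda>x. X (inv_into O' \<kappa> x) (y b))" .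
  qed auto
  moreover have "smooth_on (\<kappa> ` (O' \<inter> ?T))
      (\<lambda>x. ?D b (\<mu> (\<psi> (inv_into O' \<kappa> x)), \<eta> (\<phi> (inv_into O' \<kappa> x))))" for b
  proof -
    have "smooth_on (\<kappa> ` (O' \<inter> ?T)) (\<lambda>x. (\<mu> (\<psi> (inv_into O' \<kappa> x)), \<eta> (\<phi> (inv_into O' \<kappa> x))))"
      by (intro smooth_on_Pair smooth_on_subset[OF smooth_mapD[OF \<psi> c U(1)]]
          smooth_on_subset[OF smooth_mapD[OF \<phi> c V(1)]]) auto
    moreover have "smooth_on W (?D b)"
      by (rule Cinf_on_imp_smooth_on[OF Cinf_on_derivative[OF W(1)] subset_refl])
    moreover have "(\<lambda>x. (\<mu> (\<psi> (inv_into O' \<kappa> x)), \<eta> (\<phi> (inv_into O' \<kappa> x)))) ` \<kappa> ` (O' \<inter> ?T) \<subseteq> W"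
      using AB(5) by (auto simp: inj)
    ultimately show ?thesis by (rule smooth_on_compose)
  qed
  ultimately have "smooth_on (\<kappa> ` (O' \<inter> ?T)) (\<lambda>x. \<Sum>b\<in>Basis. X (inv_into O' \<kappa> x) (y b)
      * ?D b (\<mu> (\<psi> (inv_into O' \<kappa> x)), \<eta> (\<phi> (inv_into O' \<kappa> x))))"
    by (intro smooth_on_sum smooth_on_mult)
  then have "smooth_on (\<kappa> ` (O' \<inter> ?T)) (\<lambda>x. X (inv_into O' \<kappa> x) (\<lambda>y. K (\<psi> (inv_into O' \<kappa> x), y)))"
  proof (rule smooth_on_cong)
    fix x assume "x \<in> \<kappa> ` (O' \<inter> ?T)"
    then obtain q where q: "q \<in> O'" "q \<in> ?T" "x = \<kappa> q" by blast
    have i: "inv_into O' \<kappa> x = q" using inj[OF q(1)] q(3) by simp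
    show "(\<Sum>b\<in>Basis. X (inv_into O' \<kappa> x) (y b)
      * ?D b (\<mu> (\<psi> (inv_into O' \<kappa> x)), \<eta> (\<phi> (inv_into O' \<kappa> x))))
      = X (inv_into O' \<kappa> x) (\<lambda>y. K (\<psi> (inv_into O' \<kappa> x), y))"
      unfolding i by (rule X_eq[OF q(2), symmetric])
  qed
  then show "\<exists>T. openin (mtop P) T \<and> p \<in> T \<and>
      smooth_on (\<kappa> ` (O' \<inter> T)) (\<lambda>x. X (inv_into O' \<kappa> x) (\<lambda>y. K (\<psi> (inv_into O' \<kappa> x), y)))"
    using T pP U V AB S by (intro exI[of _ ?T]) auto
qed

section \<open>Inner products on subspaces\<close>

text \<open>Restricted to V because the operations on the Lie algebra, such as the definite
  description \<open>levi_civita_product\<close>, are under control only for arguments in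
  it.\<close>

definition bilin_on :: "'v::real_vector set \<Rightarrow> ('v \<Rightarrow> 'v \<Rightarrow> 'w::real_vector) \<Rightarrow> bool" where
  "bilin_on V b \<longleftrightarrow>
     (\<forall>u\<in>V. \<forall>u'\<in>V. \<forall>w\<in>V. b (u + u') w = b u w + b u' w \<and> b w (u + u') = b w u + b w u') \<and>
     (\<forall>c. \<forall>u\<in>V. \<forall>w\<in>V. b (c *\<^sub>R u) w = c *\<^sub>R b u w \<and> b u (c *\<^sub>R w) = c *\<^sub>R b u w)"

lemma bilin_onI:
  assumes "\<And>u u' w. u \<in> V \<Longrightarrow> u' \<in> V \<Longrightarrow> w \<in> V \<Longrightarrow> b (u + u') w = b u w + b u' w"
    and "\<And>u u' w. u \<in> V \<Longrightarrow> u' \<in> V \<Longrightarrow> w \<in> V \<Longrightarrow> b w (u + u') = b w u + b w u'"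
    and "\<And>c u w. u \<in> V \<Longrightarrow> w \<in> V \<Longrightarrow> b (c *\<^sub>R u) w = c *\<^sub>R b u w"
    and "\<And>c u w. u \<in> V \<Longrightarrow> w \<in> V \<Longrightarrow> b u (c *\<^sub>R w) = c *\<^sub>R b u w"
  shows "bilin_on V b"
  using assms unfolding bilin_on_def by blast

lemma bilin_onD:
  assumes "bilin_on V b" "u \<in> V" "w \<in> V"
  shows "u' \<in> V \<Longrightarrow> b (u + u') w = b u w + b u' w" "u' \<in> V \<Longrightarrow> b w (u + u') = b w u + b w u'"
    "b (c *\<^sub>R u) w = c *\<^sub>R b u w" "b u (c *\<^sub>R w) = c *\<^sub>R b u w"
  using assms unfolding bilin_on_def by blast+

lemma bilin_on_0:
  assumes "bilin_on V b" "u \<in> V"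
  shows "b 0 u = 0" "b u 0 = 0"
  using bilin_onD(3,4)[OF assms(1) assms(2) assms(2), of 0] by simp_all

lemma bilin_on_diff:
  assumes b: "bilin_on V b" and V: "subspace V" and u: "u \<in> V" "u' \<in> V" and w: "w \<in> V"
  shows "b (u - u') w = b u w - b u' w" "b w (u - u') = b w u - b w u'"
proof -
  have m: "-1 *\<^sub>R u' \<in> V" using V u(2) by (rule subspace_scale)
  show "b (u - u') w = b u w - b u' w"
    using bilin_onD(1)[OF b u(1) w m] bilin_onD(3)[OF b u(2) w, of "-1"] by simp
  show "b w (u - u') = b w u - b w u'"
    using bilin_onD(2)[OF b u(1) w m] bilin_onD(4)[OF b w u(2), of "-1"] by simp
qed

lemma bilin_on_sum:
  assumes b: "bilin_on V b" and V: "subspace V" and u: "\<And>i. i \<in> I \<Longrightarrow> u i \<in> V" and w: "w \<in> V"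
  shows "b (\<Sum>i\<in>I. c i *\<^sub>R u i) w = (\<Sum>i\<in>I. c i *\<^sub>R b (u i) w)"
    "b w (\<Sum>i\<in>I. c i *\<^sub>R u i) = (\<Sum>i\<in>I. c i *\<^sub>R b w (u i))"
proof -
  have "b (\<Sum>i\<in>I. c i *\<^sub>R u i) w = (\<Sum>i\<in>I. c i *\<^sub>R b (u i) w) \<and>
    b w (\<Sum>i\<in>I. c i *\<^sub>R u i) = (\<Sum>i\<in>I. c i *\<^sub>R b w (u i))"
    using u
  proof (induction I rule: infinite_finite_induct)
    case (insert i I)
    have "(\<Sum>i\<in>I. c i *\<^sub>R u i) \<in> V" "c i *\<^sub>R u i \<in> V"
      using insert.prems V by (auto intro!: subspace_sum subspace_scale)
    then show ?case
      using insert bilin_onD[OF b _ w] bilin_onD[OF b w] by simp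
  qed (auto simp: bilin_on_0[OF b w])
  then show "b (\<Sum>i\<in>I. c i *\<^sub>R u i) w = (\<Sum>i\<in>I. c i *\<^sub>R b (u i) w)"
    "b w (\<Sum>i\<in>I. c i *\<^sub>R u i) = (\<Sum>i\<in>I. c i *\<^sub>R b w (u i))" by blast+
qed

lemma bilin_on_sum2:
  assumes b: "bilin_on V b" and V: "subspace V"
    and u: "\<And>i. i \<in> I \<Longrightarrow> u i \<in> V" and w: "\<And>j. j \<in> J \<Longrightarrow> w j \<in> V"
  shows "b (\<Sum>i\<in>I. c i *\<^sub>R u i) (\<Sum>j\<in>J. d j *\<^sub>R w j) = (\<Sum>i\<in>I. \<Sum>j\<in>J. (c i * d j) *\<^sub>R b (u i) (w j))"
proof -
  have "(\<Sum>j\<in>J. d j *\<^sub>R w j) \<in> V" using w V by (auto intro!: subspace_sum subspace_scale)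
  from bilin_on_sum(1)[OF b V u this]
  have "b (\<Sum>i\<in>I. c i *\<^sub>R u i) (\<Sum>j\<in>J. d j *\<^sub>R w j) = (\<Sum>i\<in>I. c i *\<^sub>R b (u i) (\<Sum>j\<in>J. d j *\<^sub>R w j))" .
  also have "\<dots> = (\<Sum>i\<in>I. \<Sum>j\<in>J. (c i * d j) *\<^sub>R b (u i) (w j))"
  proof (rule sum.cong[OF refl])
    fix i assume "i \<in> I"
    from bilin_on_sum(2)[OF b V w u[OF this]]
    have "b (u i) (\<Sum>j\<in>J. d j *\<^sub>R w j) = (\<Sum>j\<in>J. d j *\<^sub>R b (u i) (w j))" .
    then show "c i *\<^sub>R b (u i) (\<Sum>j\<in>J. d j *\<^sub>R w j) = (\<Sum>j\<in>J. (c i * d j) *\<^sub>R b (u i) (w j))"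
      by (simp add: scaleR_sum_right)
  qed
  finally show ?thesis .
qed

definition inner_on :: "'v::real_vector set \<Rightarrow> ('v \<Rightarrow> 'v \<Rightarrow> real) \<Rightarrow> bool" where
  "inner_on V ip \<longleftrightarrow> subspace V \<and> bilin_on V ip \<and> (\<forall>u\<in>V. \<forall>w\<in>V. ip u w = ip w u) \<and>
     (\<forall>u\<in>V. u \<noteq> 0 \<longrightarrow> ip u u > 0)"

lemma inner_onD:
  assumes "inner_on V ip"
  shows "subspace V" "bilin_on V ip" "u \<in> V \<Longrightarrow> w \<in> V \<Longrightarrow> ip u w = ip w u"
    "u \<in> V \<Longrightarrow> ip u u = 0 \<Longrightarrow> u = 0" "u \<in> V \<Longrightarrow> u \<noteq> 0 \<Longrightarrow> ip u u > 0"
  using assms unfolding inner_on_def by (blast, blast, blast, metis less_irrefl, blast)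

lemma inner_on_eqI:
  assumes "inner_on V ip" "u \<in> V" "u' \<in> V" "\<And>w. w \<in> V \<Longrightarrow> ip u w = ip u' w"
  shows "u = u'"
proof -
  note i = inner_onD[OF assms(1)]
  have d: "u - u' \<in> V" using i(1) assms(2,3) by (rule subspace_diff)
  have "ip (u - u') (u - u') = 0"
    using bilin_on_diff(1)[OF i(2,1) assms(2,3) d] assms(4)[OF d] by simp
  then show ?thesis using i(4)[OF d] by simp
qed

section \<open>Orthonormal bases and traces\<close>

lemma orthonormal_basisD:
  assumes "orthonormal_basis V ip n e"
  shows "i < n \<Longrightarrow> e i \<in> V" "i < n \<Longrightarrow> j < n \<Longrightarrow> ip (e i) (e j) = (if i = j then 1 else 0)"
    "V = span (e ` {..<n})"
  using assms unfolding orthonormal_basis_def by auto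

text \<open>The difference of the two sides is orthogonal to every basis vector, hence to their span
  V, hence to itself.\<close>

lemma orthonormal_expansion:
  assumes ip: "inner_on V ip" and e: "orthonormal_basis V ip n e" and u: "u \<in> V"
  shows "u = (\<Sum>i<n. ip u (e i) *\<^sub>R e i)"
proof -
  note i = inner_onD[OF ip] and eD = orthonormal_basisD[OF e]
  let ?d = "u - (\<Sum>i<n. ip u (e i) *\<^sub>R e i)"
  have s: "(\<Sum>i<n. ip u (e i) *\<^sub>R e i) \<in> V" using eD(1) i(1) by (auto intro!: subspace_sum subspace_scale)
  have d: "?d \<in> V" using i(1) u s by (rule subspace_diff)
  have "ip ?d (e j) = 0" if j: "j < n" for j
  proof -
    have "ip (\<Sum>i<n. ip u (e i) *\<^sub>R e i) (e j) = (\<Sum>i<n. ip u (e i) *\<^sub>R ip (e i) (e j))"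
      by (rule bilin_on_sum(1)[OF i(2,1)]) (use eD(1) j in auto)
    also have "\<dots> = (\<Sum>i<n. if i = j then ip u (e j) else 0)"
      by (rule sum.cong) (use eD(2) j in auto)
    finally show ?thesis using bilin_on_diff(1)[OF i(2,1) u s eD(1)[OF j]] j by simp
  qed
  moreover have "subspace {w\<in>V. ip ?d w = 0}"
    using i(1) d by (auto simp: subspace_def bilin_on_0[OF i(2)] bilin_onD[OF i(2)])
  ultimately have "span (e ` {..<n}) \<subseteq> {w\<in>V. ip ?d w = 0}"
    using eD(1) by (intro span_minimal) auto
  then have "ip ?d ?d = 0" using d eD(3) by auto
  then show ?thesis using i(4)[OF d] by simp
qed

lemma orthonormal_basis_dim:
  assumes ip: "inner_on V ip" and e: "orthonormal_basis V ip n e"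
  shows "independent (e ` {..<n})" "inj_on e {..<n}" "dim V = n"
proof -
  note i = inner_onD[OF ip] and eD = orthonormal_basisD[OF e]
  show inj: "inj_on e {..<n}"
    using eD(2) by (intro inj_onI) (metis lessThan_iff zero_neq_one)
  show ind: "independent (e ` {..<n})"
  proof (rule independent_if_scalars_zero)
    fix f x assume s: "(\<Sum>x\<in>e ` {..<n}. f x *\<^sub>R x) = 0" and "x \<in> e ` {..<n}"
    then obtain j where j: "j < n" "x = e j" by auto
    have "0 = ip (\<Sum>i<n. f (e i) *\<^sub>R e i) (e j)"
      using s bilin_on_0[OF i(2) eD(1)[OF j(1)]] by (simp add: sum.reindex[OF inj])
    also have "\<dots> = (\<Sum>i<n. f (e i) *\<^sub>R ip (e i) (e j))"
      by (rule bilin_on_sum(1)[OF i(2,1)]) (use eD(1) j in auto)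
    also have "\<dots> = (\<Sum>i<n. if i = j then f (e j) else 0)"
      by (rule sum.cong) (use eD(2) j in auto)
    finally show "f x = 0" using j by simp
  qed simp
  show "dim V = n"
    unfolding eD(3) dim_span using dim_eq_card_independent[OF ind] by (simp add: card_image[OF inj])
qed

text \<open>Gram-Schmidt, one vector at a time. If the new vector already lies in the span of the
  earlier ones, its remainder d is zero and the old basis is kept, so S may be any finite
  set.\<close>

lemma orthonormal_basis_exists:
  assumes ip: "inner_on V ip" and "finite S" "S \<subseteq> V"
  shows "\<exists>n e. orthonormal_basis (span S) ip n e"
  using assms(2,3)
proof (induction S)
  case empty
  show ?case by (intro exI[of _ 0]) (simp add: orthonormal_basis_def)
next
  case (insert x S)
  note i = inner_onD[OF ip]
  obtain n e where e: "orthonormal_basis (span S) ip n e" using insert by auto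
  note eD = orthonormal_basisD[OF e]
  have SV: "span S \<subseteq> V" using insert i(1) by (simp add: span_minimal)
  have x: "x \<in> V" using insert by simp
  define p where "p = (\<Sum>i<n. ip x (e i) *\<^sub>R e i)"
  have pS: "p \<in> span S" unfolding p_def using eD(1) by (auto intro!: span_sum span_scale)
  have pV: "p \<in> V" using pS SV by auto
  define d where "d = x - p"
  have d: "d \<in> V" unfolding d_def using i(1) x pV by (rule subspace_diff)
  have sp: "span (insert x S) = span (insert d S)"
  proof
    have "x = d + p" by (simp add: d_def)
    then have "x \<in> span (insert d S)"
      using pS span_mono[of S "insert d S"] by (metis insertCI span_add span_base subsetD subset_insertI)
    then show "span (insert x S) \<subseteq> span (insert d S)"
      by (intro span_minimal) (auto intro: span_base)
    have "d \<in> span (insert x S)"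
      unfolding d_def using pS span_mono[of S "insert x S"] by (auto intro!: span_diff intro: span_base)
    then show "span (insert d S) \<subseteq> span (insert x S)"
      by (intro span_minimal) (auto intro: span_base)
  qed
  have de: "ip d (e j) = 0" if j: "j < n" for j
  proof -
    have ej: "e j \<in> V" using eD(1)[OF j] SV by auto
    have "ip p (e j) = (\<Sum>i<n. ip x (e i) *\<^sub>R ip (e i) (e j))"
      unfolding p_def by (rule bilin_on_sum(1)[OF i(2,1) _ ej]) (use eD(1) SV in auto)
    also have "\<dots> = (\<Sum>i<n. if i = j then ip x (e j) else 0)"
      by (rule sum.cong) (use eD(2) j in auto)
    finally show ?thesis unfolding d_def using bilin_on_diff(1)[OF i(2,1) x pV ej] j by simp
  qed
  show ?case
  proof (cases "d = 0")
    case True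
    then have "span (insert x S) = span S" using sp by (simp add: span_insert_0)
    then show ?thesis using e by auto
  next
    case False
    define c where "c = 1 / sqrt (ip d d)"
    have pos: "ip d d > 0" by (rule i(5)[OF d False])
    then have c: "c \<noteq> 0" "c * (c * ip d d) = 1" by (auto simp: c_def)
    define e' where "e' = e(n := c *\<^sub>R d)"
    have cd: "c *\<^sub>R d \<in> V" using i(1) d by (rule subspace_scale)
    have eV: "e j \<in> V" if "j < n" for j using eD(1)[OF that] SV by auto
    have "ip (c *\<^sub>R d) (c *\<^sub>R d) = 1"
      using c bilin_onD(3)[OF i(2) d cd] bilin_onD(4)[OF i(2) d d] by simp
    moreover have cde: "ip (c *\<^sub>R d) (e j) = 0" if "j < n" for j
      using de[OF that] bilin_onD(3)[OF i(2) d eV[OF that]] by simp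
    moreover have "ip (e j) (c *\<^sub>R d) = 0" if "j < n" for j
      using cde[OF that] i(3)[OF cd eV[OF that]] by simp
    ultimately have orth: "\<forall>j<Suc n. \<forall>k<Suc n. ip (e' j) (e' k) = (if j = k then 1 else 0)"
      using eD(2) by (auto simp: e'_def less_Suc_eq)
    have "e' ` {..<Suc n} = insert (c *\<^sub>R d) (e ` {..<n})"
      by (auto simp: e'_def lessThan_Suc image_iff)
    also have "span \<dots> = span (insert x S)"
    proof
      have "e ` {..<n} \<subseteq> span (insert d S)"
        using eD(1) span_mono[of S "insert d S"] by auto
      moreover have "c *\<^sub>R d \<in> span (insert d S)" by (intro span_scale span_base) simp
      ultimately show "span (insert (c *\<^sub>R d) (e ` {..<n})) \<subseteq> span (insert x S)"
        unfolding sp by (intro span_minimal) auto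
      have "(1 / c) *\<^sub>R (c *\<^sub>R d) \<in> span (insert (c *\<^sub>R d) (e ` {..<n}))"
        by (intro span_scale span_base) simp
      moreover have "(1 / c) *\<^sub>R (c *\<^sub>R d) = d" using c(1) by simp
      moreover have "S \<subseteq> span (insert (c *\<^sub>R d) (e ` {..<n}))"
        using span_superset[of S] span_mono[of "e ` {..<n}" "insert (c *\<^sub>R d) (e ` {..<n})"]
        unfolding eD(3) by auto
      ultimately show "span (insert x S) \<subseteq> span (insert (c *\<^sub>R d) (e ` {..<n}))"
        unfolding sp by (intro span_minimal) auto
    qed
    finally have spn: "span (insert x S) = span (e' ` {..<Suc n})" by simp
    then have "\<forall>j<Suc n. e' j \<in> span (insert x S)"
      by (auto intro: span_base)
    then have "orthonormal_basis (span (insert x S)) ip (Suc n) e'"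
      using orth spn unfolding orthonormal_basis_def by blast
    then show ?thesis by blast
  qed
qed

text \<open>The transition coefficients \<open>ip (a i) (e j)\<close> have orthonormal columns, so
  after expanding b in e and summing over i only the diagonal terms survive. This is what makes an
  arbitrary chosen frame as good as the given basis.\<close>

lemma orthonormal_trace_unique:
  assumes ip: "inner_on V ip" and a: "orthonormal_basis V ip m a" and e: "orthonormal_basis V ip n e"
    and b: "bilin_on V b"
  shows "(\<Sum>i<m. b (a i) (a i)) = (\<Sum>j<n. b (e j) (e j))"
proof -
  note i = inner_onD[OF ip] and aD = orthonormal_basisD[OF a] and eD = orthonormal_basisD[OF e]
  have orth: "(\<Sum>i<m. ip (a i) (e j) * ip (a i) (e k)) = (if j = k then 1 else 0)"
    if jk: "j < n" "k < n" for j k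
  proof -
    have "(if j = k then 1 else 0) = ip (e j) (e k)" using eD(2) jk by simp
    also have "\<dots> = ip (\<Sum>i<m. ip (e j) (a i) *\<^sub>R a i) (e k)"
      using orthonormal_expansion[OF ip a eD(1)[OF jk(1)]] by simp
    also have "\<dots> = (\<Sum>i<m. ip (e j) (a i) *\<^sub>R ip (a i) (e k))"
      by (rule bilin_on_sum(1)[OF i(2,1)]) (use aD(1) eD(1) jk in auto)
    also have "\<dots> = (\<Sum>i<m. ip (a i) (e j) * ip (a i) (e k))"
      by (rule sum.cong) (use i(3) aD(1) eD(1) jk in auto)
    finally show ?thesis by simp
  qed
  have "(\<Sum>i<m. b (a i) (a i)) = (\<Sum>i<m. \<Sum>j<n. \<Sum>k<n. (ip (a i) (e j) * ip (a i) (e k)) *\<^sub>R b (e j) (e k))"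
  proof (rule sum.cong[OF refl])
    fix l assume "l \<in> {..<m}"
    then have "a l = (\<Sum>j<n. ip (a l) (e j) *\<^sub>R e j)"
      using orthonormal_expansion[OF ip e aD(1)] by simp
    then have "b (a l) (a l) = b (\<Sum>j<n. ip (a l) (e j) *\<^sub>R e j) (\<Sum>j<n. ip (a l) (e j) *\<^sub>R e j)" by simp
    also have "\<dots> = (\<Sum>j<n. \<Sum>k<n. (ip (a l) (e j) * ip (a l) (e k)) *\<^sub>R b (e j) (e k))"
      by (rule bilin_on_sum2[OF b i(1)]) (use eD(1) in auto)
    finally show "b (a l) (a l) = (\<Sum>j<n. \<Sum>k<n. (ip (a l) (e j) * ip (a l) (e k)) *\<^sub>R b (e j) (e k))" .
  qed
  also have "\<dots> = (\<Sum>j<n. \<Sum>k<n. \<Sum>i<m. (ip (a i) (e j) * ip (a i) (e k)) *\<^sub>R b (e j) (e k))"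
    by (subst sum.swap) (intro sum.cong refl sum.swap)
  also have "\<dots> = (\<Sum>j<n. \<Sum>k<n. if j = k then b (e j) (e k) else 0)"
    by (intro sum.cong refl) (auto simp: scaleR_sum_left[symmetric] orth)
  also have "\<dots> = (\<Sum>j<n. b (e j) (e j))" by (intro sum.cong refl) simp
  finally show ?thesis .
qed

text \<open>The basis S behind \<open>trace_on\<close> is an unspecified choice. Expanding e i in S
  under L and exchanging the sums leaves, for each b in S, the S-coordinate of the orthonormal
  expansion of L b.\<close>

lemma trace_on_orthonormal:
  assumes ip: "inner_on V ip" and e: "orthonormal_basis V ip n e"
    and L: "\<And>u. u \<in> V \<Longrightarrow> L u \<in> V" "\<And>u w. u \<in> V \<Longrightarrow> w \<in> V \<Longrightarrow> L (u + w) = L u + L w"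
      "\<And>c u. u \<in> V \<Longrightarrow> L (c *\<^sub>R u) = c *\<^sub>R L u"
  shows "trace_on V L = (\<Sum>i<n. ip (L (e i)) (e i))"
proof -
  note i = inner_onD[OF ip] and eD = orthonormal_basisD[OF e]
  define S where "S = (SOME S. independent S \<and> span S = V)"
  have "\<exists>S. independent S \<and> span S = V"
    using orthonormal_basis_dim(1)[OF ip e] eD(3) by blast
  then have S: "independent S" "span S = V" unfolding S_def by (metis (mono_tags, lifting) someI_ex)+
  have SV: "S \<subseteq> V" using S(2) span_superset by blast
  have fin: "finite S"
    using independent_span_bound[of "e ` {..<n}" S] S SV eD(3) by auto
  let ?r = "representation S"
  have L0: "L 0 = 0" using L(3)[of 0 0] i(1) by (simp add: subspace_0)
  have Lsum: "L (\<Sum>i\<in>I. c i *\<^sub>R u i) = (\<Sum>i\<in>I. c i *\<^sub>R L (u i))" if "\<And>i. i \<in> I \<Longrightarrow> u i \<in> V"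
    for I and c :: "'a \<Rightarrow> real" and u
    using that
  proof (induction I rule: infinite_finite_induct)
    case (insert j I)
    have "(\<Sum>i\<in>I. c i *\<^sub>R u i) \<in> V" "c j *\<^sub>R u j \<in> V"
      using insert.prems i(1) by (auto intro!: subspace_sum subspace_scale)
    then show ?case using insert L by simp
  qed (auto simp: L0)
  have rep: "u = (\<Sum>b\<in>S. ?r u b *\<^sub>R b)" if "u \<in> V" for u
    using sum_representation_eq[OF S(1) _ fin, of u] S(2) that by simp
  \<comment> \<open>The coordinate c of the orthonormal expansion of u.\<close>
  have rip: "(\<Sum>i<n. ip u (e i) * ?r (e i) c) = ?r u c" if u: "u \<in> V" for u c
  proof -
    have "?r u c = ?r (\<Sum>i<n. ip u (e i) *\<^sub>R e i) c"
      using orthonormal_expansion[OF ip e u] by simp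
    also have "\<dots> = (\<Sum>i<n. ?r (ip u (e i) *\<^sub>R e i) c)"
      by (subst representation_sum[OF S(1)]) (use eD(1) S(2) span_scale in auto)
    also have "\<dots> = (\<Sum>i<n. ip u (e i) * ?r (e i) c)"
      by (rule sum.cong) (use representation_scale[OF S(1)] eD(1) S(2) in auto)
    finally show ?thesis by simp
  qed
  have "(\<Sum>i<n. ip (L (e i)) (e i)) = (\<Sum>i<n. \<Sum>b\<in>S. ?r (e i) b * ip (L b) (e i))"
  proof (rule sum.cong[OF refl])
    fix j assume "j \<in> {..<n}"
    then have j: "e j \<in> V" using eD(1) by simp
    have "L (e j) = L (\<Sum>b\<in>S. ?r (e j) b *\<^sub>R b)" using rep[OF j] by simp
    also have "\<dots> = (\<Sum>b\<in>S. ?r (e j) b *\<^sub>R L b)" using SV by (intro Lsum) auto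
    finally have "ip (L (e j)) (e j) = ip (\<Sum>b\<in>S. ?r (e j) b *\<^sub>R L b) (e j)" by simp
    also have "\<dots> = (\<Sum>b\<in>S. ?r (e j) b *\<^sub>R ip (L b) (e j))"
      using SV L(1) by (intro bilin_on_sum(1)[OF i(2,1) _ j]) auto
    finally show "ip (L (e j)) (e j) = (\<Sum>b\<in>S. ?r (e j) b * ip (L b) (e j))" by simp
  qed
  also have "\<dots> = (\<Sum>b\<in>S. \<Sum>i<n. ip (L b) (e i) * ?r (e i) b)"
    by (subst sum.swap) (simp add: mult.commute)
  also have "\<dots> = (\<Sum>b\<in>S. ?r (L b) b)"
    using SV L(1) by (intro sum.cong refl rip) auto
  finally show ?thesis unfolding trace_on_def S_def[symmetric] Let_def by simp
qed

section \<open>Sections and connections\<close>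

lemma sections_alongD:
  assumes "V \<in> sections_along M N \<phi>"
  shows "p \<in> points M \<Longrightarrow> V p \<in> tangent_space N (\<phi> p)"
    "f \<in> smooth_functions N \<Longrightarrow> (\<lambda>p. V p f) \<in> smooth_functions M"
  using assms unfolding sections_along_def by auto

lemma sections_alongI:
  assumes "\<And>p. p \<in> points M \<Longrightarrow> V p \<in> tangent_space N (\<phi> p)"
    and "\<And>f. f \<in> smooth_functions N \<Longrightarrow> (\<lambda>p. V p f) \<in> smooth_functions M"
  shows "V \<in> sections_along M N \<phi>"
  using assms unfolding sections_along_def by auto

lemma sections_along_all:
  assumes M: "open_charts M" and V: "V \<in> sections_along M N \<phi>"
  shows "(\<lambda>p. V p f) \<in> smooth_functions M"
proof (cases "f \<in> smooth_functions N")
  case False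
  then have "V p f = 0" if "p \<in> points M" for p
    using tangent_space_nonsmooth[OF sections_alongD(1)[OF V that]] by simp
  then show ?thesis by (intro smooth_functions_cong[OF M smooth_functions_const[of 0]]) simp
qed (rule sections_alongD(2)[OF V])

lemma sections_along_cong:
  assumes M: "open_charts M" and V: "V \<in> sections_along M N \<phi>"
    and eq: "\<And>p. p \<in> points M \<Longrightarrow> V p = V' p"
  shows "V' \<in> sections_along M N \<phi>"
proof (rule sections_alongI)
  show "V' p \<in> tangent_space N (\<phi> p)" if "p \<in> points M" for p
    using sections_alongD(1)[OF V that] eq[OF that] by simp
  show "(\<lambda>p. V' p f) \<in> smooth_functions M" if "f \<in> smooth_functions N" for f
    by (rule smooth_functions_cong[OF M sections_alongD(2)[OF V that]]) (simp add: eq)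
qed

lemma sections_along_add:
  assumes "V \<in> sections_along M N \<phi>" "V' \<in> sections_along M N \<phi>"
  shows "(\<lambda>q. V q + V' q) \<in> sections_along M N \<phi>"
  using sections_alongD[OF assms(1)] sections_alongD[OF assms(2)]
  by (auto intro!: sections_alongI subspace_add[OF subspace_tangent_space] smooth_functions_add)

lemma sections_along_scale:
  assumes "V \<in> sections_along M N \<phi>" "f \<in> smooth_functions M"
  shows "(\<lambda>q. f q *\<^sub>R V q) \<in> sections_along M N \<phi>"
proof (rule sections_alongI)
  show "f p *\<^sub>R V p \<in> tangent_space N (\<phi> p)" if "p \<in> points M" for p
    by (rule subspace_scale[OF subspace_tangent_space sections_alongD(1)[OF assms(1) that]])
  show "(\<lambda>p. (f p *\<^sub>R V p) k) \<in> smooth_functions M" if "k \<in> smooth_functions N" for k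
    using smooth_functions_mult[OF assms(2) sections_alongD(2)[OF assms(1) that]] by (simp add: scaleR_fun_def)
qed

lemma sections_along_zero: "(\<lambda>q. 0) \<in> sections_along M N \<phi>"
  by (auto intro!: sections_alongI subspace_0[OF subspace_tangent_space] smooth_functions_const)

lemma sections_along_sum:
  assumes "\<And>i. i \<in> I \<Longrightarrow> V i \<in> sections_along M N \<phi>"
  shows "(\<lambda>q. \<Sum>i\<in>I. V i q) \<in> sections_along M N \<phi>"
  using assms
  by (induction I rule: infinite_finite_induct) (auto intro: sections_along_zero sections_along_add)

lemma vector_fieldsD:
  assumes "X \<in> vector_fields M"
  shows "X \<in> sections_along M M (\<lambda>p. p)" "p \<in> points M \<Longrightarrow> X p \<in> tangent_space M p"
    "f \<in> smooth_functions M \<Longrightarrow> (\<lambda>p. X p f) \<in> smooth_functions M"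
  using assms sections_alongD[of X M M "\<lambda>p. p"] unfolding vector_fields_def by auto

lemma sections_along_apply:
  assumes "X \<in> vector_fields M" "V \<in> sections_along M N \<phi>" "open_charts M"
  shows "(\<lambda>p. X p (\<lambda>q. V q f)) \<in> smooth_functions M"
  using vector_fieldsD(3)[OF assms(1) sections_along_all[OF assms(3,2)]] .

lemma sum_apply: "(\<Sum>i\<in>I. v i) f = (\<Sum>i\<in>I. v i f)" for v :: "'i \<Rightarrow> 'c \<Rightarrow> 'd::real_vector"
  by (induction I rule: infinite_finite_induct) auto

lemma connectionD:
  assumes "is_connection M N \<phi> D" "p \<in> points M" "u \<in> tangent_space M p" "V \<in> sections_along M N \<phi>"
  shows "D p u V \<in> tangent_space N (\<phi> p)"
    "v \<in> tangent_space M p \<Longrightarrow> D p (u + v) V = D p u V + D p v V"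
    "D p (c *\<^sub>R u) V = c *\<^sub>R D p u V"
    "V' \<in> sections_along M N \<phi> \<Longrightarrow> D p u (\<lambda>q. V q + V' q) = D p u V + D p u V'"
    "f \<in> smooth_functions M \<Longrightarrow> D p u (\<lambda>q. f q *\<^sub>R V q) = u f *\<^sub>R V p + f p *\<^sub>R D p u V"
  using assms unfolding is_connection_def plus_fun_def by blast+

lemma connection_section:
  assumes "is_connection M N \<phi> D" "X \<in> vector_fields M" "V \<in> sections_along M N \<phi>"
  shows "(\<lambda>p. D p (X p) V) \<in> sections_along M N \<phi>"
  using assms unfolding is_connection_def by blast

text \<open>The difference Z of the two fields vanishes on the manifold, so it is unchanged by
  multiplication with the indicator function of the complement; both Leibniz terms of that product
  vanish at p.\<close>

lemma connection_cong:
  assumes M: "open_charts M" and D: "is_connection M N \<phi> D" and p: "p \<in> points M"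
    and u: "u \<in> tangent_space M p" and V: "V \<in> sections_along M N \<phi>"
    and eq: "\<And>q. q \<in> points M \<Longrightarrow> V q = V' q"
  shows "D p u V = D p u V'"
proof -
  let ?i = "\<lambda>q. if q \<in> points M then 0 else 1 :: real" and ?Z = "\<lambda>q. V' q - V q"
  have i: "?i \<in> smooth_functions M"
    by (rule smooth_functions_cong[OF M smooth_functions_const[of 0]]) simp
  have Z: "?Z \<in> sections_along M N \<phi>"
    by (rule sections_along_cong[OF M sections_along_zero]) (simp add: eq)
  have "(\<lambda>q. V q + ?i q *\<^sub>R ?Z q) = V'" using eq by auto
  moreover have "D p u (\<lambda>q. V q + ?i q *\<^sub>R ?Z q) = D p u V + D p u (\<lambda>q. ?i q *\<^sub>R ?Z q)"
    by (rule connectionD(4)[OF D p u V sections_along_scale[OF Z i]])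
  moreover have "D p u (\<lambda>q. ?i q *\<^sub>R ?Z q) = u ?i *\<^sub>R ?Z p + ?i p *\<^sub>R D p u ?Z"
    by (rule connectionD(5)[OF D p u Z i])
  ultimately show ?thesis using p eq by simp
qed

lemma connection_sum:
  assumes D: "is_connection M N \<phi> D" and p: "p \<in> points M" and u: "u \<in> tangent_space M p"
    and E: "\<And>i. i \<in> I \<Longrightarrow> E i \<in> sections_along M N \<phi>" and c: "\<And>i. i \<in> I \<Longrightarrow> c i \<in> smooth_functions M"
  shows "D p u (\<lambda>q. \<Sum>i\<in>I. c i q *\<^sub>R E i q) = (\<Sum>i\<in>I. u (c i) *\<^sub>R E i p + c i p *\<^sub>R D p u (E i))"
  using E c
proof (induction I rule: infinite_finite_induct)
  case (insert i I)
  have "D p u (\<lambda>q. c i q *\<^sub>R E i q + (\<Sum>i\<in>I. c i q *\<^sub>R E i q))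
      = D p u (\<lambda>q. c i q *\<^sub>R E i q) + D p u (\<lambda>q. \<Sum>i\<in>I. c i q *\<^sub>R E i q)"
    using insert.prems by (intro connectionD(4)[OF D p u] sections_along_scale sections_along_sum) auto
  moreover have "D p u (\<lambda>q. c i q *\<^sub>R E i q) = u (c i) *\<^sub>R E i p + c i p *\<^sub>R D p u (E i)"
    using insert.prems by (intro connectionD(5)[OF D p u]) auto
  ultimately show ?case
    unfolding sum.insert[OF insert.hyps(1,2)] using insert.IH insert.prems by (simp only: insertI2)
qed (use connectionD(5)[OF D p u sections_along_zero smooth_functions_const[of 0]] in simp_all)

section \<open>Differentials of maps and brackets of vector fields\<close>

lemma differential_apply:
  "differential M N \<phi> p v f = (if f \<in> smooth_functions N then v (\<lambda>x. f (\<phi> x)) else 0)"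
  by (simp add: differential_def comp_def)

lemma differential_in:
  assumes \<phi>: "\<And>f. f \<in> smooth_functions N \<Longrightarrow> (\<lambda>x. f (\<phi> x)) \<in> smooth_functions M"
    and v: "v \<in> tangent_space M p"
  shows "differential M N \<phi> q v \<in> tangent_space N (\<phi> p)"
proof (rule tangent_spaceI)
  show "differential M N \<phi> q v (\<lambda>x. c * f x) = c * differential M N \<phi> q v f"
    if "f \<in> smooth_functions N" for c f
    using that smooth_functions_mult[OF smooth_functions_const that, of c] \<phi>
    by (simp add: differential_apply tangent_space_cmult[OF v])
qed (simp_all add: differential_apply smooth_functions_add smooth_functions_mult \<phi>
    tangent_space_add[OF v] tangent_space_mult[OF v])

lemma differential_linear:
  "differential M N \<phi> p (u + v) = differential M N \<phi> p u + differential M N \<phi> p v"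
  "differential M N \<phi> p (c *\<^sub>R u) = c *\<^sub>R differential M N \<phi> p u"
  "differential M N \<phi> p 0 = 0"
  "differential M N \<phi> p (u - v) = differential M N \<phi> p u - differential M N \<phi> p v"
  by (auto simp: fun_eq_iff differential_apply scaleR_fun_def)

lemma differential_sum:
  "differential M N \<phi> p (\<Sum>i\<in>I. v i) = (\<Sum>i\<in>I. differential M N \<phi> p (v i))"
  by (auto simp: fun_eq_iff differential_apply sum_apply)

text \<open>In the second order product rule \<open>mult\<close> the mixed products of first
  derivatives are symmetric in the two fields and cancel in the commutator; what remains is the
  Leibniz rule.\<close>

lemma vf_bracket_in:
  assumes M: "open_charts M" and X: "X \<in> vector_fields M" and Y: "Y \<in> vector_fields M" and p: "p \<in> points M"
  shows "vf_bracket X Y p \<in> tangent_space M p"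
proof -
  have add: "Z p (\<lambda>q. W q (\<lambda>q. f q + f' q)) = Z p (\<lambda>q. W q f) + Z p (\<lambda>q. W q f')"
    if Z: "Z \<in> vector_fields M" and W: "W \<in> vector_fields M" and f: "f \<in> smooth_functions M" "f' \<in> smooth_functions M"
    for Z W f f'
  proof -
    have "Z p (\<lambda>q. W q (\<lambda>q. f q + f' q)) = Z p (\<lambda>q. W q f + W q f')"
      by (rule tangent_space_cong[OF M p vector_fieldsD(2)[OF Z p]])
        (rule tangent_space_add[OF vector_fieldsD(2)[OF W] f])
    then show ?thesis
      using tangent_space_add[OF vector_fieldsD(2)[OF Z p] vector_fieldsD(3)[OF W f(1)] vector_fieldsD(3)[OF W f(2)]]
      by simp
  qed
  have cmult: "Z p (\<lambda>q. W q (\<lambda>q. c * f q)) = c * Z p (\<lambda>q. W q f)"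
    if Z: "Z \<in> vector_fields M" and W: "W \<in> vector_fields M" and f: "f \<in> smooth_functions M"
    for Z W f c
  proof -
    have "Z p (\<lambda>q. W q (\<lambda>q. c * f q)) = Z p (\<lambda>q. c * W q f)"
      by (rule tangent_space_cong[OF M p vector_fieldsD(2)[OF Z p]])
        (rule tangent_space_cmult[OF vector_fieldsD(2)[OF W] f])
    then show ?thesis
      using tangent_space_cmult[OF vector_fieldsD(2)[OF Z p] vector_fieldsD(3)[OF W f]] by simp
  qed
  have mult: "Z p (\<lambda>q. W q (\<lambda>q. f q * f' q)) = Z p (\<lambda>q. W q f) * f' p + W p f * Z p f'
      + (Z p f * W p f' + f p * Z p (\<lambda>q. W q f'))"
    if Z: "Z \<in> vector_fields M" and W: "W \<in> vector_fields M" and f: "f \<in> smooth_functions M" "f' \<in> smooth_functions M"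
    for Z W f f'
  proof -
    note Zp = vector_fieldsD(2)[OF Z p] and Wf = vector_fieldsD(3)[OF W f(1)] vector_fieldsD(3)[OF W f(2)]
    have "Z p (\<lambda>q. W q (\<lambda>q. f q * f' q)) = Z p (\<lambda>q. W q f * f' q + f q * W q f')"
      by (rule tangent_space_cong[OF M p Zp])
        (rule tangent_space_mult[OF vector_fieldsD(2)[OF W] f])
    also have "\<dots> = Z p (\<lambda>q. W q f * f' q) + Z p (\<lambda>q. f q * W q f')"
      by (rule tangent_space_add[OF Zp smooth_functions_mult[OF Wf(1) f(2)] smooth_functions_mult[OF f(1) Wf(2)]])
    finally show ?thesis
      unfolding tangent_space_mult[OF Zp Wf(1) f(2)] tangent_space_mult[OF Zp f(1) Wf(2)] .
  qed
  have zero: "Z p (\<lambda>q. W q f) = 0"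
    if Z: "Z \<in> vector_fields M" and W: "W \<in> vector_fields M" and f: "f \<notin> smooth_functions M" for Z W f
  proof -
    have "Z p (\<lambda>q. W q f) = Z p (\<lambda>_. 0)"
      by (rule tangent_space_cong[OF M p vector_fieldsD(2)[OF Z p]])
        (rule tangent_space_nonsmooth[OF vector_fieldsD(2)[OF W] f])
    then show ?thesis using tangent_space_const[OF vector_fieldsD(2)[OF Z p]] by simp
  qed
  show ?thesis
    by (rule tangent_spaceI)
      (simp_all add: vf_bracket_def add[OF X Y] add[OF Y X] cmult[OF X Y] cmult[OF Y X]
        mult[OF X Y] mult[OF Y X] zero[OF X Y] zero[OF Y X] algebra_simps)
qed

text \<open>Functions with values in a fixed tangent space are encoded as sections along a constant map.\<close>

definition vector_derivative_at :: "'p tangent_vector \<Rightarrow> ('p, 'q) field_along \<Rightarrow> 'q tangent_vector" where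
  "vector_derivative_at v s = (\<lambda>f. v (\<lambda>p. s p f))"

text \<open>All the vectors s p have the same base point c, so the factors f c and f' c in their
  Leibniz rules are constants that v does not differentiate.\<close>

lemma vector_derivative_at_in:
  assumes M: "open_charts M" and p: "p \<in> points M" and v: "v \<in> tangent_space M p"
    and s: "s \<in> sections_along M N (\<lambda>_. c)"
  shows "vector_derivative_at v s \<in> tangent_space N c"
proof (rule tangent_spaceI)
  note sD = sections_alongD[OF s]
  fix f f' assume f: "f \<in> smooth_functions N" "f' \<in> smooth_functions N"
  have "v (\<lambda>p. s p (\<lambda>q. f q + f' q)) = v (\<lambda>p. s p f + s p f')"
    by (rule tangent_space_cong[OF M p v]) (rule tangent_space_add[OF sD(1) f])
  then show "vector_derivative_at v s (\<lambda>q. f q + f' q) = vector_derivative_at v s f + vector_derivative_at v s f'"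
    unfolding vector_derivative_at_def tangent_space_add[OF v sD(2)[OF f(1)] sD(2)[OF f(2)]] .
  have "v (\<lambda>p. s p (\<lambda>q. f q * f' q)) = v (\<lambda>p. f' c * s p f + f c * s p f')"
    by (rule tangent_space_cong[OF M p v]) (simp add: tangent_space_mult[OF sD(1) f])
  also have "\<dots> = v (\<lambda>p. f' c * s p f) + v (\<lambda>p. f c * s p f')"
    by (intro tangent_space_add[OF v] smooth_functions_mult[OF smooth_functions_const] sD(2) f)
  finally show "vector_derivative_at v s (\<lambda>q. f q * f' q) = vector_derivative_at v s f * f' c + f c * vector_derivative_at v s f'"
    unfolding vector_derivative_at_def tangent_space_cmult[OF v sD(2)[OF f(1)]] tangent_space_cmult[OF v sD(2)[OF f(2)]]
    by simp
next
  note sD = sections_alongD[OF s]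
  fix k f assume f: "f \<in> smooth_functions N"
  have "v (\<lambda>p. s p (\<lambda>q. k * f q)) = v (\<lambda>p. k * s p f)"
    by (rule tangent_space_cong[OF M p v]) (rule tangent_space_cmult[OF sD(1) f])
  then show "vector_derivative_at v s (\<lambda>q. k * f q) = k * vector_derivative_at v s f"
    unfolding vector_derivative_at_def tangent_space_cmult[OF v sD(2)[OF f]] .
next
  note sD = sections_alongD[OF s]
  fix f assume f: "f \<notin> smooth_functions N"
  have "v (\<lambda>p. s p f) = v (\<lambda>_. 0)"
    by (rule tangent_space_cong[OF M p v]) (rule tangent_space_nonsmooth[OF sD(1) f])
  then show "vector_derivative_at v s f = 0"
    unfolding vector_derivative_at_def tangent_space_const[OF v] .
qed

lemma vector_derivative_at_const:
  assumes "v \<in> tangent_space M p"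
  shows "vector_derivative_at v (\<lambda>_. u) = 0"
  unfolding vector_derivative_at_def by (rule ext) (simp add: tangent_space_const[OF assms])

lemma vector_derivative_at_add:
  assumes M: "open_charts M" and v: "v \<in> tangent_space M p"
    and s: "s \<in> sections_along M N (\<lambda>_. c)" "s' \<in> sections_along M N (\<lambda>_. c)"
  shows "vector_derivative_at v (\<lambda>q. s q + s' q) = vector_derivative_at v s + vector_derivative_at v s'"
  unfolding vector_derivative_at_def
  by (rule ext) (simp add: tangent_space_add[OF v sections_along_all[OF M s(1)] sections_along_all[OF M s(2)]])

lemma vector_derivative_at_scale:
  assumes M: "open_charts M" and v: "v \<in> tangent_space M p"
    and s: "s \<in> sections_along M N (\<lambda>_. c)" and f: "f \<in> smooth_functions M"
  shows "vector_derivative_at v (\<lambda>q. f q *\<^sub>R s q) = v f *\<^sub>R s p + f p *\<^sub>R vector_derivative_at v s"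
  unfolding vector_derivative_at_def
  by (rule ext) (simp add: scaleR_fun_def tangent_space_mult[OF v f sections_along_all[OF M s]])

lemma vector_derivative_at_linear:
  "vector_derivative_at (u + v) s = vector_derivative_at u s + vector_derivative_at v s"
  "vector_derivative_at (c *\<^sub>R u) s = c *\<^sub>R vector_derivative_at u s"
  by (auto simp: fun_eq_iff vector_derivative_at_def scaleR_fun_def)

section \<open>Lie groups\<close>

locale lie_grp =
  fixes G :: "'g monoid" and M :: "('g, 'a::euclidean_space) manifold"
  assumes lie: "lie_group G M"
begin

lemma mfd: "smooth_manifold M" and grp: "group G" and carrier: "carrier G = points M"
  using lie unfolding lie_group_def by blast+

sublocale group G by (rule grp)

lemmas oc = manifold_open_charts[OF mfd]

lemma closedG [simp]:
  "\<one>\<^bsub>G\<^esub> \<in> points M" "a \<in> points M \<Longrightarrow> inv\<^bsub>G\<^esub> a \<in> points M"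
  "a \<in> points M \<Longrightarrow> b \<in> points M \<Longrightarrow> a \<otimes>\<^bsub>G\<^esub> b \<in> points M"
  using one_closed inv_closed m_closed unfolding carrier by auto

lemma groupG [simp]:
  "a \<in> points M \<Longrightarrow> \<one>\<^bsub>G\<^esub> \<otimes>\<^bsub>G\<^esub> a = a" "a \<in> points M \<Longrightarrow> a \<otimes>\<^bsub>G\<^esub> \<one>\<^bsub>G\<^esub> = a"
  "a \<in> points M \<Longrightarrow> inv\<^bsub>G\<^esub> a \<otimes>\<^bsub>G\<^esub> a = \<one>\<^bsub>G\<^esub>" "a \<in> points M \<Longrightarrow> a \<otimes>\<^bsub>G\<^esub> inv\<^bsub>G\<^esub> a = \<one>\<^bsub>G\<^esub>"
  "a \<in> points M \<Longrightarrow> b \<in> points M \<Longrightarrow> c \<in> points M \<Longrightarrow> a \<otimes>\<^bsub>G\<^esub> b \<otimes>\<^bsub>G\<^esub> c = a \<otimes>\<^bsub>G\<^esub> (b \<otimes>\<^bsub>G\<^esub> c)"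
  using l_one r_one l_inv r_inv m_assoc unfolding carrier by auto

lemma smooth_mult:
  assumes "f \<in> smooth_functions M"
  shows "(\<lambda>(x, y). f (x \<otimes>\<^bsub>G\<^esub> y)) \<in> smooth_functions (prod_manifold M M)"
proof -
  have "smooth_map (prod_manifold M M) M (\<lambda>(x, y). x \<otimes>\<^bsub>G\<^esub> y)"
    using lie unfolding lie_group_def by blast
  from smooth_functions_pullback[OF prod_open_charts[OF oc oc] mfd this assms]
  show ?thesis by (simp add: split_beta')
qed

lemma smooth_inv: "smooth_map M M (\<lambda>x. inv\<^bsub>G\<^esub> x)"
  using lie unfolding lie_group_def by blast

lemma smooth_left: "f \<in> smooth_functions M \<Longrightarrow> a \<in> points M \<Longrightarrow> (\<lambda>x. f (a \<otimes>\<^bsub>G\<^esub> x)) \<in> smooth_functions M"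
  using smooth_functions_slice[OF mfd mfd smooth_mult] by simp

text \<open>\<^const>\<open>differential\<close> does not depend on the base point, so this serves at all points.\<close>

definition ltr :: "'g \<Rightarrow> 'g tangent_vector \<Rightarrow> 'g tangent_vector" where
  "ltr a = differential M M (\<lambda>x. a \<otimes>\<^bsub>G\<^esub> x) \<one>\<^bsub>G\<^esub>"

lemma differential_left: "differential M M (\<lambda>x. a \<otimes>\<^bsub>G\<^esub> x) p = ltr a"
  unfolding ltr_def differential_def ..

lemma left_invariant_field_eq: "left_invariant_field G M u a = ltr a u"
  unfolding ltr_def left_invariant_field_def ..

lemma ltr_apply: "ltr a v f = (if f \<in> smooth_functions M then v (\<lambda>x. f (a \<otimes>\<^bsub>G\<^esub> x)) else 0)"
  unfolding ltr_def by (rule differential_apply)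

lemmas ltr_linear = differential_linear[of M M "\<lambda>x. a \<otimes>\<^bsub>G\<^esub> x" "\<one>\<^bsub>G\<^esub>" for a, folded ltr_def]
  and ltr_sum = differential_sum[of M M "\<lambda>x. a \<otimes>\<^bsub>G\<^esub> x" "\<one>\<^bsub>G\<^esub>" for a, folded ltr_def]

abbreviation "T1 \<equiv> tangent_space M \<one>\<^bsub>G\<^esub>"

lemmas T1_sub = subspace_tangent_space[of M "\<one>\<^bsub>G\<^esub>"]

lemma ltr_in: "a \<in> points M \<Longrightarrow> v \<in> tangent_space M p \<Longrightarrow> ltr a v \<in> tangent_space M (a \<otimes>\<^bsub>G\<^esub> p)"
  unfolding ltr_def by (rule differential_in[OF smooth_left])

lemma ltr_ltr:
  assumes "a \<in> points M" "b \<in> points M" "p \<in> points M" "v \<in> tangent_space M p"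
  shows "ltr a (ltr b v) = ltr (a \<otimes>\<^bsub>G\<^esub> b) v"
proof
  fix f
  have "v (\<lambda>x. f (a \<otimes>\<^bsub>G\<^esub> (b \<otimes>\<^bsub>G\<^esub> x))) = v (\<lambda>x. f (a \<otimes>\<^bsub>G\<^esub> b \<otimes>\<^bsub>G\<^esub> x))"
    by (rule tangent_space_cong[OF oc assms(3,4)]) (simp add: assms)
  then show "ltr a (ltr b v) f = ltr (a \<otimes>\<^bsub>G\<^esub> b) v f"
    using smooth_left[OF _ assms(1)] by (simp add: ltr_apply)
qed

lemma ltr_one:
  assumes "p \<in> points M" "v \<in> tangent_space M p"
  shows "ltr \<one>\<^bsub>G\<^esub> v = v"
proof
  fix f
  have "v (\<lambda>x. f (\<one>\<^bsub>G\<^esub> \<otimes>\<^bsub>G\<^esub> x)) = v f"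
    by (rule tangent_space_cong[OF oc assms]) simp
  then show "ltr \<one>\<^bsub>G\<^esub> v f = v f"
    using tangent_space_nonsmooth[OF assms(2)] by (simp add: ltr_apply)
qed

lemma ltr_in_field: "a \<in> points M \<Longrightarrow> u \<in> T1 \<Longrightarrow> ltr a u \<in> tangent_space M a"
  using ltr_in[of a u "\<one>\<^bsub>G\<^esub>"] by simp

lemma ltr_inv_in: "a \<in> points M \<Longrightarrow> v \<in> tangent_space M a \<Longrightarrow> ltr (inv\<^bsub>G\<^esub> a) v \<in> T1"
  using ltr_in[of "inv\<^bsub>G\<^esub> a" v a] by simp

lemma ltr_inv_ltr: "a \<in> points M \<Longrightarrow> u \<in> T1 \<Longrightarrow> ltr (inv\<^bsub>G\<^esub> a) (ltr a u) = u"
  using ltr_ltr[of "inv\<^bsub>G\<^esub> a" a "\<one>\<^bsub>G\<^esub>" u] ltr_one[of "\<one>\<^bsub>G\<^esub>" u] by simp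

lemma ltr_ltr_inv: "a \<in> points M \<Longrightarrow> v \<in> tangent_space M a \<Longrightarrow> ltr a (ltr (inv\<^bsub>G\<^esub> a) v) = v"
  using ltr_ltr[of a "inv\<^bsub>G\<^esub> a" a v] ltr_one[of a v] by simp

text \<open>Smoothness is \<open>smooth_section_apply\<close> for the family (x, y) -> f (x y), with
  the first variable moving along the inverse of \<phi> p.\<close>

lemma trivialize_section:
  assumes P: "smooth_manifold P" and \<phi>: "smooth_map P M \<phi>" and V: "V \<in> sections_along P M \<phi>"
  shows "(\<lambda>p. ltr (inv\<^bsub>G\<^esub> (\<phi> p)) (V p)) \<in> sections_along P M (\<lambda>_. \<one>\<^bsub>G\<^esub>)"
proof (rule sections_alongI)
  show "ltr (inv\<^bsub>G\<^esub> (\<phi> p)) (V p) \<in> T1" if "p \<in> points P" for p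
    using ltr_inv_in smooth_map_points[OF \<phi> that] sections_alongD(1)[OF V that] by blast
  fix f assume f: "f \<in> smooth_functions M"
  have "(\<lambda>p. V p (\<lambda>y. (case (inv\<^bsub>G\<^esub> (\<phi> p), y) of (x, y) \<Rightarrow> f (x \<otimes>\<^bsub>G\<^esub> y)))) \<in> smooth_functions P"
    by (rule smooth_section_apply[OF P mfd mfd
          smooth_map_compose[OF manifold_open_charts[OF P] mfd \<phi> smooth_inv] \<phi> smooth_mult[OF f] V])
  then show "(\<lambda>p. ltr (inv\<^bsub>G\<^esub> (\<phi> p)) (V p) f) \<in> smooth_functions P"
    using f by (simp add: ltr_apply)
qed

lemma untrivialize_section:
  assumes P: "smooth_manifold P" and \<phi>: "smooth_map P M \<phi>" and s: "s \<in> sections_along P M (\<lambda>_. \<one>\<^bsub>G\<^esub>)"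
  shows "(\<lambda>p. ltr (\<phi> p) (s p)) \<in> sections_along P M \<phi>"
proof (rule sections_alongI)
  show "ltr (\<phi> p) (s p) \<in> tangent_space M (\<phi> p)" if "p \<in> points P" for p
    using ltr_in_field smooth_map_points[OF \<phi> that] sections_alongD(1)[OF s that] by blast
  fix f assume f: "f \<in> smooth_functions M"
  have "(\<lambda>p. s p (\<lambda>y. (case (\<phi> p, y) of (x, y) \<Rightarrow> f (x \<otimes>\<^bsub>G\<^esub> y)))) \<in> smooth_functions P"
    by (rule smooth_section_apply[OF P mfd mfd \<phi> smooth_map_const smooth_mult[OF f] s]) simp
  then show "(\<lambda>p. ltr (\<phi> p) (s p) f) \<in> smooth_functions P"
    using f by (simp add: ltr_apply)
qed

lemma const_section: "u \<in> T1 \<Longrightarrow> (\<lambda>_. u) \<in> sections_along P M (\<lambda>_. \<one>\<^bsub>G\<^esub>)"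
  by (auto intro!: sections_alongI smooth_functions_const)

lemma left_invariant_section:
  "smooth_manifold P \<Longrightarrow> smooth_map P M \<phi> \<Longrightarrow> u \<in> T1 \<Longrightarrow> (\<lambda>p. ltr (\<phi> p) u) \<in> sections_along P M \<phi>"
  by (rule untrivialize_section[OF _ _ const_section])

lemma left_invariant_vector_field: "u \<in> T1 \<Longrightarrow> (\<lambda>p. ltr p u) \<in> vector_fields M"
  unfolding vector_fields_def by (rule left_invariant_section[OF mfd smooth_map_id[OF mfd]])

lemma trivialize_vector_field:
  "X \<in> vector_fields M \<Longrightarrow> (\<lambda>p. ltr (inv\<^bsub>G\<^esub> p) (X p)) \<in> sections_along M M (\<lambda>_. \<one>\<^bsub>G\<^esub>)"
  unfolding vector_fields_def by (rule trivialize_section[OF mfd smooth_map_id[OF mfd]])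

text \<open>The left invariant field through u witnesses the choice.\<close>

lemma vf_extension:
  assumes "p \<in> points M" "u \<in> tangent_space M p"
  shows "vf_extension M p u \<in> vector_fields M" "vf_extension M p u p = u"
proof -
  have "\<exists>X. X \<in> vector_fields M \<and> X p = u"
    using left_invariant_vector_field[OF ltr_inv_in[OF assms]] ltr_ltr_inv[OF assms] by blast
  then have "vf_extension M p u \<in> vector_fields M \<and> vf_extension M p u p = u"
    unfolding vf_extension_def by (rule someI_ex)
  then show "vf_extension M p u \<in> vector_fields M" "vf_extension M p u p = u" by auto
qed

lemma lie_bracket_eq: "lie_bracket G M u v = vf_bracket (\<lambda>p. ltr p u) (\<lambda>p. ltr p v) \<one>\<^bsub>G\<^esub>"
proof -
  have "left_invariant_field G M u = (\<lambda>p. ltr p u)" for u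
    by (rule ext) (rule left_invariant_field_eq)
  then show ?thesis unfolding lie_bracket_def by simp
qed

lemma lie_bracket_in: "u \<in> T1 \<Longrightarrow> v \<in> T1 \<Longrightarrow> lie_bracket G M u v \<in> T1"
  unfolding lie_bracket_eq by (intro vf_bracket_in[OF oc] left_invariant_vector_field) simp_all

lemma lie_bracket_antisym: "lie_bracket G M u v = - lie_bracket G M v u"
  by (simp add: lie_bracket_eq vf_bracket_def fun_eq_iff)

lemma lie_bracket_bilin: "bilin_on T1 (lie_bracket G M)"
proof -
  have 1: "lie_bracket G M (u + u') w = lie_bracket G M u w + lie_bracket G M u' w"
    if "u \<in> T1" "u' \<in> T1" "w \<in> T1" for u u' w
  proof
    fix f
    let ?w = "ltr \<one>\<^bsub>G\<^esub> w"
    have w: "?w \<in> T1" using ltr_in_field[of "\<one>\<^bsub>G\<^esub>" w] that by simp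
    have "?w (\<lambda>q. ltr q u f + ltr q u' f) = ?w (\<lambda>q. ltr q u f) + ?w (\<lambda>q. ltr q u' f)"
      using sections_along_all[OF oc] left_invariant_vector_field that unfolding vector_fields_def
      by (intro tangent_space_add[OF w]) blast+
    then show "lie_bracket G M (u + u') w f = (lie_bracket G M u w + lie_bracket G M u' w) f"
      by (simp add: lie_bracket_eq vf_bracket_def ltr_linear)
  qed
  have 3: "lie_bracket G M (c *\<^sub>R u) w = c *\<^sub>R lie_bracket G M u w"
    if "u \<in> T1" "w \<in> T1" for u w c
  proof
    fix f
    let ?w = "ltr \<one>\<^bsub>G\<^esub> w"
    have w: "?w \<in> T1" using ltr_in_field[of "\<one>\<^bsub>G\<^esub>" w] that by simp
    have "?w (\<lambda>q. c * ltr q u f) = c * ?w (\<lambda>q. ltr q u f)"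
      using sections_along_all[OF oc] left_invariant_vector_field that unfolding vector_fields_def
      by (intro tangent_space_cmult[OF w]) blast+
    then show "lie_bracket G M (c *\<^sub>R u) w f = (c *\<^sub>R lie_bracket G M u w) f"
      by (simp add: lie_bracket_eq vf_bracket_def ltr_linear) (simp add: scaleR_fun_def right_diff_distrib)
  qed
  show ?thesis
  proof (rule bilin_onI)
    show "lie_bracket G M (u + u') w = lie_bracket G M u w + lie_bracket G M u' w"
      if "u \<in> T1" "u' \<in> T1" "w \<in> T1" for u u' w by (rule 1[OF that])
    show "lie_bracket G M (c *\<^sub>R u) w = c *\<^sub>R lie_bracket G M u w" if "u \<in> T1" "w \<in> T1" for c u w
      by (rule 3[OF that])
    show "lie_bracket G M w (u + u') = lie_bracket G M w u + lie_bracket G M w u'"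
      if "u \<in> T1" "u' \<in> T1" "w \<in> T1" for u u' w
      unfolding lie_bracket_antisym[of w] 1[OF that] by simp
    show "lie_bracket G M u (c *\<^sub>R w) = c *\<^sub>R lie_bracket G M u w" if "u \<in> T1" "w \<in> T1" for c u w
      unfolding lie_bracket_antisym[of u] 3[OF that(2,1)] by simp
  qed
qed

text \<open>Translating the derivative of f along an invariant field by a amounts to differentiating
  f composed with the left translation by a; used twice in the step \<open>*\<close>, this moves the
  translation out of both halves of the commutator.\<close>

lemma left_invariant_bracket:
  assumes a: "a \<in> points M" and u: "u \<in> T1" "v \<in> T1"
  shows "vf_bracket (\<lambda>p. ltr p u) (\<lambda>p. ltr p v) a = ltr a (lie_bracket G M u v)"
proof
  fix f
  have *: "ltr a u (\<lambda>q. ltr q v f) = ltr \<one>\<^bsub>G\<^esub> u (\<lambda>q. ltr q v (\<lambda>x. f (a \<otimes>\<^bsub>G\<^esub> x)))"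
    if f: "f \<in> smooth_functions M" and u: "u \<in> T1" "v \<in> T1" for u v
  proof -
    have "(\<lambda>q. ltr q v f) \<in> smooth_functions M"
      by (rule vector_fieldsD(3)[OF left_invariant_vector_field[OF u(2)] f])
    then have "ltr a u (\<lambda>q. ltr q v f) = u (\<lambda>q. ltr (a \<otimes>\<^bsub>G\<^esub> q) v f)" by (simp add: ltr_apply)
    also have "\<dots> = u (\<lambda>q. ltr q v (\<lambda>x. f (a \<otimes>\<^bsub>G\<^esub> x)))"
    proof (rule tangent_space_cong[OF oc _ u(1)])
      fix q assume q: "q \<in> points M"
      have "ltr (a \<otimes>\<^bsub>G\<^esub> q) v f = ltr a (ltr q v) f" using ltr_ltr[OF a q _ u(2)] by simp
      then show "ltr (a \<otimes>\<^bsub>G\<^esub> q) v f = ltr q v (\<lambda>x. f (a \<otimes>\<^bsub>G\<^esub> x))"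
        using f by (simp add: ltr_apply[of a])
    qed simp
    finally show ?thesis using ltr_one[OF _ u(1)] by simp
  qed
  show "vf_bracket (\<lambda>p. ltr p u) (\<lambda>p. ltr p v) a f = ltr a (lie_bracket G M u v) f"
  proof (cases "f \<in> smooth_functions M")
    case True
    then show ?thesis
      using *[OF True u] *[OF True u(2,1)] by (simp add: vf_bracket_def lie_bracket_eq ltr_apply[of a "_::_ \<Rightarrow> _" f])
  next
    case False
    have "vf_bracket (\<lambda>p. ltr p u) (\<lambda>p. ltr p v) a \<in> tangent_space M a"
      by (intro vf_bracket_in[OF oc] left_invariant_vector_field u a)
    then show ?thesis using False tangent_space_nonsmooth by (metis ltr_apply)
  qed
qed

end

text \<open>A basis \<open>e\<close> of the Lie algebra whose coordinates are read off by smooth functions \<open>x\<close>, so that the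
  coefficients of a smooth section are smooth.\<close>

locale lie_frame = lie_grp +
  fixes n :: nat and e :: "nat \<Rightarrow> 'a tangent_vector" and x :: "nat \<Rightarrow> 'a \<Rightarrow> real"
  assumes e_in: "i < n \<Longrightarrow> e i \<in> tangent_space M \<one>\<^bsub>G\<^esub>"
    and x_smooth: "i < n \<Longrightarrow> x i \<in> smooth_functions M"
    and expand: "u \<in> tangent_space M \<one>\<^bsub>G\<^esub> \<Longrightarrow> u = (\<Sum>i<n. u (x i) *\<^sub>R e i)"
begin

abbreviation Sec :: "('p, 'c::euclidean_space) manifold \<Rightarrow> ('p, 'a) field_along set" where
  "Sec P \<equiv> sections_along P M (\<lambda>_. \<one>\<^bsub>G\<^esub>)"

abbreviation "vd \<equiv> vector_derivative_at"

lemma bilin_expand: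
  assumes "bilin_on T1 b" "u \<in> T1" "w \<in> T1"
  shows "b u w = (\<Sum>i<n. \<Sum>j<n. (u (x i) * w (x j)) *\<^sub>R b (e i) (e j))"
proof -
  have "b u w = b (\<Sum>i<n. u (x i) *\<^sub>R e i) (\<Sum>j<n. w (x j) *\<^sub>R e j)"
    using expand[OF assms(2)] expand[OF assms(3)] by simp
  also have "\<dots> = (\<Sum>i<n. \<Sum>j<n. (u (x i) * w (x j)) *\<^sub>R b (e i) (e j))"
    by (rule bilin_on_sum2[OF assms(1) T1_sub]) (simp_all add: e_in)
  finally show ?thesis .
qed

lemma coeff_smooth: "s \<in> Sec P \<Longrightarrow> i < n \<Longrightarrow> (\<lambda>q. s q (x i)) \<in> smooth_functions P"
  by (rule sections_alongD(2)[OF _ x_smooth])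

text \<open>In the frame the form has constant coefficients \<open>b (e i) (e j)\<close>, and the
  coordinates of the sections are smooth functions, so both claims reduce to the product rule for
  these.\<close>

lemma bilin_section:
  fixes b :: "'a tangent_vector \<Rightarrow> 'a tangent_vector \<Rightarrow> real"
  assumes P: "open_charts P" and b: "bilin_on T1 b" and s: "s \<in> Sec P" and t: "t \<in> Sec P"
  shows "(\<lambda>q. b (s q) (t q)) \<in> smooth_functions P"
    and "p \<in> points P \<Longrightarrow> v \<in> tangent_space P p \<Longrightarrow>
      v (\<lambda>q. b (s q) (t q)) = b (vd v s) (t p) + b (s p) (vd v t)"
proof -
  let ?f = "\<lambda>i j q. (s q (x i) * t q (x j)) * b (e i) (e j)"
  have eq: "b (s q) (t q) = (\<Sum>i<n. \<Sum>j<n. ?f i j q)" if "q \<in> points P" for q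
    using bilin_expand[OF b sections_alongD(1)[OF s that] sections_alongD(1)[OF t that]] by simp
  have st: "(\<lambda>q. s q (x i) * t q (x j)) \<in> smooth_functions P" if "i < n" "j < n" for i j
    by (rule smooth_functions_mult[OF coeff_smooth[OF s that(1)] coeff_smooth[OF t that(2)]])
  have f: "?f i j \<in> smooth_functions P" if "i < n" "j < n" for i j
    by (rule smooth_functions_mult[OF st[OF that] smooth_functions_const])
  have f1: "(\<lambda>q. \<Sum>j<n. ?f i j q) \<in> smooth_functions P" if "i < n" for i
    by (rule smooth_functions_sum) (simp add: f that)
  have "(\<lambda>q. \<Sum>i<n. \<Sum>j<n. ?f i j q) \<in> smooth_functions P"
    by (rule smooth_functions_sum) (simp add: f1)
  then show "(\<lambda>q. b (s q) (t q)) \<in> smooth_functions P"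
    by (rule smooth_functions_cong[OF P]) (simp only: eq)
  assume p: "p \<in> points P" and v: "v \<in> tangent_space P p"
  note sp = sections_alongD(1)[OF s p] sections_alongD(1)[OF t p]
  have "v (\<lambda>q. b (s q) (t q)) = v (\<lambda>q. \<Sum>i<n. \<Sum>j<n. ?f i j q)"
    by (rule tangent_space_cong[OF P p v eq])
  also have "\<dots> = (\<Sum>i<n. v (\<lambda>q. \<Sum>j<n. ?f i j q))"
    by (rule tangent_space_sum[OF v f1]) simp
  also have "\<dots> = (\<Sum>i<n. \<Sum>j<n. v (?f i j))"
    by (rule sum.cong[OF refl], rule tangent_space_sum[OF v f]) simp_all
  also have "\<dots> = (\<Sum>i<n. \<Sum>j<n. (vd v s (x i) * t p (x j)) *\<^sub>R b (e i) (e j)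
      + (s p (x i) * vd v t (x j)) *\<^sub>R b (e i) (e j))"
  proof (intro sum.cong refl)
    fix i j assume "i \<in> {..<n}" "j \<in> {..<n}"
    then have ij: "i < n" "j < n" by auto
    show "v (?f i j) = (vd v s (x i) * t p (x j)) *\<^sub>R b (e i) (e j) + (s p (x i) * vd v t (x j)) *\<^sub>R b (e i) (e j)"
      using tangent_space_mult[OF v st[OF ij] smooth_functions_const[of "b (e i) (e j)"]]
        tangent_space_mult[OF v coeff_smooth[OF s ij(1)] coeff_smooth[OF t ij(2)]]
      by (simp add: tangent_space_const[OF v] vector_derivative_at_def distrib_right)
  qed
  also have "\<dots> = b (vd v s) (t p) + b (s p) (vd v t)"
    using bilin_expand[OF b vector_derivative_at_in[OF P p v s] sp(2)]
      bilin_expand[OF b sp(1) vector_derivative_at_in[OF P p v t]]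
    by (simp add: sum.distrib)
  finally show "v (\<lambda>q. b (s q) (t q)) = b (vd v s) (t p) + b (s p) (vd v t)" .
qed

text \<open>Tangent vectors are functionals: evaluating B at a function f gives a real bilinear
  form, and \<open>bilin_section\<close> applies for each f.\<close>

lemma bilin_section_vector:
  assumes P: "open_charts P" and B: "bilin_on T1 B" "\<And>u w. u \<in> T1 \<Longrightarrow> w \<in> T1 \<Longrightarrow> B u w \<in> T1"
    and s: "s \<in> Sec P" and t: "t \<in> Sec P"
  shows "(\<lambda>q. B (s q) (t q)) \<in> Sec P"
    and "p \<in> points P \<Longrightarrow> v \<in> tangent_space P p \<Longrightarrow>
      vd v (\<lambda>q. B (s q) (t q)) = B (vd v s) (t p) + B (s p) (vd v t)"
proof -
  have b: "bilin_on T1 (\<lambda>u w. B u w f)" for f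
    using bilin_onD[OF B(1)] by (auto intro!: bilin_onI simp: scaleR_fun_def)
  show "(\<lambda>q. B (s q) (t q)) \<in> Sec P"
    using B(2) sections_alongD(1)[OF s] sections_alongD(1)[OF t]
    by (intro sections_alongI bilin_section(1)[OF P b s t]) auto
  assume p: "p \<in> points P" and v: "v \<in> tangent_space P p"
  show "vd v (\<lambda>q. B (s q) (t q)) = B (vd v s) (t p) + B (s p) (vd v t)"
    by (rule ext) (simp add: vector_derivative_at_def[of v "\<lambda>q. B (s q) (t q)"] bilin_section(2)[OF P b s t p v])
qed

text \<open>A product rule in which q occurs twice: the first term differentiates the vector with
  the translation frozen at p, the second the translation with the vector frozen at t p.\<close>

lemma ltr_derivative:
  assumes p: "p \<in> points M" and v: "v \<in> tangent_space M p" and t: "t \<in> Sec M" and f: "f \<in> smooth_functions M"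
  shows "v (\<lambda>q. ltr q (t q) f) = ltr p (vd v t) f + v (\<lambda>q. ltr q (t p) f)"
proof -
  let ?h = "\<lambda>i q. ltr q (e i) f"
  have h: "?h i \<in> smooth_functions M" if "i < n" for i
    by (rule vector_fieldsD(3)[OF left_invariant_vector_field[OF e_in[OF that]] f])
  have ltr_expand: "ltr q u f = (\<Sum>i<n. u (x i) * ?h i q)" if "u \<in> T1" for u q
  proof -
    have "ltr q u f = ltr q (\<Sum>i<n. u (x i) *\<^sub>R e i) f" using expand[OF that] by simp
    then show ?thesis by (simp only: ltr_sum ltr_linear(2) sum_apply) (simp add: scaleR_fun_def)
  qed
  note tp = sections_alongD(1)[OF t p]
  have "v (\<lambda>q. ltr q (t q) f) = v (\<lambda>q. \<Sum>i<n. t q (x i) * ?h i q)"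
    by (rule tangent_space_cong[OF oc p v]) (rule ltr_expand[OF sections_alongD(1)[OF t]])
  also have "\<dots> = (\<Sum>i<n. v (\<lambda>q. t q (x i) * ?h i q))"
    by (rule tangent_space_sum[OF v smooth_functions_mult[OF coeff_smooth[OF t] h]]) simp_all
  also have "\<dots> = (\<Sum>i<n. vd v t (x i) * ?h i p + t p (x i) * v (?h i))"
    unfolding vector_derivative_at_def
    by (rule sum.cong[OF refl], rule tangent_space_mult[OF v coeff_smooth[OF t] h]) simp_all
  also have "\<dots> = (\<Sum>i<n. vd v t (x i) * ?h i p) + (\<Sum>i<n. t p (x i) * v (?h i))"
    by (rule sum.distrib)
  also have "(\<Sum>i<n. vd v t (x i) * ?h i p) = ltr p (vd v t) f"
    by (rule ltr_expand[OF vector_derivative_at_in[OF oc p v t], symmetric])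
  also have "(\<Sum>i<n. t p (x i) * v (?h i)) = v (\<lambda>q. \<Sum>i<n. t p (x i) * ?h i q)"
  proof -
    have "v (\<lambda>q. \<Sum>i<n. t p (x i) * ?h i q) = (\<Sum>i<n. v (\<lambda>q. t p (x i) * ?h i q))"
      by (rule tangent_space_sum[OF v smooth_functions_mult[OF smooth_functions_const h]]) simp
    then show ?thesis by (simp add: tangent_space_cmult[OF v h])
  qed
  also have "\<dots> = v (\<lambda>q. ltr q (t p) f)" by (simp only: ltr_expand[OF tp])
  finally show ?thesis .
qed

text \<open>Both halves of the commutator are split by \<open>ltr_derivative\<close>. The terms with
  frozen vectors form the commutator of the left invariant fields that agree with X and Y at
  p.\<close>

lemma bracket_trivialized:
  assumes X: "X \<in> vector_fields M" and Y: "Y \<in> vector_fields M" and p: "p \<in> points M"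
  defines "s \<equiv> \<lambda>q. ltr (inv\<^bsub>G\<^esub> q) (X q)" and "t \<equiv> \<lambda>q. ltr (inv\<^bsub>G\<^esub> q) (Y q)"
  shows "vf_bracket X Y p = ltr p (vd (X p) t - vd (Y p) s + lie_bracket G M (s p) (t p))"
proof
  fix f
  note XY = vector_fieldsD(2)[OF X] vector_fieldsD(2)[OF Y]
  have s: "s \<in> Sec M" "t \<in> Sec M" unfolding s_def t_def by (rule trivialize_vector_field[OF X], rule trivialize_vector_field[OF Y])
  note sp = sections_alongD(1)[OF s(1) p] sections_alongD(1)[OF s(2) p]
  have Xs: "X q = ltr q (s q)" "Y q = ltr q (t q)" if "q \<in> points M" for q
    using ltr_ltr_inv[OF that XY(1)[OF that]] ltr_ltr_inv[OF that XY(2)[OF that]] by (simp_all add: s_def t_def)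
  show "vf_bracket X Y p f = ltr p (vd (X p) t - vd (Y p) s + lie_bracket G M (s p) (t p)) f"
  proof (cases "f \<in> smooth_functions M")
    case True
    have "X p (\<lambda>q. Y q f) = X p (\<lambda>q. ltr q (t q) f)"
      by (rule tangent_space_cong[OF oc p XY(1)[OF p]]) (simp add: Xs)
    moreover have "Y p (\<lambda>q. X q f) = Y p (\<lambda>q. ltr q (s q) f)"
      by (rule tangent_space_cong[OF oc p XY(2)[OF p]]) (simp add: Xs)
    ultimately have "vf_bracket X Y p f = ltr p (vd (X p) t) f - ltr p (vd (Y p) s) f
        + (X p (\<lambda>q. ltr q (t p) f) - Y p (\<lambda>q. ltr q (s p) f))"
      unfolding vf_bracket_def
      using ltr_derivative[OF p XY(1)[OF p] s(2) True] ltr_derivative[OF p XY(2)[OF p] s(1) True] by simp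
    also have "X p (\<lambda>q. ltr q (t p) f) - Y p (\<lambda>q. ltr q (s p) f) = ltr p (lie_bracket G M (s p) (t p)) f"
      unfolding Xs[OF p] left_invariant_bracket[OF p sp, symmetric] vf_bracket_def ..
    finally show ?thesis by (simp add: ltr_linear)
  next
    case False
    then show ?thesis
      using tangent_space_nonsmooth[OF vf_bracket_in[OF oc X Y p]] by (simp add: ltr_apply[of p])
  qed
qed

subsection \<open>Connections in the left trivialization\<close>

text \<open>The Maurer-Cartan form of the group composed with the differential of \<open>\<phi>\<close>.\<close>

definition pullback_form :: "('p, 'c::euclidean_space) manifold \<Rightarrow> ('p \<Rightarrow> 'a) \<Rightarrow> 'p \<Rightarrow> 'p tangent_vector \<Rightarrow> 'a tangent_vector" where
  "pullback_form P \<phi> p v = ltr (inv\<^bsub>G\<^esub> (\<phi> p)) (differential P M \<phi> p v)"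

text \<open>The explicit witness for the choices in \<open>levi_civita\<close> (with the identity
  map) and in \<open>pullback_connection\<close>, in both cases with the Levi-Civita product for
  B.\<close>

definition trivialized_connection ::
    "('p, 'c::euclidean_space) manifold \<Rightarrow> ('p \<Rightarrow> 'a) \<Rightarrow>
     ('a tangent_vector \<Rightarrow> 'a tangent_vector \<Rightarrow> 'a tangent_vector) \<Rightarrow> ('p, 'a) connection" where
  "trivialized_connection P \<phi> B p v V =
     ltr (\<phi> p) (vd v (\<lambda>q. ltr (inv\<^bsub>G\<^esub> (\<phi> q)) (V q)) + B (pullback_form P \<phi> p v) (ltr (inv\<^bsub>G\<^esub> (\<phi> p)) (V p)))"

lemma pullback_form_in:
  assumes P: "smooth_manifold P" and \<phi>: "smooth_map P M \<phi>" and p: "p \<in> points P" and v: "v \<in> tangent_space P p"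
  shows "pullback_form P \<phi> p v \<in> T1"
  unfolding pullback_form_def
  by (intro ltr_inv_in smooth_map_points[OF \<phi> p]
      differential_in[OF smooth_functions_pullback[OF manifold_open_charts[OF P] mfd \<phi>] v])

lemma pullback_form_linear:
  "pullback_form P \<phi> p (u + v) = pullback_form P \<phi> p u + pullback_form P \<phi> p v"
  "pullback_form P \<phi> p (c *\<^sub>R u) = c *\<^sub>R pullback_form P \<phi> p u"
  by (simp_all only: pullback_form_def differential_linear ltr_linear)

lemma differential_section:
  assumes P: "smooth_manifold P" and \<phi>: "smooth_map P M \<phi>" and X: "X \<in> vector_fields P"
  shows "(\<lambda>q. differential P M \<phi> q (X q)) \<in> sections_along P M \<phi>"
proof (rule sections_alongI)
  note pb = smooth_functions_pullback[OF manifold_open_charts[OF P] mfd \<phi>]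
  show "differential P M \<phi> q (X q) \<in> tangent_space M (\<phi> q)" if "q \<in> points P" for q
    by (rule differential_in[OF pb vector_fieldsD(2)[OF X that]])
  show "(\<lambda>q. differential P M \<phi> q (X q) f) \<in> smooth_functions P" if "f \<in> smooth_functions M" for f
    using that vector_fieldsD(3)[OF X pb[OF that]] by (simp add: differential_apply)
qed

lemma trivialized_is_connection:
  assumes P: "smooth_manifold P" and \<phi>: "smooth_map P M \<phi>"
    and B: "bilin_on T1 B" "\<And>u w. u \<in> T1 \<Longrightarrow> w \<in> T1 \<Longrightarrow> B u w \<in> T1"
  shows "is_connection P M \<phi> (trivialized_connection P \<phi> B)"
proof -
  note ocP = manifold_open_charts[OF P]
  let ?D = "trivialized_connection P \<phi> B"
  let ?w = "pullback_form P \<phi>"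
  let ?s = "\<lambda>V q. ltr (inv\<^bsub>G\<^esub> (\<phi> q)) (V q)"
  have 1: "?D p u V \<in> tangent_space M (\<phi> p)" "?D p (u + v) V = ?D p u V + ?D p v V"
    "?D p (c *\<^sub>R u) V = c *\<^sub>R ?D p u V"
    "V' \<in> sections_along P M \<phi> \<Longrightarrow> ?D p u (V + V') = ?D p u V + ?D p u V'"
    "f \<in> smooth_functions P \<Longrightarrow> ?D p u (\<lambda>q. f q *\<^sub>R V q) = u f *\<^sub>R V p + f p *\<^sub>R ?D p u V"
    if p: "p \<in> points P" and u: "u \<in> tangent_space P p" and v: "v \<in> tangent_space P p"
      and V: "V \<in> sections_along P M \<phi>" for p u v V c V' f
  proof -
    note s = trivialize_section[OF P \<phi> V] and w = pullback_form_in[OF P \<phi> p]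
    note sp = sections_alongD(1)[OF s p] and \<phi>p = smooth_map_points[OF \<phi> p]
    have Vp: "ltr (\<phi> p) (?s V p) = V p" by (rule ltr_ltr_inv[OF \<phi>p sections_alongD(1)[OF V p]])
    show "?D p u V \<in> tangent_space M (\<phi> p)"
      unfolding trivialized_connection_def
      by (intro ltr_in_field \<phi>p subspace_add[OF T1_sub] vector_derivative_at_in[OF ocP p u s] B(2) w[OF u] sp)
    show "?D p (u + v) V = ?D p u V + ?D p v V"
      unfolding trivialized_connection_def pullback_form_linear vector_derivative_at_linear
        bilin_onD(1)[OF B(1) w[OF u] sp w[OF v]] ltr_linear by simp
    show "?D p (c *\<^sub>R u) V = c *\<^sub>R ?D p u V"
      unfolding trivialized_connection_def pullback_form_linear vector_derivative_at_linear
        bilin_onD(3)[OF B(1) w[OF u] sp] ltr_linear by (simp only: scaleR_add_right)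
    show "?D p u (V + V') = ?D p u V + ?D p u V'" if V': "V' \<in> sections_along P M \<phi>"
    proof -
      note s' = trivialize_section[OF P \<phi> V']
      have eq: "(\<lambda>q. ltr (inv\<^bsub>G\<^esub> (\<phi> q)) ((V + V') q)) = (\<lambda>q. ?s V q + ?s V' q)"
        by (rule ext) (simp only: plus_fun_apply[of V V'] ltr_linear)
      show ?thesis
        unfolding trivialized_connection_def eq fun_cong[OF eq] vector_derivative_at_add[OF ocP u s s']
          bilin_onD(2)[OF B(1) sp w[OF u] sections_alongD(1)[OF s' p]] ltr_linear
        by (simp only: ac_simps)
    qed
    show "?D p u (\<lambda>q. f q *\<^sub>R V q) = u f *\<^sub>R V p + f p *\<^sub>R ?D p u V" if f: "f \<in> smooth_functions P"
      unfolding trivialized_connection_def ltr_linear vector_derivative_at_scale[OF ocP u s f]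
        bilin_onD(4)[OF B(1) w[OF u] sp] Vp
      by (simp only: scaleR_add_right add.assoc)
  qed
  have 2: "(\<lambda>p. ?D p (X p) V) \<in> sections_along P M \<phi>"
    if X: "X \<in> vector_fields P" and V: "V \<in> sections_along P M \<phi>" for X V
    unfolding trivialized_connection_def
  proof (rule untrivialize_section[OF P \<phi> sections_along_add])
    note s = trivialize_section[OF P \<phi> V]
    show "(\<lambda>p. vd (X p) (?s V)) \<in> Sec P"
      by (rule sections_alongI)
        (auto simp: vector_derivative_at_def[of _ "?s V", THEN fun_cong]
          intro!: vector_derivative_at_in[OF ocP _ _ s] vector_fieldsD(2)[OF X] sections_along_apply[OF X s ocP])
    have "(\<lambda>p. ?w p (X p)) \<in> Sec P"
      unfolding pullback_form_def by (rule trivialize_section[OF P \<phi> differential_section[OF P \<phi> X]])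
    from bilin_section_vector(1)[OF ocP B this s]
    show "(\<lambda>p. B (?w p (X p)) (?s V p)) \<in> Sec P" .
  qed
  show ?thesis
    unfolding is_connection_def by (intro conjI ballI allI 1 2)
qed

text \<open>A connection is determined by its values on the left invariant frame.\<close>

lemma connection_trivialized:
  assumes P: "smooth_manifold P" and \<phi>: "smooth_map P M \<phi>" and D: "is_connection P M \<phi> D"
    and B: "bilin_on T1 B"
    and p: "p \<in> points P" and v: "v \<in> tangent_space P p"
    and DB: "\<And>u. u \<in> T1 \<Longrightarrow> D p v (\<lambda>q. ltr (\<phi> q) u) = ltr (\<phi> p) (B (pullback_form P \<phi> p v) u)"
    and V: "V \<in> sections_along P M \<phi>"
    and s: "s \<in> Sec P" "\<And>q. q \<in> points P \<Longrightarrow> V q = ltr (\<phi> q) (s q)"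
  shows "D p v V = ltr (\<phi> p) (vd v s + B (pullback_form P \<phi> p v) (s p))"
proof -
  note ocP = manifold_open_charts[OF P] and w = pullback_form_in[OF P \<phi> p v]
  note sD = sections_alongD(1)[OF s(1)]
  have ltr_expand: "ltr a u = (\<Sum>i<n. u (x i) *\<^sub>R ltr a (e i))" if "u \<in> T1" for a u
  proof -
    have "ltr a u = ltr a (\<Sum>i<n. u (x i) *\<^sub>R e i)" using expand[OF that] by simp
    then show ?thesis by (simp only: ltr_sum ltr_linear(2))
  qed
  \<comment> \<open>The expansion in the frame holds only at points of the manifold, so V has to be
    replaced through \<open>connection_cong\<close>.\<close>
  have "D p v V = D p v (\<lambda>q. \<Sum>i<n. s q (x i) *\<^sub>R ltr (\<phi> q) (e i))"
    by (rule connection_cong[OF ocP D p v V]) (simp only: s(2) ltr_expand[OF sD])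
  also have "\<dots> = (\<Sum>i<n. v (\<lambda>q. s q (x i)) *\<^sub>R ltr (\<phi> p) (e i) + s p (x i) *\<^sub>R D p v (\<lambda>q. ltr (\<phi> q) (e i)))"
    by (rule connection_sum[OF D p v left_invariant_section[OF P \<phi> e_in] coeff_smooth[OF s(1)]]) simp_all
  also have "\<dots> = (\<Sum>i<n. vd v s (x i) *\<^sub>R ltr (\<phi> p) (e i))
      + (\<Sum>i<n. s p (x i) *\<^sub>R ltr (\<phi> p) (B (pullback_form P \<phi> p v) (e i)))"
    unfolding sum.distrib vector_derivative_at_def
    by (intro arg_cong2[of _ _ _ _ "(+)"] sum.cong refl) (simp only: DB e_in lessThan_iff)
  also have "(\<Sum>i<n. vd v s (x i) *\<^sub>R ltr (\<phi> p) (e i)) = ltr (\<phi> p) (vd v s)"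
    by (rule ltr_expand[OF vector_derivative_at_in[OF ocP p v s(1)], symmetric])
  also have "(\<Sum>i<n. s p (x i) *\<^sub>R ltr (\<phi> p) (B (pullback_form P \<phi> p v) (e i)))
      = ltr (\<phi> p) (B (pullback_form P \<phi> p v) (\<Sum>i<n. s p (x i) *\<^sub>R e i))"
    using bilin_on_sum(2)[OF B T1_sub e_in w, of "{..<n}" "\<lambda>i. i" "\<lambda>i. s p (x i)"]
    by (simp only: ltr_sum ltr_linear(2) lessThan_iff)
  also have "(\<Sum>i<n. s p (x i) *\<^sub>R e i) = s p" by (rule expand[OF sD[OF p], symmetric])
  finally show ?thesis by (simp only: ltr_linear)
qed

end

text \<open>As rewrite rules, these turn sums of tangent vectors into abstractions.\<close>

declare plus_fun_apply [simp del] zero_fun_apply [simp del] minus_apply [simp del] uminus_apply [simp del]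

section \<open>Lie groups with a left invariant metric\<close>

lemma riemannian_inner_on:
  assumes g: "riemannian_metric M g" and p: "p \<in> points M"
  shows "inner_on (tangent_space M p) (g p)"
proof -
  have sym: "g p u v = g p v u" and add: "g p u (v + w) = g p u v + g p u w" and sc: "g p u (c *\<^sub>R v) = c * g p u v"
    and pos: "u \<noteq> 0 \<Longrightarrow> g p u u > 0"
    if "u \<in> tangent_space M p" "v \<in> tangent_space M p" "w \<in> tangent_space M p" for u v w c
    using g p that unfolding riemannian_metric_def by blast+
  note S = subspace_add[OF subspace_tangent_space[of M p]] subspace_scale[OF subspace_tangent_space[of M p]]
  have "bilin_on (tangent_space M p) (g p)"
  proof (rule bilin_onI)
    show "g p (u + u') w = g p u w + g p u' w" "g p w (u + u') = g p w u + g p w u'"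
      if u: "u \<in> tangent_space M p" "u' \<in> tangent_space M p" "w \<in> tangent_space M p" for u u' w
      using add[OF u(3) u(1,2)] sym[OF S(1)[OF u(1,2)] u(3) u(3)] sym[OF u(1,3,3)] sym[OF u(2,3,3)] by simp_all
    show "g p (c *\<^sub>R u) w = c *\<^sub>R g p u w" "g p u (c *\<^sub>R w) = c *\<^sub>R g p u w"
      if u: "u \<in> tangent_space M p" "w \<in> tangent_space M p" for c u w
      using sc[OF u(2,1,1)] sc[OF u(1,2,2)] sym[OF S(2)[OF u(1)] u(2,2)] sym[OF u(1,2,2)] by simp_all
  qed
  moreover have "\<forall>u\<in>tangent_space M p. \<forall>w\<in>tangent_space M p. g p u w = g p w u"
    using sym by simp
  moreover have "\<forall>u\<in>tangent_space M p. u \<noteq> 0 \<longrightarrow> g p u u > 0"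
    using pos by simp
  ultimately show ?thesis
    unfolding inner_on_def using subspace_tangent_space by (intro conjI)
qed

context lie_grp
begin

text \<open>A linear injection of the Lie algebra into a Euclidean space. It bounds independent sets
  in \<open>T1_spanning\<close>, and it carries the basis to a place where dual functionals are
  available in \<open>lie_frame_exists\<close>.\<close>

lemma coordinates_linear:
  obtains y :: "'a \<Rightarrow> 'g \<Rightarrow> real" and \<iota> :: "'g tangent_vector \<Rightarrow> 'a" where "\<forall>b\<in>Basis. y b \<in> smooth_functions M"
    "\<iota> = (\<lambda>v. \<Sum>b\<in>Basis. v (y b) *\<^sub>R b)" "linear \<iota>" "inj_on \<iota> T1"
proof -
  obtain y :: "'a \<Rightarrow> 'g \<Rightarrow> real" where y: "\<And>b. b \<in> Basis \<Longrightarrow> y b \<in> smooth_functions M"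
    "\<And>v w. v \<in> T1 \<Longrightarrow> w \<in> T1 \<Longrightarrow> (\<And>b. b \<in> Basis \<Longrightarrow> v (y b) = w (y b)) \<Longrightarrow> v = w"
    using tangent_space_eqI_coordinates[OF mfd closedG(1)] by blast
  define \<iota> where "\<iota> = (\<lambda>v :: 'g tangent_vector. \<Sum>b\<in>Basis. v (y b) *\<^sub>R b)"
  have "linear \<iota>"
    by (rule linearI)
      (simp_all add: \<iota>_def plus_fun_apply scaleR_fun_def scaleR_add_left sum.distrib scaleR_sum_right)
  moreover have "inj_on \<iota> T1"
  proof (rule inj_onI)
    fix v w assume vw: "v \<in> T1" "w \<in> T1" "\<iota> v = \<iota> w"
    have "\<iota> u \<bullet> b = u (y b)" if "b \<in> Basis" for u b
      using that by (simp add: \<iota>_def inner_sum_left_Basis)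
    then show "v = w" using y(2)[OF vw(1,2)] vw(3) by metis
  qed
  moreover have "\<forall>b\<in>Basis. y b \<in> smooth_functions M" using y(1) by blast
  ultimately show thesis using that \<iota>_def by blast
qed

lemma T1_spanning:
  obtains S where "finite S" "S \<subseteq> T1" "span S = T1"
proof -
  obtain \<iota> :: "'g tangent_vector \<Rightarrow> 'a" where i: "linear \<iota>" "inj_on \<iota> T1" using coordinates_linear by metis
  obtain S where S: "S \<subseteq> T1" "independent S" "T1 \<subseteq> span S" using maximal_independent_subset by blast
  have sp: "span S = T1" using S(1,3) T1_sub by (metis span_minimal subset_antisym)
  have "independent (\<iota> ` S)"
    by (rule linear_independent_injective_image[OF i(1) S(2)]) (simp add: sp i(2))
  then have "finite (\<iota> ` S)" using independent_bound by blast
  then have "finite S" using i(2) S(1) by (metis finite_imageD inj_on_subset)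
  then show thesis using that S(1) sp by blast
qed

text \<open>Functionals l i dual to the images of the basis under \<iota> exist on the Euclidean
  space; applying their coefficients to the coordinate functions y gives smooth functions on which
  the vectors e j act as a dual basis.\<close>

lemma lie_frame_exists:
  assumes ip: "inner_on T1 ip" and e: "orthonormal_basis T1 ip n e"
  shows "\<exists>x. lie_frame G M n e x"
proof -
  note eD = orthonormal_basisD[OF e] and ind = orthonormal_basis_dim[OF ip e]
  obtain y :: "'a \<Rightarrow> 'g \<Rightarrow> real" and \<iota> :: "'g tangent_vector \<Rightarrow> 'a" where y0: "\<forall>b\<in>Basis. y b \<in> smooth_functions M"
    and \<iota>: "\<iota> = (\<lambda>v. \<Sum>b\<in>Basis. v (y b) *\<^sub>R b)" "linear \<iota>" "inj_on \<iota> T1"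
    using coordinates_linear by blast
  note y = bspec[OF y0]
  have "independent (\<iota> ` e ` {..<n})"
    by (rule linear_independent_injective_image[OF \<iota>(2) ind(1)]) (use \<iota>(3) eD(3) in simp)
  then have "\<exists>l. linear l \<and> (\<forall>z\<in>\<iota> ` e ` {..<n}. l z = (if z = \<iota> (e i) then 1 else 0 :: real))" for i
    by (rule linear_independent_extend)
  then obtain l where l: "\<And>i. linear (l i :: 'a \<Rightarrow> real)"
    "\<And>i z. z \<in> \<iota> ` e ` {..<n} \<Longrightarrow> l i z = (if z = \<iota> (e i) then 1 else 0 :: real)" by metis
  define x where "x = (\<lambda>i q. \<Sum>b\<in>Basis. l i b * y b q)"
  have x: "x i \<in> smooth_functions M" for i
    unfolding x_def by (intro smooth_functions_sum smooth_functions_mult smooth_functions_const y)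
  have ux: "u (x i) = l i (\<iota> u)" if u: "u \<in> T1" for u i
  proof -
    have "u (x i) = (\<Sum>b\<in>Basis. u (\<lambda>q. l i b * y b q))"
      unfolding x_def by (intro tangent_space_sum[OF u] smooth_functions_mult smooth_functions_const y)
    also have "\<dots> = (\<Sum>b\<in>Basis. l i b * u (y b))"
      by (intro sum.cong refl tangent_space_cmult[OF u] y)
    also have "\<dots> = l i (\<iota> u)"
      unfolding \<iota>(1) linear_sum[OF l(1)] linear_cmul[OF l(1)] by (simp add: mult.commute)
    finally show ?thesis .
  qed
  have ex: "e j (x i) = (if i = j then 1 else 0)" if ij: "i < n" "j < n" for i j
  proof -
    have "(\<iota> (e j) = \<iota> (e i)) = (i = j)"
      using \<iota>(3) ind(2) eD(1) ij by (auto simp: inj_on_def)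
    then show ?thesis using ux[OF eD(1)[OF ij(2)]] l(2) ij by auto
  qed
  have "u = (\<Sum>i<n. u (x i) *\<^sub>R e i)" if u: "u \<in> T1" for u
  proof -
    have exp: "u = (\<Sum>j<n. ip u (e j) *\<^sub>R e j)" by (rule orthonormal_expansion[OF ip e u])
    have "u (x i) = ip u (e i)" if i: "i < n" for i
    proof -
      have "u (x i) = (\<Sum>j<n. ip u (e j) *\<^sub>R e j) (x i)" using exp by simp
      also have "\<dots> = (\<Sum>j<n. if i = j then ip u (e i) else 0)"
        unfolding sum_apply by (rule sum.cong[OF refl]) (simp add: scaleR_fun_def ex[OF i])
      finally show ?thesis using i by simp
    qed
    then show ?thesis using exp by simp
  qed
  then have "lie_frame G M n e x"
    by unfold_locales (use eD(1) x in auto)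
  then show ?thesis by blast
qed

end

locale metric_lie = lie_frame G M n e x
  for G :: "'g monoid" and M :: "('g, 'a::euclidean_space) manifold" and n e x +
  fixes g :: "'g metric"
  assumes riem: "riemannian_metric M g" and inv_metric: "left_invariant_metric G M g"
    and onb: "orthonormal_basis (tangent_space M \<one>\<^bsub>G\<^esub>) (g \<one>\<^bsub>G\<^esub>) n e"
begin

abbreviation "g1 \<equiv> g \<one>\<^bsub>G\<^esub>"
abbreviation "A \<equiv> levi_civita_product G M g"
abbreviation "br \<equiv> lie_bracket G M"

lemmas ip = riemannian_inner_on[OF riem]
lemmas ip1 = ip[OF closedG(1)]
lemmas g1_sym = inner_onD(3)[OF ip1]

lemma g_ltr:
  assumes "a \<in> points M" "p \<in> points M" "u \<in> tangent_space M p" "v \<in> tangent_space M p"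
  shows "g (a \<otimes>\<^bsub>G\<^esub> p) (ltr a u) (ltr a v) = g p u v"
  using inv_metric assms unfolding left_invariant_metric_def carrier differential_left by blast

lemma g_ltr1: "a \<in> points M \<Longrightarrow> u \<in> T1 \<Longrightarrow> v \<in> T1 \<Longrightarrow> g a (ltr a u) (ltr a v) = g1 u v"
  using g_ltr[of a "\<one>\<^bsub>G\<^esub>" u v] by simp

lemma T1_closed [simp]:
  "u \<in> T1 \<Longrightarrow> v \<in> T1 \<Longrightarrow> u + v \<in> T1" "u \<in> T1 \<Longrightarrow> v \<in> T1 \<Longrightarrow> u - v \<in> T1" "u \<in> T1 \<Longrightarrow> c *\<^sub>R u \<in> T1"
  "u \<in> T1 \<Longrightarrow> - u \<in> T1" "u \<in> T1 \<Longrightarrow> v \<in> T1 \<Longrightarrow> br u v \<in> T1"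
  using subspace_add[OF T1_sub] subspace_diff[OF T1_sub] subspace_scale[OF T1_sub] subspace_neg[OF T1_sub]
    lie_bracket_in by auto

lemma g1_linear:
  "u \<in> T1 \<Longrightarrow> u' \<in> T1 \<Longrightarrow> w \<in> T1 \<Longrightarrow> g1 (u + u') w = g1 u w + g1 u' w"
  "u \<in> T1 \<Longrightarrow> u' \<in> T1 \<Longrightarrow> w \<in> T1 \<Longrightarrow> g1 w (u + u') = g1 w u + g1 w u'"
  "u \<in> T1 \<Longrightarrow> u' \<in> T1 \<Longrightarrow> w \<in> T1 \<Longrightarrow> g1 (u - u') w = g1 u w - g1 u' w"
  "u \<in> T1 \<Longrightarrow> u' \<in> T1 \<Longrightarrow> w \<in> T1 \<Longrightarrow> g1 w (u - u') = g1 w u - g1 w u'"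
  "u \<in> T1 \<Longrightarrow> w \<in> T1 \<Longrightarrow> g1 (c *\<^sub>R u) w = c * g1 u w"
  "u \<in> T1 \<Longrightarrow> w \<in> T1 \<Longrightarrow> g1 u (c *\<^sub>R w) = c * g1 u w"
  using bilin_onD[OF inner_onD(2)[OF ip1]] bilin_on_diff[OF inner_onD(2)[OF ip1] T1_sub] by simp_all

lemma br_linear:
  "u \<in> T1 \<Longrightarrow> u' \<in> T1 \<Longrightarrow> w \<in> T1 \<Longrightarrow> br (u + u') w = br u w + br u' w"
  "u \<in> T1 \<Longrightarrow> u' \<in> T1 \<Longrightarrow> w \<in> T1 \<Longrightarrow> br w (u + u') = br w u + br w u'"
  "u \<in> T1 \<Longrightarrow> w \<in> T1 \<Longrightarrow> br (c *\<^sub>R u) w = c *\<^sub>R br u w"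
  "u \<in> T1 \<Longrightarrow> w \<in> T1 \<Longrightarrow> br u (c *\<^sub>R w) = c *\<^sub>R br u w"
  using bilin_onD[OF lie_bracket_bilin] by simp_all

lemma g1_br_antisym: "u \<in> T1 \<Longrightarrow> v \<in> T1 \<Longrightarrow> w \<in> T1 \<Longrightarrow> g1 (br u v) w = - g1 (br v u) w"
  using g1_linear(5)[of "br v u" w "-1"] by (simp add: lie_bracket_antisym[of u v])

section \<open>The Levi-Civita product and its algebraic properties\<close>

definition koszul :: "'g tangent_vector \<Rightarrow> 'g tangent_vector \<Rightarrow> 'g tangent_vector \<Rightarrow> real" where
  "koszul u v w = g1 (br u v) w + g1 (br w u) v + g1 (br w v) u"

text \<open>Justifies the definite description: the Koszul expression is linear in w, so it is
  represented by the vector with components \<open>koszul u v (e k) / 2\<close>, and positive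
  definiteness makes that vector unique. The third claim is how vectors are later recognized as
  values of A.\<close>

lemma product_spec:
  assumes u: "u \<in> T1" "v \<in> T1"
  shows "A u v \<in> T1" "w \<in> T1 \<Longrightarrow> 2 * g1 (A u v) w = koszul u v w"
    and "a \<in> T1 \<Longrightarrow> (\<And>w. w \<in> T1 \<Longrightarrow> 2 * g1 a w = koszul u v w) \<Longrightarrow> a = A u v"
proof -
  have uniq: "a = b" if "a \<in> T1" "b \<in> T1" "\<And>w. w \<in> T1 \<Longrightarrow> 2 * g1 a w = koszul u v w"
    "\<And>w. w \<in> T1 \<Longrightarrow> 2 * g1 b w = koszul u v w" for a b
    using inner_on_eqI[OF ip1 that(1,2)] that(3,4) by fastforce
  define a where "a = (\<Sum>k<n. (koszul u v (e k) / 2) *\<^sub>R e k)"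
  have a: "a \<in> T1" unfolding a_def by (intro subspace_sum[OF T1_sub] T1_closed) (simp add: e_in)
  have spec: "2 * g1 a w = koszul u v w" if w: "w \<in> T1" for w
  proof -
    let ?c = "\<lambda>k. g1 w (e k)"
    have kos_lin: "koszul u v (\<Sum>k\<in>K. c k *\<^sub>R e k) = (\<Sum>k\<in>K. c k * koszul u v (e k))" if "K \<subseteq> {..<n}" for K c
      using finite_subset[OF that finite_lessThan] that
    proof (induction K)
      case empty
      \<comment> \<open>Zero is written as a multiple of u so that the homogeneity rules evaluate
        it.\<close>
      have "koszul u v (0 *\<^sub>R u) = 0" unfolding koszul_def using u by (simp add: br_linear g1_linear del: scaleR_zero_left)
      then show ?case by simp
    next
      case (insert k K)
      have "(\<Sum>k\<in>K. c k *\<^sub>R e k) \<in> T1" "e k \<in> T1"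
        using insert.prems e_in by (auto intro!: subspace_sum[OF T1_sub] T1_closed)
      then have "koszul u v (c k *\<^sub>R e k + (\<Sum>k\<in>K. c k *\<^sub>R e k))
          = c k * koszul u v (e k) + koszul u v (\<Sum>k\<in>K. c k *\<^sub>R e k)"
        unfolding koszul_def using u by (simp add: br_linear g1_linear algebra_simps)
      then show ?case using insert by simp
    qed
    have "koszul u v w = koszul u v (\<Sum>k<n. ?c k *\<^sub>R e k)"
      using orthonormal_expansion[OF ip1 onb w] by simp
    also have "\<dots> = (\<Sum>k<n. ?c k * koszul u v (e k))" by (rule kos_lin) simp
    also have "\<dots> = 2 * (\<Sum>k<n. (koszul u v (e k) / 2) *\<^sub>R g1 (e k) w)"
      unfolding sum_distrib_left by (rule sum.cong[OF refl]) (simp add: g1_sym[OF e_in w])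
    also have "(\<Sum>k<n. (koszul u v (e k) / 2) *\<^sub>R g1 (e k) w) = g1 a w"
      unfolding a_def
      by (rule bilin_on_sum(1)[OF inner_onD(2)[OF ip1] T1_sub _ w, symmetric]) (simp add: e_in)
    finally show ?thesis by simp
  qed
  have Aeq: "A u v = (THE a. a \<in> T1 \<and> (\<forall>w\<in>T1. 2 * g1 a w = koszul u v w))"
    unfolding levi_civita_product_def lie_algebra_def koszul_def ..
  have ex: "a = A u v"
    unfolding Aeq by (rule the_equality[symmetric]) (use a spec uniq in auto)
  show "A u v \<in> T1" using a ex by simp
  show "2 * g1 (A u v) w = koszul u v w" if "w \<in> T1" using spec[OF that] ex by simp
  show "b = A u v" if "b \<in> T1" "\<And>w. w \<in> T1 \<Longrightarrow> 2 * g1 b w = koszul u v w" for b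
    unfolding ex[symmetric] by (rule uniq[OF that(1) a that(2) spec])
qed

lemmas A_in [simp] = product_spec(1)

text \<open>Inherited from the Koszul expression through the uniqueness clause of
  \<open>product_spec\<close>.\<close>

lemma A_bilin: "bilin_on T1 A"
proof (rule bilin_onI)
  show "A (u + u') w = A u w + A u' w" "A w (u + u') = A w u + A w u'"
    if u: "u \<in> T1" "u' \<in> T1" "w \<in> T1" for u u' w
    using u by (auto intro!: product_spec(3)[symmetric] simp: g1_linear distrib_left product_spec(2))
      (auto simp: koszul_def br_linear g1_linear)
  show "A (c *\<^sub>R u) w = c *\<^sub>R A u w" "A u (c *\<^sub>R w) = c *\<^sub>R A u w" if u: "u \<in> T1" "w \<in> T1" for c u w
  proof -
    have "2 * g1 (c *\<^sub>R A u w) z = c * koszul u w z" if "z \<in> T1" for z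
      using product_spec(2)[OF u that] that u by (simp add: g1_linear)
    then show "A (c *\<^sub>R u) w = c *\<^sub>R A u w" "A u (c *\<^sub>R w) = c *\<^sub>R A u w"
      using u by (auto intro!: product_spec(3)[symmetric])
        (auto simp: koszul_def br_linear g1_linear algebra_simps)
  qed
qed

lemma A_section:
  assumes P: "open_charts P" and s: "s \<in> Sec P" and t: "t \<in> Sec P"
  shows "(\<lambda>q. A (s q) (t q)) \<in> Sec P"
    and "p \<in> points P \<Longrightarrow> v \<in> tangent_space P p \<Longrightarrow>
      vd v (\<lambda>q. A (s q) (t q)) = A (vd v s) (t p) + A (s p) (vd v t)"
  by (rule bilin_section_vector(1)[OF P A_bilin A_in s t], assumption+)
    (rule bilin_section_vector(2)[OF P A_bilin A_in s t], assumption+)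

text \<open>Exchanging u and v swaps the last two Koszul terms, so they cancel in the difference and
  the bracket term is doubled.\<close>

lemma A_torsion_free:
  assumes u: "u \<in> T1" "v \<in> T1"
  shows "A u v - A v u = br u v"
proof (rule inner_on_eqI[OF ip1])
  fix w assume w: "w \<in> T1"
  show "g1 (A u v - A v u) w = g1 (br u v) w"
    using product_spec(2)[OF u w] product_spec(2)[OF u(2,1) w] g1_br_antisym[OF u w] u w
    unfolding koszul_def by (simp add: g1_linear)
qed (use u in auto)

text \<open>The six Koszul terms of the sum cancel in pairs by antisymmetry of the bracket.\<close>

lemma A_skew:
  assumes u: "u \<in> T1" "v \<in> T1" "w \<in> T1"
  shows "g1 (A u v) w + g1 v (A u w) = 0"
  using product_spec(2)[OF u] product_spec(2)[OF u(1,3,2)] g1_sym[OF u(2) A_in[OF u(1,3)]]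
    g1_br_antisym[OF u] g1_br_antisym[OF u(1,3,2)] g1_br_antisym[OF u(2,3,1)]
  unfolding koszul_def by simp

lemma pullback_form_id:
  assumes "p \<in> points M" "v \<in> tangent_space M p"
  shows "pullback_form M (\<lambda>p. p) p v = ltr (inv\<^bsub>G\<^esub> p) v"
proof -
  have "differential M M (\<lambda>p. p) p v = v"
    using tangent_space_nonsmooth[OF assms(2)] by (auto simp: differential_apply fun_eq_iff)
  then show ?thesis by (simp add: pullback_form_def)
qed

text \<open>By left invariance the metric is the constant form \<open>g1\<close> in the
  trivialization. Hence compatibility reduces to skewness of A, and vanishing torsion to
  \<open>A_torsion_free\<close> together with the trivialized bracket.\<close>

lemma trivialized_is_levi_civita: "is_levi_civita M g (trivialized_connection M (\<lambda>p. p) A)"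
  unfolding is_levi_civita_def
proof (intro conjI ballI)
  show "is_connection M M (\<lambda>p. p) (trivialized_connection M (\<lambda>p. p) A)"
    by (rule trivialized_is_connection[OF mfd smooth_map_id[OF mfd] A_bilin A_in])
  fix X Y p assume X: "X \<in> vector_fields M" and Y: "Y \<in> vector_fields M" and p: "p \<in> points M"
  let ?s = "\<lambda>q. ltr (inv\<^bsub>G\<^esub> q) (X q)" and ?t = "\<lambda>q. ltr (inv\<^bsub>G\<^esub> q) (Y q)"
  note s = trivialize_vector_field[OF X] and t = trivialize_vector_field[OF Y]
  note sp = sections_alongD(1)[OF s p] sections_alongD(1)[OF t p]
  note XY = vector_fieldsD(2)[OF X] vector_fieldsD(2)[OF Y]
  have "ltr p (vd (X p) ?t + A (?s p) (?t p)) - ltr p (vd (Y p) ?s + A (?t p) (?s p))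
      = ltr p (vd (X p) ?t - vd (Y p) ?s + (A (?s p) (?t p) - A (?t p) (?s p)))"
    unfolding ltr_linear(4)[symmetric] by (simp add: algebra_simps)
  then show "trivialized_connection M (\<lambda>p. p) A p (X p) Y - trivialized_connection M (\<lambda>p. p) A p (Y p) X
      = vf_bracket X Y p"
    unfolding trivialized_connection_def pullback_form_id[OF p XY(1)[OF p]] pullback_form_id[OF p XY(2)[OF p]]
      bracket_trivialized[OF X Y p] A_torsion_free[OF sp] .
  fix v assume v: "v \<in> tangent_space M p"
  let ?w = "ltr (inv\<^bsub>G\<^esub> p) v"
  have w: "?w \<in> T1" by (rule ltr_inv_in[OF p v])
  note ds = vector_derivative_at_in[OF oc p v s] vector_derivative_at_in[OF oc p v t]
  have gX: "g q (X q) (Y q) = g1 (?s q) (?t q)" if q: "q \<in> points M" for q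
    using g_ltr1[OF q sections_alongD(1)[OF s q] sections_alongD(1)[OF t q]]
    unfolding ltr_ltr_inv[OF q XY(1)[OF q]] ltr_ltr_inv[OF q XY(2)[OF q]] .
  have "v (\<lambda>q. g q (X q) (Y q)) = v (\<lambda>q. g1 (?s q) (?t q))"
    by (rule tangent_space_cong[OF oc p v gX])
  also have "\<dots> = g1 (vd v ?s) (?t p) + g1 (?s p) (vd v ?t)"
    by (rule bilin_section(2)[OF oc inner_onD(2)[OF ip1] s t p v])
  \<comment> \<open>The two A terms inserted here add up to zero by \<open>A_skew\<close>.\<close>
  also have "\<dots> = g1 (vd v ?s + A ?w (?s p)) (?t p) + g1 (?s p) (vd v ?t + A ?w (?t p))"
    using A_skew[OF w sp] sp ds w by (simp add: g1_linear)
  also have "\<dots> = g p (ltr p (vd v ?s + A ?w (?s p))) (Y p) + g p (X p) (ltr p (vd v ?t + A ?w (?t p)))"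
  proof -
    have "vd v ?s + A ?w (?s p) \<in> T1" "vd v ?t + A ?w (?t p) \<in> T1" using sp ds w by auto
    then show ?thesis
      using g_ltr1[OF p _ sp(2)] g_ltr1[OF p sp(1)]
      unfolding ltr_ltr_inv[OF p XY(1)[OF p]] ltr_ltr_inv[OF p XY(2)[OF p]] by simp
  qed
  finally show "v (\<lambda>q. g q (X q) (Y q)) = g p (trivialized_connection M (\<lambda>p. p) A p v X) (Y p)
      + g p (X p) (trivialized_connection M (\<lambda>p. p) A p v Y)"
    unfolding trivialized_connection_def pullback_form_id[OF p v] .
qed

lemma levi_civita: "is_levi_civita M g (levi_civita M g)"
  unfolding levi_civita_def by (rule someI[of "is_levi_civita M g", OF trivialized_is_levi_civita])

lemma levi_civita_connection: "is_connection M M (\<lambda>p. p) (levi_civita M g)"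
  using levi_civita unfolding is_levi_civita_def by blast

lemma levi_civita_torsion_free:
  assumes "X \<in> vector_fields M" "Y \<in> vector_fields M" "p \<in> points M"
  shows "levi_civita M g p (X p) Y - levi_civita M g p (Y p) X = vf_bracket X Y p"
  using levi_civita assms unfolding is_levi_civita_def by blast

lemma levi_civita_metric:
  assumes "X \<in> vector_fields M" "Y \<in> vector_fields M" "p \<in> points M" "v \<in> tangent_space M p"
  shows "v (\<lambda>q. g q (X q) (Y q)) = g p (levi_civita M g p v X) (Y p) + g p (X p) (levi_civita M g p v Y)"
  using levi_civita assms unfolding is_levi_civita_def by blast

text \<open>Only the axioms of the chosen connection are available. Inner products of left invariant
  fields are constant, which gives \<open>skew\<close>, and the torsion axiom gives
  \<open>tors\<close>. Replacing the brackets in the Koszul expression by \<open>tors\<close> and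
  cancelling by \<open>skew\<close> leaves twice the sought inner product, so the uniqueness clause
  identifies the value with A u w.\<close>

lemma levi_civita_left_invariant:
  assumes p: "p \<in> points M" and v: "v \<in> tangent_space M p" and w: "w \<in> T1"
  shows "levi_civita M g p v (\<lambda>q. ltr q w) = ltr p (A (ltr (inv\<^bsub>G\<^esub> p) v) w)"
proof -
  let ?D = "levi_civita M g"
  let ?a = "\<lambda>u w. ltr (inv\<^bsub>G\<^esub> p) (?D p (ltr p u) (\<lambda>q. ltr q w))"
  note F = left_invariant_vector_field
  have Dp: "?D p (ltr p u) (\<lambda>q. ltr q w) \<in> tangent_space M p" if "u \<in> T1" "w \<in> T1" for u w
    using connectionD(1)[OF levi_civita_connection p ltr_in_field[OF p that(1)] vector_fieldsD(1)[OF F[OF that(2)]]] .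
  have a: "?a u w \<in> T1" "?D p (ltr p u) (\<lambda>q. ltr q w) = ltr p (?a u w)" if "u \<in> T1" "w \<in> T1" for u w
    using ltr_inv_in[OF p Dp[OF that]] ltr_ltr_inv[OF p Dp[OF that]] by simp_all
  have skew: "g1 (?a z u) w = - g1 (?a z w) u" if z: "z \<in> T1" and u: "u \<in> T1" and w: "w \<in> T1" for z u w
  proof -
    note vz = ltr_in_field[OF p z]
    have "ltr p z (\<lambda>q. g q (ltr q u) (ltr q w)) = g p (?D p (ltr p z) (\<lambda>q. ltr q u)) (ltr p w)
        + g p (ltr p u) (?D p (ltr p z) (\<lambda>q. ltr q w))"
      by (rule levi_civita_metric[OF F[OF u] F[OF w] p vz])
    also have "\<dots> = g1 (?a z u) w + g1 u (?a z w)"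
      using g_ltr1[OF p a(1)[OF z u] w] g_ltr1[OF p u a(1)[OF z w]]
      by (simp only: a(2)[OF z u, symmetric] a(2)[OF z w, symmetric])
    also have "ltr p z (\<lambda>q. g q (ltr q u) (ltr q w)) = ltr p z (\<lambda>_. g1 u w)"
      by (rule tangent_space_cong[OF oc p vz]) (rule g_ltr1[OF _ u w])
    also have "\<dots> = 0" by (rule tangent_space_const[OF vz])
    finally show ?thesis using g1_sym[OF u a(1)[OF z w]] by simp
  qed
  have tors: "?a u w - ?a w u = br u w" if u: "u \<in> T1" and w: "w \<in> T1" for u w
  proof -
    have "?D p (ltr p u) (\<lambda>q. ltr q w) - ?D p (ltr p w) (\<lambda>q. ltr q u) = ltr p (br u w)"
      using levi_civita_torsion_free[OF F[OF u] F[OF w] p] left_invariant_bracket[OF p u w] by simp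
    then have "ltr (inv\<^bsub>G\<^esub> p) (?D p (ltr p u) (\<lambda>q. ltr q w) - ?D p (ltr p w) (\<lambda>q. ltr q u)) = br u w"
      using ltr_inv_ltr[OF p lie_bracket_in[OF u w]] by simp
    then show ?thesis unfolding ltr_linear .
  qed
  define u where "u = ltr (inv\<^bsub>G\<^esub> p) v"
  have u: "u \<in> T1" "ltr p u = v" using ltr_inv_in[OF p v] ltr_ltr_inv[OF p v] by (simp_all add: u_def)
  have eq: "?a u w = A u w"
  proof (rule product_spec(3)[OF u(1) w a(1)[OF u(1) w]])
    fix z assume z: "z \<in> T1"
    have gd: "g1 (br u' w') z' = g1 (?a u' w') z' - g1 (?a w' u') z'"
      if "u' \<in> T1" "w' \<in> T1" "z' \<in> T1" for u' w' z'
      unfolding tors[OF that(1,2), symmetric] by (rule g1_linear(3)[OF a(1)[OF that(1,2)] a(1)[OF that(2,1)] that(3)])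
    show "2 * g1 (?a u w) z = koszul u w z"
      unfolding koszul_def gd[OF u(1) w z] gd[OF z u(1) w] gd[OF z w u(1)]
      using skew[OF u(1) w z] skew[OF w u(1) z] skew[OF z u(1) w] by simp
  qed
  have "?D p (ltr p u) (\<lambda>q. ltr q w) = ltr p (A u w)"
    using a(2)[OF u(1) w] unfolding eq .
  then show ?thesis unfolding u(2) unfolding u_def .
qed

lemma levi_civita_trivialized:
  assumes p: "p \<in> points M" and v: "v \<in> tangent_space M p" and X: "X \<in> vector_fields M"
    and s: "s \<in> Sec M" "\<And>q. q \<in> points M \<Longrightarrow> X q = ltr q (s q)"
  shows "levi_civita M g p v X = ltr p (vd v s + A (ltr (inv\<^bsub>G\<^esub> p) v) (s p))"
  using connection_trivialized[OF mfd smooth_map_id[OF mfd] levi_civita_connection A_bilin p v _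
      vector_fieldsD(1)[OF X] s] levi_civita_left_invariant[OF p v]
  unfolding pullback_form_id[OF p v] by simp

lemma levi_civita_trivialized':
  assumes p: "p \<in> points M" and v: "v \<in> tangent_space M p" and X: "X \<in> vector_fields M"
  shows "levi_civita M g p v X
      = ltr p (vd v (\<lambda>q. ltr (inv\<^bsub>G\<^esub> q) (X q)) + A (ltr (inv\<^bsub>G\<^esub> p) v) (ltr (inv\<^bsub>G\<^esub> p) (X p)))"
  by (rule levi_civita_trivialized[OF p v X trivialize_vector_field[OF X]])
    (simp add: ltr_ltr_inv vector_fieldsD(2)[OF X])

text \<open>The trivialized connection along \<phi> satisfies the defining property: if y
  trivializes Y, then y composed with \<phi> trivializes the composed section, and differentiating y
  along d\<phi>(v) is differentiating that composition along v.\<close>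

lemma pullback_connection_spec:
  fixes P :: "('p, 'c::euclidean_space) manifold"
  assumes P: "smooth_manifold P" and \<phi>: "smooth_map P M \<phi>"
  shows "is_connection P M \<phi> (pullback_connection P M \<phi> (levi_civita M g))"
    and "p \<in> points P \<Longrightarrow> v \<in> tangent_space P p \<Longrightarrow> Y \<in> vector_fields M \<Longrightarrow>
      pullback_connection P M \<phi> (levi_civita M g) p v (\<lambda>q. Y (\<phi> q))
        = levi_civita M g (\<phi> p) (differential P M \<phi> p v) Y"
proof -
  let ?Q = "\<lambda>D. is_connection P M \<phi> D \<and> (\<forall>p\<in>points P. \<forall>v\<in>tangent_space P p. \<forall>Y\<in>vector_fields M.
      D p v (Y \<circ> \<phi>) = levi_civita M g (\<phi> p) (differential P M \<phi> p v) Y)"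
  have dphi: "differential P M \<phi> p v \<in> tangent_space M (\<phi> p)" if "v \<in> tangent_space P p" for p v
    by (rule differential_in[OF smooth_functions_pullback[OF manifold_open_charts[OF P] mfd \<phi>] that])
  have "?Q (trivialized_connection P \<phi> A)"
  proof (intro conjI ballI)
    show "is_connection P M \<phi> (trivialized_connection P \<phi> A)"
      by (rule trivialized_is_connection[OF P \<phi> A_bilin A_in])
    fix p v Y assume p: "p \<in> points P" and v: "v \<in> tangent_space P p" and Y: "Y \<in> vector_fields M"
    let ?y = "\<lambda>q. ltr (inv\<^bsub>G\<^esub> q) (Y q)"
    note y = trivialize_vector_field[OF Y]
    have "vd (differential P M \<phi> p v) ?y = vd v (\<lambda>q. ?y (\<phi> q))"
      using sections_along_all[OF oc y] by (auto simp: vector_derivative_at_def differential_apply fun_eq_iff)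
    then show "trivialized_connection P \<phi> A p v (Y \<circ> \<phi>) = levi_civita M g (\<phi> p) (differential P M \<phi> p v) Y"
      unfolding levi_civita_trivialized'[OF smooth_map_points[OF \<phi> p] dphi[OF v] Y]
        trivialized_connection_def pullback_form_def by (simp add: comp_def)
  qed
  then have "?Q (SOME D. ?Q D)" by (rule someI[of ?Q])
  then have Q: "?Q (pullback_connection P M \<phi> (levi_civita M g))"
    unfolding pullback_connection_def .
  show "is_connection P M \<phi> (pullback_connection P M \<phi> (levi_civita M g))" using Q by blast
  show "pullback_connection P M \<phi> (levi_civita M g) p v (\<lambda>q. Y (\<phi> q))
        = levi_civita M g (\<phi> p) (differential P M \<phi> p v) Y"
    if "p \<in> points P" "v \<in> tangent_space P p" "Y \<in> vector_fields M"
    using Q that unfolding comp_def by blast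
qed

text \<open>Left invariant fields composed with \<phi> form a frame along \<phi>, and on them the
  defining property of the pull-back reduces to \<open>levi_civita_left_invariant\<close>;
  \<open>connection_trivialized\<close> does the rest.\<close>

lemma pullback_connection_trivialized:
  fixes P :: "('p, 'c::euclidean_space) manifold"
  assumes P: "smooth_manifold P" and \<phi>: "smooth_map P M \<phi>"
    and p: "p \<in> points P" and v: "v \<in> tangent_space P p" and s: "s \<in> Sec P"
    and V: "\<And>q. q \<in> points P \<Longrightarrow> V q = ltr (\<phi> q) (s q)"
  shows "pullback_connection P M \<phi> (levi_civita M g) p v V
      = ltr (\<phi> p) (vd v s + A (pullback_form P \<phi> p v) (s p))"
proof (rule connection_trivialized[OF P \<phi> pullback_connection_spec(1)[OF P \<phi>] A_bilin p v _ _ s V])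
  have dphi: "differential P M \<phi> p v \<in> tangent_space M (\<phi> p)"
    by (rule differential_in[OF smooth_functions_pullback[OF manifold_open_charts[OF P] mfd \<phi>] v])
  show "pullback_connection P M \<phi> (levi_civita M g) p v (\<lambda>q. ltr (\<phi> q) u)
      = ltr (\<phi> p) (A (pullback_form P \<phi> p v) u)" if u: "u \<in> T1" for u
    unfolding pullback_connection_spec(2)[OF P \<phi> p v left_invariant_vector_field[OF u]]
      levi_civita_left_invariant[OF smooth_map_points[OF \<phi> p] dphi u] pullback_form_def ..
  show "V \<in> sections_along P M \<phi>"
    by (rule sections_along_cong[OF manifold_open_charts[OF P] untrivialize_section[OF P \<phi> s]]) (simp add: V)
qed

text \<open>The chosen extensions X, Y, Z are arbitrary, so derivatives of their trivializations
  appear. Second derivatives of Z cancel against the bracket term by \<open>vdb\<close>, products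
  with first derivatives of Z are symmetric in X and Y, and first derivatives of X and Y cancel
  against those in the trivialized bracket.\<close>

lemma curvature_trivialized:
  assumes p: "p \<in> points M" and u: "u \<in> T1" "v \<in> T1" "w \<in> T1"
  shows "curvature M g p (ltr p u) (ltr p v) (ltr p w) = ltr p (lie_curvature G M g u v w)"
proof -
  let ?D = "levi_civita M g"
  define X where "X = vf_extension M p (ltr p u)"
  define Y where "Y = vf_extension M p (ltr p v)"
  define Z where "Z = vf_extension M p (ltr p w)"
  have X: "X \<in> vector_fields M" "X p = ltr p u" and Y: "Y \<in> vector_fields M" "Y p = ltr p v"
    and Z: "Z \<in> vector_fields M" "Z p = ltr p w"
    unfolding X_def Y_def Z_def using vf_extension[OF p ltr_in_field[OF p]] u by blast+
  define s where "s = (\<lambda>X q. ltr (inv\<^bsub>G\<^esub> q) (X q :: 'g tangent_vector))"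
  have s_in: "s X \<in> Sec M" if "X \<in> vector_fields M" for X
    using trivialize_vector_field[OF that] by (simp add: s_def)
  have sp: "s X p = u" "s Y p = v" "s Z p = w"
    using ltr_inv_ltr[OF p] u X Y Z by (simp_all add: s_def)
  have DZ: "?D q a Z = ltr q (vd a (s Z) + A (ltr (inv\<^bsub>G\<^esub> q) a) (s Z q))"
    if "q \<in> points M" "a \<in> tangent_space M q" for q a
    using levi_civita_trivialized'[OF that Z(1)] by (simp add: s_def)
  have DD: "?D p (X p) (\<lambda>q. ?D q (Y q) Z)
      = ltr p (vd (X p) (\<lambda>q. vd (Y q) (s Z)) + (A (vd (X p) (s Y)) (s Z p) + A (s Y p) (vd (X p) (s Z)))
          + A (s X p) (vd (Y p) (s Z) + A (s Y p) (s Z p)))"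
    if X: "X \<in> vector_fields M" and Y: "Y \<in> vector_fields M" for X Y
  proof -
    note Xp = vector_fieldsD(2)[OF X p]
    have S1: "(\<lambda>q. vd (Y q) (s Z)) \<in> Sec M"
      by (rule sections_alongI)
        (auto simp: vector_derivative_at_def[of _ "s Z", THEN fun_cong]
          intro!: vector_derivative_at_in[OF oc _ _ s_in[OF Z(1)]] vector_fieldsD(2)[OF Y]
            sections_along_apply[OF Y s_in[OF Z(1)] oc])
    note S2 = A_section[OF oc s_in[OF Y] s_in[OF Z(1)]]
    let ?S = "\<lambda>q. vd (Y q) (s Z) + A (s Y q) (s Z q)"
    have S: "?S \<in> Sec M" by (rule sections_along_add[OF S1 S2(1)])
    have DY: "(\<lambda>q. ?D q (Y q) Z) \<in> vector_fields M"
      unfolding vector_fields_def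
      by (rule connection_section[OF levi_civita_connection Y vector_fieldsD(1)[OF Z(1)]])
    have "?D p (X p) (\<lambda>q. ?D q (Y q) Z) = ltr p (vd (X p) ?S + A (ltr (inv\<^bsub>G\<^esub> p) (X p)) (?S p))"
      by (rule levi_civita_trivialized[OF p Xp DY S]) (simp add: DZ vector_fieldsD(2)[OF Y] s_def)
    also have "vd (X p) ?S = vd (X p) (\<lambda>q. vd (Y q) (s Z)) + vd (X p) (\<lambda>q. A (s Y q) (s Z q))"
      by (rule vector_derivative_at_add[OF oc Xp S1 S2(1)])
    also have "vd (X p) (\<lambda>q. A (s Y q) (s Z q)) = A (vd (X p) (s Y)) (s Z p) + A (s Y p) (vd (X p) (s Z))"
      by (rule S2(2)[OF p Xp])
    finally show ?thesis by (simp only: s_def)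
  qed
  note XB = vector_fieldsD(2)[OF X(1) p] vector_fieldsD(2)[OF Y(1) p]
  note inS = vector_derivative_at_in[OF oc p]
  have d: "vd (X p) (s Y) \<in> T1" "vd (Y p) (s X) \<in> T1" "vd (X p) (s Z) \<in> T1" "vd (Y p) (s Z) \<in> T1"
    using XB s_in X(1) Y(1) Z(1) by (auto intro!: inS)
  have br: "vf_bracket X Y p = ltr p (vd (X p) (s Y) - vd (Y p) (s X) + br u v)"
    using bracket_trivialized[OF X(1) Y(1) p] sp by (simp add: s_def)
  then have "ltr (inv\<^bsub>G\<^esub> p) (vf_bracket X Y p) = vd (X p) (s Y) - vd (Y p) (s X) + br u v"
    using ltr_inv_ltr[OF p] d u by simp
  then have DB: "?D p (vf_bracket X Y p) Z
      = ltr p (vd (vf_bracket X Y p) (s Z) + A (vd (X p) (s Y) - vd (Y p) (s X) + br u v) w)"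
    using DZ[OF p vf_bracket_in[OF oc X(1) Y(1) p]] sp by simp
  \<comment> \<open>Immediate, since the vector derivative acts on component functions and the
    bracket is the commutator of these actions.\<close>
  have vdb: "vd (vf_bracket X Y p) (s Z) = vd (X p) (\<lambda>q. vd (Y q) (s Z)) - vd (Y p) (\<lambda>q. vd (X q) (s Z))"
    by (simp add: vector_derivative_at_def vf_bracket_def fun_eq_iff minus_apply)
  note AD = bilin_onD[OF A_bilin] bilin_on_diff[OF A_bilin T1_sub]
  have "curvature M g p (ltr p u) (ltr p v) (ltr p w)
      = ?D p (X p) (\<lambda>q. ?D q (Y q) Z) - ?D p (Y p) (\<lambda>q. ?D q (X q) Z) - ?D p (vf_bracket X Y p) Z"
    unfolding curvature_def Let_def X_def Y_def Z_def ..
  also have "\<dots> = ltr p (lie_curvature G M g u v w)"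
    unfolding DD[OF X(1) Y(1)] DD[OF Y(1) X(1)] DB vdb ltr_linear(4)[symmetric] lie_curvature_def Let_def sp
    using d u by (simp add: AD algebra_simps)
  finally show ?thesis .
qed

end

section \<open>Homomorphisms\<close>

context metric_lie
begin

lemma orthonormal_basis_ltr:
  assumes a: "a \<in> points M" and p: "p \<in> points M" and E: "orthonormal_basis (tangent_space M p) (g p) k E"
  shows "orthonormal_basis (tangent_space M (a \<otimes>\<^bsub>G\<^esub> p)) (g (a \<otimes>\<^bsub>G\<^esub> p)) k (\<lambda>i. ltr a (E i))"
proof -
  note ED = orthonormal_basisD[OF E]
  have sp: "ltr a (E i) \<in> tangent_space M (a \<otimes>\<^bsub>G\<^esub> p)" if "i < k" for i
    by (rule ltr_in[OF a ED(1)[OF that]])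
  have "u \<in> span ((\<lambda>i. ltr a (E i)) ` {..<k})" if u: "u \<in> tangent_space M (a \<otimes>\<^bsub>G\<^esub> p)" for u
  proof -
    let ?w = "ltr (inv\<^bsub>G\<^esub> a) u"
    have inv: "inv\<^bsub>G\<^esub> a \<otimes>\<^bsub>G\<^esub> (a \<otimes>\<^bsub>G\<^esub> p) = p"
      using a p groupG(5)[of "inv\<^bsub>G\<^esub> a" a p] by simp
    have "?w \<in> tangent_space M p" using ltr_in[OF closedG(2)[OF a] u] inv by simp
    then have w: "?w = (\<Sum>i<k. g p ?w (E i) *\<^sub>R E i)" by (rule orthonormal_expansion[OF ip[OF p] E])
    have "u = ltr a ?w"
      using ltr_ltr[OF a closedG(2)[OF a] closedG(3)[OF a p] u] ltr_one[OF closedG(3)[OF a p] u] a by simp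
    also have "\<dots> = ltr a (\<Sum>i<k. g p ?w (E i) *\<^sub>R E i)" using arg_cong[OF w] .
    also have "\<dots> = (\<Sum>i<k. g p ?w (E i) *\<^sub>R ltr a (E i))" by (simp only: ltr_sum ltr_linear(2))
    finally show ?thesis by (rule ssubst) (intro span_sum span_scale span_base, simp)
  qed
  moreover have "span ((\<lambda>i. ltr a (E i)) ` {..<k}) \<subseteq> tangent_space M (a \<otimes>\<^bsub>G\<^esub> p)"
    by (rule span_minimal[OF _ subspace_tangent_space]) (use sp in auto)
  ultimately have "tangent_space M (a \<otimes>\<^bsub>G\<^esub> p) = span ((\<lambda>i. ltr a (E i)) ` {..<k})" by auto
  then show ?thesis
    unfolding orthonormal_basis_def using sp ED(2) g_ltr[OF a p ED(1) ED(1)] by simp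
qed

text \<open>The left invariant frame shows that the choice in \<open>some_frame\<close> can be met.
  Of the chosen frame only smoothness and orthonormality at p are kept; its values, translated to
  the identity, can be compared with e by \<open>orthonormal_trace_unique\<close>.\<close>

lemma frame:
  assumes p: "p \<in> points M"
  defines "E \<equiv> some_frame M g p"
  shows "dim (tangent_space M p) = n" "i < n \<Longrightarrow> E i \<in> vector_fields M"
    "orthonormal_basis T1 g1 n (\<lambda>i. ltr (inv\<^bsub>G\<^esub> p) (E i p))"
proof -
  have L: "orthonormal_basis (tangent_space M q) (g q) n (\<lambda>i. ltr q (e i))" if "q \<in> points M" for q
    using orthonormal_basis_ltr[OF that closedG(1) onb] that by simp
  show d: "dim (tangent_space M p) = n" by (rule orthonormal_basis_dim(3)[OF ip[OF p] L[OF p]])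
  have "local_orthonormal_frame M g p (\<lambda>i q. ltr q (e i))"
    unfolding local_orthonormal_frame_def d
    using left_invariant_vector_field[OF e_in] L p openin_topspace[of "mtop M"] by blast
  then have "local_orthonormal_frame M g p E"
    unfolding E_def some_frame_def by (rule someI[of "local_orthonormal_frame M g p"])
  then have F: "\<forall>i<n. E i \<in> vector_fields M" "orthonormal_basis (tangent_space M p) (g p) n (\<lambda>i. E i p)"
    unfolding local_orthonormal_frame_def d by blast+
  show "E i \<in> vector_fields M" if "i < n" using F(1) that by blast
  show "orthonormal_basis T1 g1 n (\<lambda>i. ltr (inv\<^bsub>G\<^esub> p) (E i p))"
    using orthonormal_basis_ltr[OF closedG(2)[OF p] p F(2)] p by simp
qed

lemma A_linear:
  "u \<in> T1 \<Longrightarrow> u' \<in> T1 \<Longrightarrow> w \<in> T1 \<Longrightarrow> A (u + u') w = A u w + A u' w"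
  "u \<in> T1 \<Longrightarrow> u' \<in> T1 \<Longrightarrow> w \<in> T1 \<Longrightarrow> A w (u + u') = A w u + A w u'"
  "u \<in> T1 \<Longrightarrow> u' \<in> T1 \<Longrightarrow> w \<in> T1 \<Longrightarrow> A (u - u') w = A u w - A u' w"
  "u \<in> T1 \<Longrightarrow> u' \<in> T1 \<Longrightarrow> w \<in> T1 \<Longrightarrow> A w (u - u') = A w u - A w u'"
  "u \<in> T1 \<Longrightarrow> w \<in> T1 \<Longrightarrow> A (c *\<^sub>R u) w = c *\<^sub>R A u w"
  "u \<in> T1 \<Longrightarrow> w \<in> T1 \<Longrightarrow> A u (c *\<^sub>R w) = c *\<^sub>R A u w"
  "u \<in> T1 \<Longrightarrow> A 0 u = 0" "u \<in> T1 \<Longrightarrow> A u 0 = 0"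
  using bilin_onD[OF A_bilin] bilin_on_diff[OF A_bilin T1_sub] bilin_on_0[OF A_bilin] by simp_all

lemma A_sum_left:
  "(\<And>i. i \<in> I \<Longrightarrow> u i \<in> T1) \<Longrightarrow> w \<in> T1 \<Longrightarrow> A (\<Sum>i\<in>I. u i) w = (\<Sum>i\<in>I. A (u i) w)"
  using bilin_on_sum(1)[OF A_bilin T1_sub, of I u w "\<lambda>_. 1"] by simp

text \<open>For equal arguments the first Koszul term vanishes and the other two coincide, so the
  inner product of A (e i) (e i) with w is the i-th diagonal entry of ad w.\<close>

lemma trace_vector:
  assumes U: "U \<in> T1" "\<And>v. v \<in> T1 \<Longrightarrow> g1 U v = trace_on T1 (br v)"
  shows "(\<Sum>i<n. A (e i) (e i)) = U"
proof (rule inner_on_eqI[OF ip1 _ U(1)])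
  have eA: "A (e i) (e i) \<in> T1" if "i < n" for i using e_in that by simp
  show "(\<Sum>i<n. A (e i) (e i)) \<in> T1" by (rule subspace_sum[OF T1_sub]) (simp add: eA)
  fix w assume w: "w \<in> T1"
  have "g1 (A (e i) (e i)) w = g1 (br w (e i)) (e i)" if "i < n" for i
  proof -
    note ei = e_in[OF that]
    have "g1 (br (e i) (e i)) w = 0" using g1_br_antisym[OF ei ei w] by simp
    then show ?thesis using product_spec(2)[OF ei ei w] by (simp add: koszul_def)
  qed
  then have "g1 (\<Sum>i<n. A (e i) (e i)) w = (\<Sum>i<n. g1 (br w (e i)) (e i))"
    using bilin_on_sum(1)[OF inner_onD(2)[OF ip1] T1_sub, of "{..<n}" "\<lambda>i. A (e i) (e i)" w "\<lambda>_. 1"] eA w by simp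
  also have "\<dots> = trace_on T1 (br w)"
    by (rule trace_on_orthonormal[OF ip1 onb, symmetric]) (use w in \<open>auto simp: br_linear\<close>)
  finally show "g1 (\<Sum>i<n. A (e i) (e i)) w = g1 U w" using U(2)[OF w] by simp
qed

end

lemma metric_lie_exists:
  assumes G: "riemannian_lie_group G M g" and e: "orthonormal_basis (lie_algebra G M) (g \<one>\<^bsub>G\<^esub>) n e"
  obtains x where "metric_lie G M n e x g"
proof -
  interpret lie_grp G M using G by unfold_locales (simp add: riemannian_lie_group_def)
  have r: "riemannian_metric M g" "left_invariant_metric G M g"
    using G by (simp_all add: riemannian_lie_group_def)
  obtain x where "lie_frame G M n e x"
    using lie_frame_exists[OF riemannian_inner_on[OF r(1) closedG(1)]] e unfolding lie_algebra_def by blast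
  then have "metric_lie G M n e x g"
    using r e unfolding lie_algebra_def by (intro metric_lie.intro metric_lie_axioms.intro)
  then show thesis by (rule that)
qed

text \<open>The theorem provides a basis only for the domain; the frame of the target comes from
  here.\<close>

lemma lie_algebra_orthonormal_basis:
  assumes "riemannian_lie_group G M g"
  obtains n e where "orthonormal_basis (lie_algebra G M) (g \<one>\<^bsub>G\<^esub>) n e"
proof -
  interpret lie_grp G M using assms by unfold_locales (simp add: riemannian_lie_group_def)
  have r: "riemannian_metric M g" using assms by (simp add: riemannian_lie_group_def)
  obtain S where S: "finite S" "S \<subseteq> T1" "span S = T1" using T1_spanning .
  show thesis
    using orthonormal_basis_exists[OF riemannian_inner_on[OF r closedG(1)] S(1,2)] that
    unfolding S(3) lie_algebra_def by blast
qed

section \<open>A homomorphism: tension and bitension fields as left translates\<close>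

locale metric_lie_hom =
  dom: metric_lie G M n e x g + cod: metric_lie H N m f y h
  for G :: "'g monoid" and M :: "('g, 'a::euclidean_space) manifold" and n e x g
    and H :: "'h monoid" and N :: "('h, 'b::euclidean_space) manifold" and m f y h +
  fixes \<phi> :: "'g \<Rightarrow> 'h"
  assumes hom: "\<phi> \<in> hom G H" and smooth: "smooth_map M N \<phi>"
begin

abbreviation "A \<equiv> levi_civita_product G M g"
abbreviation "B \<equiv> levi_civita_product H N h"
abbreviation "K \<equiv> lie_curvature H N h"

definition \<xi> :: "'g tangent_vector \<Rightarrow> 'h tangent_vector" where
  "\<xi> = differential M N \<phi> \<one>\<^bsub>G\<^esub>"

lemma differential_eq: "differential M N \<phi> p = \<xi>"
  unfolding \<xi>_def differential_def ..

lemmas \<xi>_linear [simp] = differential_linear[of M N \<phi> "\<one>\<^bsub>G\<^esub>", folded \<xi>_def]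
  and \<xi>_sum = differential_sum[of M N \<phi> "\<one>\<^bsub>G\<^esub>", folded \<xi>_def]
  and \<xi>_apply = differential_apply[of M N \<phi> "\<one>\<^bsub>G\<^esub>", folded \<xi>_def]

lemma pullback: "k \<in> smooth_functions N \<Longrightarrow> (\<lambda>x. k (\<phi> x)) \<in> smooth_functions M"
  by (rule smooth_functions_pullback[OF dom.oc cod.mfd smooth])

lemma group_hom: "group_hom G H \<phi>"
  by (rule group_hom.intro[OF dom.grp cod.grp]) (simp add: group_hom_axioms_def hom)

lemma \<phi>_hom [simp]:
  "\<phi> \<one>\<^bsub>G\<^esub> = \<one>\<^bsub>H\<^esub>" "a \<in> points M \<Longrightarrow> \<phi> a \<in> points N"
  "a \<in> points M \<Longrightarrow> b \<in> points M \<Longrightarrow> \<phi> (a \<otimes>\<^bsub>G\<^esub> b) = \<phi> a \<otimes>\<^bsub>H\<^esub> \<phi> b"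
  "a \<in> points M \<Longrightarrow> \<phi> (inv\<^bsub>G\<^esub> a) = inv\<^bsub>H\<^esub> (\<phi> a)"
  using group_hom.hom_one[OF group_hom] group_hom.hom_closed[OF group_hom]
    group_hom.hom_mult[OF group_hom] group_hom.hom_inv[OF group_hom]
  unfolding dom.carrier cod.carrier by auto

lemma \<xi>_in_at: "v \<in> tangent_space M p \<Longrightarrow> \<xi> v \<in> tangent_space N (\<phi> p)"
  unfolding \<xi>_def by (rule differential_in[OF pullback])

lemma \<xi>_in [simp]: "u \<in> dom.T1 \<Longrightarrow> \<xi> u \<in> cod.T1"
  using \<xi>_in_at[of u "\<one>\<^bsub>G\<^esub>"] by simp

text \<open>The chain rule for \<phi> (a x) = \<phi> a \<phi> x, an identity on the manifold only,
  whence \<open>tangent_space_cong\<close>.\<close>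

lemma \<xi>_ltr:
  assumes a: "a \<in> points M" and p: "p \<in> points M" and u: "u \<in> tangent_space M p"
  shows "\<xi> (dom.ltr a u) = cod.ltr (\<phi> a) (\<xi> u)"
proof
  fix k
  have "u (\<lambda>x. k (\<phi> (a \<otimes>\<^bsub>G\<^esub> x))) = u (\<lambda>x. k (\<phi> a \<otimes>\<^bsub>H\<^esub> \<phi> x))"
    by (rule tangent_space_cong[OF dom.oc p u]) (simp add: a)
  then show "\<xi> (dom.ltr a u) k = cod.ltr (\<phi> a) (\<xi> u) k"
    using a by (simp add: \<xi>_apply dom.ltr_apply cod.ltr_apply pullback cod.smooth_left)
qed

lemma pullback_form_eq:
  assumes p: "p \<in> points M" and v: "v \<in> tangent_space M p"
  shows "cod.pullback_form M \<phi> p v = \<xi> (dom.ltr (inv\<^bsub>G\<^esub> p) v)"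
  unfolding cod.pullback_form_def differential_eq using \<xi>_ltr[OF dom.closedG(2)[OF p] p v] p by simp

text \<open>Applying \<xi> is precomposing the argument function with \<phi>, independently of the
  base point, so it passes through the derivative v.\<close>

lemma \<xi>_section:
  assumes s: "s \<in> dom.Sec M"
  shows "(\<lambda>q. \<xi> (s q)) \<in> cod.Sec M"
    and "v \<in> tangent_space M p \<Longrightarrow> vector_derivative_at v (\<lambda>q. \<xi> (s q)) = \<xi> (vector_derivative_at v s)"
proof -
  show "(\<lambda>q. \<xi> (s q)) \<in> cod.Sec M"
  proof (rule sections_alongI)
    show "\<xi> (s q) \<in> cod.T1" if "q \<in> points M" for q using sections_alongD(1)[OF s that] by simp
    show "(\<lambda>q. \<xi> (s q) k) \<in> smooth_functions M" if "k \<in> smooth_functions N" for k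
      using sections_alongD(2)[OF s pullback[OF that]] that by (simp add: \<xi>_apply)
  qed
  show "vector_derivative_at v (\<lambda>q. \<xi> (s q)) = \<xi> (vector_derivative_at v s)" if "v \<in> tangent_space M p"
    by (rule ext) (simp add: vector_derivative_at_def \<xi>_apply tangent_space_const[OF that])
qed

abbreviation "D \<equiv> pullback_connection M N \<phi> (levi_civita N h)"

lemma D_trivialized:
  assumes p: "p \<in> points M" and v: "v \<in> tangent_space M p" and s: "s \<in> cod.Sec M"
    and V: "\<And>q. q \<in> points M \<Longrightarrow> V q = cod.ltr (\<phi> q) (s q)"
  shows "D p v V = cod.ltr (\<phi> p) (vector_derivative_at v s + B (\<xi> (dom.ltr (inv\<^bsub>G\<^esub> p) v)) (s p))"
  using cod.pullback_connection_trivialized[OF dom.mfd smooth p v s V] pullback_form_eq[OF p v] by simp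

text \<open>The second fundamental form of \<open>\<phi>\<close> in the left trivialization.\<close>

definition \<beta> :: "'g tangent_vector \<Rightarrow> 'g tangent_vector \<Rightarrow> 'h tangent_vector" where
  "\<beta> u w = B (\<xi> u) (\<xi> w) - \<xi> (A u w)"

lemma \<beta>_in: "u \<in> dom.T1 \<Longrightarrow> w \<in> dom.T1 \<Longrightarrow> \<beta> u w \<in> cod.T1"
  by (simp add: \<beta>_def)

lemma \<beta>_bilin: "bilin_on dom.T1 \<beta>"
  by (rule bilin_onI)
    (simp_all add: \<beta>_def dom.A_linear cod.A_linear algebra_simps)

text \<open>The derivative of the trivialization of Y enters both the pull-back term and the
  Levi-Civita term as the same \<xi> (vd v y), leaving only the value of Y at p.\<close>

lemma second_fundamental_form_eq:
  assumes p: "p \<in> points M" and v: "v \<in> tangent_space M p" and Y: "Y \<in> vector_fields M"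
  shows "second_fundamental_form M g N h \<phi> p v Y
    = cod.ltr (\<phi> p) (\<beta> (dom.ltr (inv\<^bsub>G\<^esub> p) v) (dom.ltr (inv\<^bsub>G\<^esub> p) (Y p)))"
proof -
  let ?y = "\<lambda>q. dom.ltr (inv\<^bsub>G\<^esub> q) (Y q)" and ?w = "dom.ltr (inv\<^bsub>G\<^esub> p) v"
  note y = dom.trivialize_vector_field[OF Y]
  note yp = sections_alongD(1)[OF y p] and w = dom.ltr_inv_in[OF p v]
    and dy = vector_derivative_at_in[OF dom.oc p v y]
  have Yq: "\<xi> (Y q) = cod.ltr (\<phi> q) (\<xi> (?y q))" if q: "q \<in> points M" for q
    using \<xi>_ltr[OF q dom.closedG(1) sections_alongD(1)[OF y q]] dom.ltr_ltr_inv[OF q vector_fieldsD(2)[OF Y q]] by simp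
  have "D p v (\<lambda>q. \<xi> (Y q)) = cod.ltr (\<phi> p) (\<xi> (vector_derivative_at v ?y) + B (\<xi> ?w) (\<xi> (?y p)))"
    using D_trivialized[OF p v \<xi>_section(1)[OF y] Yq] \<xi>_section(2)[OF y v] by simp
  moreover have "\<xi> (levi_civita M g p v Y) = cod.ltr (\<phi> p) (\<xi> (vector_derivative_at v ?y) + \<xi> (A ?w (?y p)))"
    unfolding dom.levi_civita_trivialized'[OF p v Y]
    using \<xi>_ltr[OF p dom.closedG(1), of "vector_derivative_at v ?y + A ?w (?y p)"] dy w yp by simp
  ultimately show ?thesis
    unfolding second_fundamental_form_def differential_eq \<beta>_def by (simp add: cod.ltr_linear(4)[symmetric])
qed

definition \<tau> :: "'h tangent_vector" where
  "\<tau> = (\<Sum>i<n. \<beta> (e i) (e i))"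

lemma \<tau>_in [simp]: "\<tau> \<in> cod.T1"
  unfolding \<tau>_def by (rule subspace_sum[OF cod.T1_sub]) (simp add: \<beta>_in dom.e_in)

lemma tension_eq:
  assumes p: "p \<in> points M"
  shows "tension M g N h \<phi> p = cod.ltr (\<phi> p) \<tau>"
proof -
  let ?E = "some_frame M g p"
  let ?a = "\<lambda>i. dom.ltr (inv\<^bsub>G\<^esub> p) (?E i p)"
  note fr = dom.frame[OF p]
  have "tension M g N h \<phi> p = (\<Sum>i<n. cod.ltr (\<phi> p) (\<beta> (?a i) (?a i)))"
    unfolding tension_def Let_def fr(1)
    by (rule sum.cong[OF refl], rule second_fundamental_form_eq[OF p])
      (simp_all add: fr(2) vector_fieldsD(2)[OF _ p])
  also have "\<dots> = cod.ltr (\<phi> p) (\<Sum>i<n. \<beta> (?a i) (?a i))" by (simp only: cod.ltr_sum)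
  also have "(\<Sum>i<n. \<beta> (?a i) (?a i)) = \<tau>"
    unfolding \<tau>_def by (rule orthonormal_trace_unique[OF dom.ip1 fr(3) dom.onb \<beta>_bilin])
  finally show ?thesis .
qed

text \<open>The bilinear form whose trace is the negative of the bitension field.\<close>

definition \<gamma> :: "'g tangent_vector \<Rightarrow> 'g tangent_vector \<Rightarrow> 'h tangent_vector" where
  "\<gamma> u w = B (\<xi> u) (B (\<xi> w) \<tau>) - B (\<xi> (A u w)) \<tau> + K \<tau> (\<xi> u) (\<xi> w)"

lemma \<gamma>_bilin: "bilin_on dom.T1 \<gamma>"
  by (rule bilin_onI)
    (simp_all add: \<gamma>_def lie_curvature_def Let_def dom.A_linear cod.A_linear cod.br_linear algebra_simps)

text \<open>The tension field is constant in the trivialization, so its own derivatives vanish. The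
  derivative z of the trivialization of Y survives in the first two terms, each time as B (\<xi> z)
  \<tau>, and cancels.\<close>

lemma bitension_summand:
  assumes p: "p \<in> points M" and Y: "Y \<in> vector_fields M"
  defines "w \<equiv> dom.ltr (inv\<^bsub>G\<^esub> p) (Y p)" and "\<tau>' \<equiv> tension M g N h \<phi>"
  shows "D p (Y p) (\<lambda>q. D q (Y q) \<tau>') - D p (levi_civita M g p (Y p) Y) \<tau>'
      + curvature N h (\<phi> p) (\<tau>' p) (differential M N \<phi> p (Y p)) (differential M N \<phi> p (Y p))
    = cod.ltr (\<phi> p) (\<gamma> w w)"
proof -
  let ?y = "\<lambda>q. dom.ltr (inv\<^bsub>G\<^esub> q) (Y q)"
  note y = dom.trivialize_vector_field[OF Y]
  note Yp = vector_fieldsD(2)[OF Y p]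
  have w: "?y p = w" "w \<in> dom.T1" "Y p = dom.ltr p w"
    using dom.ltr_inv_in[OF p Yp] dom.ltr_ltr_inv[OF p Yp] by (simp_all add: w_def)
  define z where "z = vector_derivative_at (Y p) ?y"
  have z: "z \<in> dom.T1" unfolding z_def by (rule vector_derivative_at_in[OF dom.oc p Yp y])
  note c = cod.const_section[OF \<tau>_in, of M]
  have D\<tau>: "D q v \<tau>' = cod.ltr (\<phi> q) (B (\<xi> (dom.ltr (inv\<^bsub>G\<^esub> q) v)) \<tau>)"
    if q: "q \<in> points M" and v: "v \<in> tangent_space M q" for q v
    using D_trivialized[OF q v c, of \<tau>'] tension_eq vector_derivative_at_const[OF v, of \<tau>]
    by (simp add: \<tau>'_def)
  note S = cod.A_section[OF dom.oc \<xi>_section(1)[OF y] c]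
  have "D p (Y p) (\<lambda>q. D q (Y q) \<tau>')
      = cod.ltr (\<phi> p) (vector_derivative_at (Y p) (\<lambda>q. B (\<xi> (?y q)) \<tau>) + B (\<xi> (?y p)) (B (\<xi> (?y p)) \<tau>))"
    by (rule D_trivialized[OF p Yp S(1)]) (rule D\<tau>[OF _ vector_fieldsD(2)[OF Y]])
  also have "vector_derivative_at (Y p) (\<lambda>q. B (\<xi> (?y q)) \<tau>) = B (\<xi> z) \<tau>"
    using S(2)[OF p Yp] \<xi>_section(2)[OF y Yp] vector_derivative_at_const[OF Yp, of \<tau>] w
    by (simp add: z_def cod.A_linear)
  finally have 1: "D p (Y p) (\<lambda>q. D q (Y q) \<tau>') = cod.ltr (\<phi> p) (B (\<xi> z) \<tau> + B (\<xi> w) (B (\<xi> w) \<tau>))"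
    unfolding w(1) .
  have LC: "levi_civita M g p (Y p) Y = dom.ltr p (z + A w w)"
    using dom.levi_civita_trivialized'[OF p Yp Y] w(1) by (simp add: z_def)
  have zA: "z + A w w \<in> dom.T1" using z w by simp
  have 2: "D p (levi_civita M g p (Y p) Y) \<tau>' = cod.ltr (\<phi> p) (B (\<xi> z) \<tau> + B (\<xi> (A w w)) \<tau>)"
    unfolding LC using D\<tau>[OF p dom.ltr_in_field[OF p zA]] dom.ltr_inv_ltr[OF p zA] z w
    by (simp add: cod.A_linear)
  have "\<xi> (Y p) = cod.ltr (\<phi> p) (\<xi> w)"
    unfolding w(3) by (rule \<xi>_ltr[OF p dom.closedG(1) w(2)])
  then have 3: "curvature N h (\<phi> p) (\<tau>' p) (differential M N \<phi> p (Y p)) (differential M N \<phi> p (Y p))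
      = cod.ltr (\<phi> p) (K \<tau> (\<xi> w) (\<xi> w))"
    unfolding differential_eq \<tau>'_def tension_eq[OF p] using p w(2)
    by (simp add: cod.curvature_trivialized)
  show ?thesis
    unfolding 1 2 3 cod.ltr_linear(1,4)[symmetric] \<gamma>_def by (simp add: algebra_simps)
qed

lemma bitension_eq:
  assumes p: "p \<in> points M"
  shows "bitension M g N h \<phi> p = cod.ltr (\<phi> p) (- (\<Sum>i<n. \<gamma> (e i) (e i)))"
proof -
  let ?E = "some_frame M g p"
  let ?a = "\<lambda>i. dom.ltr (inv\<^bsub>G\<^esub> p) (?E i p)"
  note fr = dom.frame[OF p]
  have neg: "- cod.ltr a u = cod.ltr a (- u)" for a u
    using cod.ltr_linear(2)[of a "-1" u] by simp
  have "bitension M g N h \<phi> p = - (\<Sum>i<n. cod.ltr (\<phi> p) (\<gamma> (?a i) (?a i)))"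
    unfolding bitension_def Let_def fr(1)
    by (rule arg_cong[of _ _ uminus], rule sum.cong[OF refl], rule bitension_summand[OF p])
      (simp add: fr(2))
  also have "\<dots> = cod.ltr (\<phi> p) (- (\<Sum>i<n. \<gamma> (?a i) (?a i)))" unfolding cod.ltr_sum[symmetric] neg ..
  also have "(\<Sum>i<n. \<gamma> (?a i) (?a i)) = (\<Sum>i<n. \<gamma> (e i) (e i))"
    by (rule orthonormal_trace_unique[OF dom.ip1 fr(3) dom.onb \<gamma>_bilin])
  finally show ?thesis .
qed

text \<open>Turns vanishing at every point of a field of left translates into vanishing of one
  vector of the Lie algebra.\<close>

lemma ltr_eq_0_iff: "a \<in> points N \<Longrightarrow> u \<in> cod.T1 \<Longrightarrow> cod.ltr a u = 0 \<longleftrightarrow> u = 0"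
  using cod.ltr_inv_ltr[of a u] cod.ltr_linear(3) by metis

end

theorem proposition2p1:
  fixes G :: "'g monoid" and M :: "('g, 'a::euclidean_space) manifold" and g :: "'g metric"
    and H :: "'h monoid" and N :: "('h, 'b::euclidean_space) manifold" and h :: "'h metric"
    and \<phi> :: "'g \<Rightarrow> 'h" and \<xi> :: "'g tangent_vector \<Rightarrow> 'h tangent_vector"
    and B :: "'h tangent_vector \<Rightarrow> 'h tangent_vector \<Rightarrow> 'h tangent_vector"
    and K :: "'h tangent_vector \<Rightarrow> 'h tangent_vector \<Rightarrow> 'h tangent_vector \<Rightarrow> 'h tangent_vector"
    and n :: nat and e :: "nat \<Rightarrow> 'g tangent_vector"
    and U\<xi> :: "'h tangent_vector" and Ug :: "'g tangent_vector"
    and \<tau>\<xi> \<tau>2\<xi> :: "'h tangent_vector"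
  assumes "riemannian_lie_group G M g" and "riemannian_lie_group H N h"
    and "\<phi> \<in> hom G H" and "smooth_map M N \<phi>"
    and "\<xi> = differential M N \<phi> \<one>\<^bsub>G\<^esub>"
    and "orthonormal_basis (lie_algebra G M) (g \<one>\<^bsub>G\<^esub>) n e"
    and "B = levi_civita_product H N h" and "K = lie_curvature H N h"
    and "U\<xi> = (\<Sum>i<n. B (\<xi> (e i)) (\<xi> (e i)))"
    and "Ug \<in> lie_algebra G M"
    and "\<forall>v\<in>lie_algebra G M. g \<one>\<^bsub>G\<^esub> Ug v = trace_on (lie_algebra G M) (lie_bracket G M v)"
    and "\<tau>\<xi> = tension M g N h \<phi> \<one>\<^bsub>G\<^esub>" and "\<tau>2\<xi> = bitension M g N h \<phi> \<one>\<^bsub>G\<^esub>"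
  shows "\<tau>\<xi> = U\<xi> - \<xi> Ug \<and>
    (harmonic M g N h \<phi> \<longleftrightarrow> \<tau>\<xi> = 0) \<and>
    \<tau>2\<xi> = - (\<Sum>i<n. B (\<xi> (e i)) (B (\<xi> (e i)) \<tau>\<xi>) + K \<tau>\<xi> (\<xi> (e i)) (\<xi> (e i))) + B (\<xi> Ug) \<tau>\<xi> \<and>
    (biharmonic M g N h \<phi> \<longleftrightarrow> \<tau>2\<xi> = 0)"
proof -
  have G: "riemannian_lie_group G M g" and H: "riemannian_lie_group H N h" by (rule assms)+
  obtain x where x: "metric_lie G M n e x g" using metric_lie_exists[OF G assms(6)] .
  obtain m f where f: "orthonormal_basis (lie_algebra H N) (h \<one>\<^bsub>H\<^esub>) m f"
    using lie_algebra_orthonormal_basis[OF H] .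
  obtain y where y: "metric_lie H N m f y h" using metric_lie_exists[OF H f] .
  interpret hom: metric_lie_hom G M n e x g H N m f y h \<phi>
    by (rule metric_lie_hom.intro[OF x y metric_lie_hom_axioms.intro[OF assms(3,4)]])
  have \<xi>: "\<xi> = hom.\<xi>" by (simp add: assms(5) hom.\<xi>_def)
  have Ug: "(\<Sum>i<n. hom.A (e i) (e i)) = Ug"
    by (rule hom.dom.trace_vector) (use assms(10,11) in \<open>simp_all add: lie_algebra_def\<close>)
  have one: "hom.cod.ltr (\<phi> \<one>\<^bsub>G\<^esub>) u = u" if "u \<in> hom.cod.T1" for u
    using hom.cod.ltr_one[OF hom.cod.closedG(1) that] by simp
  have \<tau>: "\<tau>\<xi> = hom.\<tau>"
    unfolding assms(12) hom.tension_eq[OF hom.dom.closedG(1)] by (rule one) simp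
  have 1: "\<tau>\<xi> = U\<xi> - \<xi> Ug"
    unfolding \<tau> hom.\<tau>_def hom.\<beta>_def sum_subtractf hom.\<xi>_sum[symmetric] Ug \<xi> assms(7,9) ..
  have h2: "harmonic M g N h \<phi> \<longleftrightarrow> \<tau>\<xi> = 0"
    unfolding harmonic_def \<tau> using hom.tension_eq hom.ltr_eq_0_iff[OF hom.\<phi>_hom(2) hom.\<tau>_in] hom.dom.closedG(1)
    by metis
  define t2 where "t2 = - (\<Sum>i<n. hom.\<gamma> (e i) (e i))"
  have AT: "hom.A (e i) (e i) \<in> hom.dom.T1" if "i < n" for i using hom.dom.e_in[OF that] by simp
  have "hom.\<gamma> (e i) (e i) \<in> hom.cod.T1" if "i < n" for i
    using hom.dom.e_in[OF that] AT[OF that] by (simp add: hom.\<gamma>_def lie_curvature_def Let_def)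
  then have t2_in: "t2 \<in> hom.cod.T1"
    unfolding t2_def by (intro hom.cod.T1_closed(4) subspace_sum[OF hom.cod.T1_sub]) simp
  have \<tau>2: "\<tau>2\<xi> = t2"
    unfolding assms(13) hom.bitension_eq[OF hom.dom.closedG(1)] t2_def[symmetric] by (rule one[OF t2_in])
  \<comment> \<open>Linearity of \<xi> and of B in its first argument collects the correction terms
    of the second covariant derivatives into the last summand of the bitension formula.\<close>
  have "(\<Sum>i<n. B (\<xi> (hom.A (e i) (e i))) \<tau>\<xi>) = B (\<xi> Ug) \<tau>\<xi>"
    unfolding Ug[symmetric] \<xi> hom.\<xi>_sum assms(7) \<tau>
    by (rule hom.cod.A_sum_left[symmetric]) (simp_all add: AT)
  moreover have "t2 = - ((\<Sum>i<n. B (\<xi> (e i)) (B (\<xi> (e i)) \<tau>\<xi>) + K \<tau>\<xi> (\<xi> (e i)) (\<xi> (e i)))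
      - (\<Sum>i<n. B (\<xi> (hom.A (e i) (e i))) \<tau>\<xi>))"
    unfolding t2_def hom.\<gamma>_def sum_subtractf[symmetric] assms(7,8) \<xi> \<tau> by (simp add: algebra_simps)
  ultimately have 3: "\<tau>2\<xi> = - (\<Sum>i<n. B (\<xi> (e i)) (B (\<xi> (e i)) \<tau>\<xi>) + K \<tau>\<xi> (\<xi> (e i)) (\<xi> (e i))) + B (\<xi> Ug) \<tau>\<xi>"
    unfolding \<tau>2 by simp
  have 4: "biharmonic M g N h \<phi> \<longleftrightarrow> \<tau>2\<xi> = 0"
    unfolding biharmonic_def \<tau>2
    using hom.bitension_eq[folded t2_def] hom.ltr_eq_0_iff[OF hom.\<phi>_hom(2) t2_in] hom.dom.closedG(1) by metis
  show ?thesis using 1 h2 3 4 by blast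
qed

end
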